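(* Let $D\subset\overline{\mathbb R}^d$ be a closed cone, let $(\tau,\theta)$ be polar coordinates in $\mathbb R^d\setminus D$ with unit sphere $S$, let $\alpha>0$, and let $\nu$ be a measure of regular variation with exponent $\alpha$ on $\overline{\mathbb R}^d\setminus D$, with spectral measure $\sigma$ on $S$. A random vector $Y$ in $\mathbb R^d\setminus D$ has an $(f,\nu)$-implicit extreme value law (for some $f$) if and only if, for some measurable $g:S\to[0,\infty)$ with $\int_S g^\alpha(\theta)\,\sigma(d\theta)=1$, $$Y\stackrel{d}{=}Z\,\frac{\Theta}{g(\Theta)},$$ where $Z$ is standard $\alpha$-Fréchet and $\Theta$ is a random vector independent of $Z$, taking values in $S$ and having distribution $\sigma_g(d\theta):=g^\alpha(\theta)\,\sigma(d\theta)$. Moreover, the function $g$ in this representation is unique modulo $\sigma$-null sets and, when $Y$ is the limit $a_n^{-1}X_{k(n)}\Rightarrow Y$ under Assumptions RV, H, F and C for the function $f$, it is given by $g(\theta)=C^{-1/\alpha}f(\theta)$, $\theta\in S$, where $C=\nu\{f>1\}=\int_S f(\theta)^\alpha\,\sigma(d\theta)$. (Note that $P(g(\Theta)=0)=0$, so the representation is well defined.)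
   Context: $\overline{\mathbb R}=[-\infty,\infty]$ carries its usual compact topology and $\overline{\mathbb R}^d$ the product topology. A set $D\subset\overline{\mathbb R}^d$ is a (positive) cone if $\lambda D\subset D$ for all $\lambda>0$. For a closed cone $D$, put $\overline{\mathbb R}^d_D:=\overline{\mathbb R}^d\setminus D$ with the relative topology. A subset of $\overline{\mathbb R}^d_D$ is bounded away from $D$ if it is contained in the complement of an open neighbourhood of $D$ in $\overline{\mathbb R}^d$; it is compact iff it is closed in $\overline{\mathbb R}^d_D$ and bounded away from $D$. Radon measures on $\overline{\mathbb R}^d_D$ are Borel measures finite on compacts; $\nu_n\stackrel{v}{\to}\nu$ means $\int h\,d\nu_n\to\int h\,d\nu$ for every continuous $h:\overline{\mathbb R}^d_D\to\mathbb R$ vanishing outside some compact set. Regular variation: a random vector $X$ in $\mathbb R^d$ satisfies $X\in RV_\alpha(\{a_n\},D,\nu)$ if $\nu$ is a non-trivial Radon measure on $\overline{\mathbb R}^d_D$ supported on $\mathbb R^d\setminus D$, $a_n>0$ is a regularly varying sequence with exponent $1/\alpha$, and $nP(a_n^{-1}X\in\cdot)\stackrel{v}{\to}\nu$. Such a $\nu$ (a measure of regular variation with exponent $\alpha$) satisfies $\nu(\lambda\,\cdot)=\lambda^{-\alpha}\nu(\cdot)$ for all $\lambda>0$. Polar coordinates: let $\tau:\overline{\mathbb R}^d\to[0,\infty]$ be continuous with $\{\tau=0\}=D$, $\tau(x)<\infty$ for $x\in\mathbb R^d$, and $\tau(\lambda x)=\lambda\tau(x)$ for all $\lambda>0$,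 $x\in\overline{\mathbb R}^d$. The polar coordinates of $x\in\mathbb R^d\setminus D$ are $(\tau(x),\theta(x))$ with $\theta(x)=x/\tau(x)$; the unit sphere is $S=\{\tau=1\}\cap\mathbb R^d$. The spectral measure of $\nu$ is the finite measure $\sigma$ on $S$ given by $\sigma(B)=\nu\{x:\tau(x)>1,\ \theta(x)\in B\}$; it satisfies $\nu(A)=\int_S\int_0^\infty 1_A(\tau\theta)\,\alpha\tau^{-\alpha-1}\,d\tau\,\sigma(d\theta)$ for measurable $A\subset\mathbb R^d\setminus D$. Assumptions. (RV) $X\in RV_\alpha(\{a_n\},D,\nu)$ and $\nu(\overline{\mathbb R}^d\setminus(\mathbb R^d\cup D))=0$. (H) $f:\overline{\mathbb R}^d\to[0,\infty]$ is Borel measurable, $f(x)<\infty$ for $x\in\mathbb R^d$, $f(0)=0$, and $f(\lambda x)=\lambda f(x)$ for all $\lambda>0$ and $x\neq0$. (F) For all $\epsilon>0$ the set $\{f>\epsilon\}$ is bounded away from $D$, and $\inf_{x\in K}f(x)>0$ for every compact $K\subset\overline{\mathbb R}^d_D$. (C) $\nu(\overline{\mathrm{Disc}(f)})=0$, where $\overline{\mathrm{Disc}(f)}$ is the closure in $\overline{\mathbb R}^d_D$ of the set of discontinuity points of $f$. Implicit extreme value laws: let $X_1,X_2,\dots$ be independent copies of $X$ and let $k(n)$ be the smallest index $k\in\{1,\dots,n\}$ with $f(X_k)=\max_{1\le i\le n}f(X_i)$. Under Assumptions RV, H, F and C one has $a_n^{-1}X_{k(n)}\Rightarrow Y$ in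 distribution as $n\to\infty$, where $P_Y(dx)=e^{-Cf(x)^{-\alpha}}\,\nu(dx)$ with $C=\nu\{f>1\}=\int_S f(\theta)^\alpha\,\sigma(d\theta)<\infty$. The limits arising in this way are called $(f,\nu)$-implicit extreme value laws. A random variable $Z$ is standard $\alpha$-Fréchet if $P(Z\le x)=e^{-x^{-\alpha}}$, $x>0$.
   Formalization: In the equivalence, an (f,ν)-implicit extreme value law is a limit of a_n^{-1}X_{k(n)} with law e^{-Cf^{-α}}ν(dx), C finite, under RV and H only; F and C are dropped there because they force f to be bounded and bounded away from 0 on S, so the converse would fail for general g. *)

theory Defs
  imports "HOL-Probability.Probability"
begin

text \<open>
  The compactified space is the type \<open>'d \<Rightarrow> ereal\<close> with its product topology;
  \<open>emb\<close> embeds the finite points \<open>real ^ 'd\<close>.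
\<close>

definition emb :: "real ^ 'd \<Rightarrow> ('d::finite \<Rightarrow> ereal)" where
  "emb x = (\<lambda>i. ereal (x $ i))"

definition unemb :: "('d \<Rightarrow> ereal) \<Rightarrow> real ^ 'd::finite" where
  "unemb x = (\<chi> i. real_of_ereal (x i))"

definition dilate :: "real \<Rightarrow> ('d \<Rightarrow> ereal) \<Rightarrow> ('d::finite \<Rightarrow> ereal)" where
  "dilate c x = (\<lambda>i. ereal c * x i)"

definition is_cone :: "('d::finite \<Rightarrow> ereal) set \<Rightarrow> bool" where
  "is_cone D \<longleftrightarrow> (\<forall>c>0. dilate c ` D \<subseteq> D)"

definition bounded_away :: "('d::finite \<Rightarrow> ereal) set \<Rightarrow> ('d \<Rightarrow> ereal) set \<Rightarrow> bool" where
  "bounded_away D A \<longleftrightarrow> (\<exists>U. open U \<and> D \<subseteq> U \<and> A \<subseteq> - U)"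

text \<open>
  A measure on the complement of \<open>D\<close> lives on the trace of the Borel sigma-algebra on \<open>- D\<close>.
  A set is compact in the relative topology of \<open>- D\<close> iff it is a compact subset of the whole
  space that is contained in \<open>- D\<close>.
\<close>

definition radon_off :: "('d::finite \<Rightarrow> ereal) set \<Rightarrow> ('d \<Rightarrow> ereal) measure \<Rightarrow> bool" where
  "radon_off D \<nu> \<longleftrightarrow>
     sets \<nu> = sets (restrict_space borel (- D)) \<and>
     (\<forall>K. compact K \<and> K \<subseteq> - D \<longrightarrow> emeasure \<nu> K < \<infinity>)"

definition vague_conv ::
  "('d::finite \<Rightarrow> ereal) set \<Rightarrow> (nat \<Rightarrow> ('d \<Rightarrow> ereal) measure) \<Rightarrow> ('d \<Rightarrow> ereal) measure \<Rightarrow> bool" where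
  "vague_conv D \<nu>s \<nu> \<longleftrightarrow>
     (\<forall>h :: ('d \<Rightarrow> ereal) \<Rightarrow> real.
        continuous_on (- D) h \<and>
        (\<exists>K. compact K \<and> K \<subseteq> - D \<and> (\<forall>x \<in> - D - K. h x = 0)) \<longrightarrow>
        (\<lambda>n. integral\<^sup>L (\<nu>s n) h) \<longlonglongrightarrow> integral\<^sup>L \<nu> h)"

definition conv_in_distr ::
  "(nat \<Rightarrow> (real ^ 'd::finite) measure) \<Rightarrow> (real ^ 'd) measure \<Rightarrow> bool" where
  "conv_in_distr \<mu>s \<mu> \<longleftrightarrow>
     (\<forall>h :: real ^ 'd \<Rightarrow> real. continuous_on UNIV h \<and> bounded (range h) \<longrightarrow>
        (\<lambda>n. integral\<^sup>L (\<mu>s n) h) \<longlonglongrightarrow> integral\<^sup>L \<mu> h)"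

definition regularly_varying_seq :: "real \<Rightarrow> (nat \<Rightarrow> real) \<Rightarrow> bool" where
  "regularly_varying_seq \<rho> a \<longleftrightarrow>
     (\<forall>c>0. (\<lambda>n. a (nat \<lfloor>c * real n\<rfloor>) / a n) \<longlonglongrightarrow> c powr \<rho>)"

text \<open>
  \<open>X \<in> RV\<^sub>\<alpha>({a\<^sub>n}, D, \<nu>)\<close>.  Sequences are indexed from 1, the value \<open>a 0\<close> plays no role.
\<close>

definition regularly_varying ::
  "real \<Rightarrow> (nat \<Rightarrow> real) \<Rightarrow> ('d::finite \<Rightarrow> ereal) set \<Rightarrow> ('d \<Rightarrow> ereal) measure \<Rightarrow>
   'a measure \<Rightarrow> ('a \<Rightarrow> real ^ 'd) \<Rightarrow> bool" where
  "regularly_varying \<alpha> a D \<nu> M X \<longleftrightarrow>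
     prob_space M \<and> X \<in> borel_measurable M \<and>
     radon_off D \<nu> \<and>
     emeasure \<nu> (space \<nu>) \<noteq> 0 \<and>
     emeasure \<nu> (space \<nu> - range emb) = 0 \<and>
     (\<forall>n\<ge>1. a n > 0) \<and>
     regularly_varying_seq (1 / \<alpha>) a \<and>
     vague_conv D
       (\<lambda>n. scale_measure (of_nat n)
              (restrict_space (distr M borel (\<lambda>\<omega>. emb (X \<omega> /\<^sub>R a n))) (- D))) \<nu>"

text \<open>
  Only the law of \<open>X\<close> matters, so \<open>real ^ 'd\<close> is a sufficiently large sample space.
\<close>

definition measure_of_regular_variation ::
  "real \<Rightarrow> ('d::finite \<Rightarrow> ereal) set \<Rightarrow> ('d \<Rightarrow> ereal) measure \<Rightarrow> bool" where
  "measure_of_regular_variation \<alpha> D \<nu> \<longleftrightarrow>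
     (\<exists>(M :: (real ^ 'd) measure) X a. regularly_varying \<alpha> a D \<nu> M X)"

definition radial_function ::
  "('d::finite \<Rightarrow> ereal) set \<Rightarrow> (('d \<Rightarrow> ereal) \<Rightarrow> ennreal) \<Rightarrow> bool" where
  "radial_function D \<tau> \<longleftrightarrow>
     continuous_on UNIV \<tau> \<and>
     {x. \<tau> x = 0} = D \<and>
     (\<forall>x. \<tau> (emb x) < \<infinity>) \<and>
     (\<forall>c>0. \<forall>x. \<tau> (dilate c x) = ennreal c * \<tau> x)"

definition angle :: "(('d::finite \<Rightarrow> ereal) \<Rightarrow> ennreal) \<Rightarrow> real ^ 'd \<Rightarrow> real ^ 'd" where
  "angle \<tau> x = x /\<^sub>R enn2real (\<tau> (emb x))"

definition tau_sphere :: "(('d::finite \<Rightarrow> ereal) \<Rightarrow> ennreal) \<Rightarrow> (real ^ 'd) set" where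
  "tau_sphere \<tau> = {s. \<tau> (emb s) = 1}"

text \<open>
  \<open>\<sigma>(B) = \<nu> {x \<in> \<real>\<^sup>d - D. \<tau> x > 1 \<and> \<theta> x \<in> B}\<close> for Borel subsets \<open>B\<close> of the sphere.
\<close>

definition spectral_measure ::
  "(('d::finite \<Rightarrow> ereal) \<Rightarrow> ennreal) \<Rightarrow> ('d \<Rightarrow> ereal) measure \<Rightarrow> (real ^ 'd) measure" where
  "spectral_measure \<tau> \<nu> =
     distr (restrict_space \<nu> {x \<in> space \<nu>. x \<in> range emb \<and> \<tau> x > 1})
           (restrict_space borel (tau_sphere \<tau>))
           (\<lambda>x. angle \<tau> (unemb x))"

definition assumption_H :: "(('d::finite \<Rightarrow> ereal) \<Rightarrow> ennreal) \<Rightarrow> bool" where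
  "assumption_H f \<longleftrightarrow>
     f \<in> borel_measurable borel \<and>
     (\<forall>x. f (emb x) < \<infinity>) \<and>
     f (emb 0) = 0 \<and>
     (\<forall>c>0. \<forall>x. x \<noteq> emb 0 \<longrightarrow> f (dilate c x) = ennreal c * f x)"

definition assumption_F ::
  "('d::finite \<Rightarrow> ereal) set \<Rightarrow> (('d \<Rightarrow> ereal) \<Rightarrow> ennreal) \<Rightarrow> bool" where
  "assumption_F D f \<longleftrightarrow>
     (\<forall>\<epsilon>>0. bounded_away D {x. f x > \<epsilon>}) \<and>
     (\<forall>K. compact K \<and> K \<subseteq> - D \<longrightarrow> (INF x\<in>K. f x) > 0)"

definition assumption_C ::
  "('d::finite \<Rightarrow> ereal) set \<Rightarrow> ('d \<Rightarrow> ereal) measure \<Rightarrow> (('d \<Rightarrow> ereal) \<Rightarrow> ennreal) \<Rightarrow> bool" where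
  "assumption_C D \<nu> f \<longleftrightarrow>
     emeasure \<nu> (closure {x \<in> - D. \<not> (f \<longlongrightarrow> f x) (at x within - D)} \<inter> - D) = 0"

definition independent_copies ::
  "'a measure \<Rightarrow> ('a \<Rightarrow> real ^ 'd::finite) \<Rightarrow> (nat \<Rightarrow> 'a \<Rightarrow> real ^ 'd) \<Rightarrow> bool" where
  "independent_copies M X Xs \<longleftrightarrow>
     prob_space.indep_vars M (\<lambda>_. borel) Xs {1..} \<and>
     (\<forall>i\<ge>1. distr M borel (Xs i) = distr M borel X)"

definition argmax_index ::
  "(('d::finite \<Rightarrow> ereal) \<Rightarrow> ennreal) \<Rightarrow> (nat \<Rightarrow> 'a \<Rightarrow> real ^ 'd) \<Rightarrow> nat \<Rightarrow> 'a \<Rightarrow> nat" where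
  "argmax_index f Xs n \<omega> =
     (LEAST k. k \<in> {1..n} \<and> f (emb (Xs k \<omega>)) = (MAX i\<in>{1..n}. f (emb (Xs i \<omega>))))"

text \<open>
  \<open>Xs\<close> are independent copies of \<open>X \<in> RV\<^sub>\<alpha>({a\<^sub>n}, D, \<nu>)\<close> and the normalized implicit extremes
  \<open>X\<^bsub>k(n)\<^esub> / a\<^sub>n\<close> converge in distribution to \<open>\<mu>\<close>.
\<close>

definition implicit_extremes_limit ::
  "real \<Rightarrow> (nat \<Rightarrow> real) \<Rightarrow> ('d::finite \<Rightarrow> ereal) set \<Rightarrow> (('d \<Rightarrow> ereal) \<Rightarrow> ennreal) \<Rightarrow>
   ('d \<Rightarrow> ereal) measure \<Rightarrow> 'a measure \<Rightarrow> ('a \<Rightarrow> real ^ 'd) \<Rightarrow> (nat \<Rightarrow> 'a \<Rightarrow> real ^ 'd) \<Rightarrow>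
   (real ^ 'd) measure \<Rightarrow> bool" where
  "implicit_extremes_limit \<alpha> a D f \<nu> M X Xs \<mu> \<longleftrightarrow>
     regularly_varying \<alpha> a D \<nu> M X \<and>
     independent_copies M X Xs \<and>
     conv_in_distr
       (\<lambda>n. distr M borel (\<lambda>\<omega>. Xs (argmax_index f Xs n \<omega>) \<omega> /\<^sub>R a n)) \<mu>"

definition level_const :: "(('d::finite \<Rightarrow> ereal) \<Rightarrow> ennreal) \<Rightarrow> ('d \<Rightarrow> ereal) measure \<Rightarrow> ennreal" where
  "level_const f \<nu> = emeasure \<nu> {x \<in> space \<nu>. f x > 1}"

text \<open>
  The density \<open>exp (- C f(x)\<^sup>-\<^sup>\<alpha>)\<close> is 0 where \<open>f\<close> vanishes; the case distinction is needed
  because \<open>0 powr b = 0\<close>.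
\<close>

definition implicit_ev_density ::
  "real \<Rightarrow> (('d::finite \<Rightarrow> ereal) \<Rightarrow> ennreal) \<Rightarrow> ('d \<Rightarrow> ereal) measure \<Rightarrow> ('d \<Rightarrow> ereal) \<Rightarrow> ennreal" where
  "implicit_ev_density \<alpha> f \<nu> x =
     (if f x = 0 then 0
      else ennreal (exp (- enn2real (level_const f \<nu>) * enn2real (f x) powr (- \<alpha>))))"

text \<open>
  \<open>\<mu>\<close> (a law on the finite points, with no mass on \<open>D\<close>) is an \<open>(f, \<nu>)\<close>-implicit extreme value
  law: the limit in distribution of normalized implicit extremes, with
  \<open>\<mu>(dx) = exp (- C f(x)\<^sup>-\<^sup>\<alpha>) \<nu>(dx)\<close> and \<open>C = \<nu> {f > 1} < \<infinity>\<close>.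
  The loss \<open>f\<close> is only required to be measurable and homogeneous.  Assumptions F and C, which are
  sufficient for the convergence, are deliberately not part of the notion: they force \<open>f\<close> to be
  bounded and bounded away from 0 on the sphere and almost everywhere continuous, whereas the
  representation admits every measurable \<open>g\<close>.
\<close>

definition implicit_ev_law ::
  "real \<Rightarrow> ('d::finite \<Rightarrow> ereal) set \<Rightarrow> (('d \<Rightarrow> ereal) \<Rightarrow> ennreal) \<Rightarrow> ('d \<Rightarrow> ereal) measure \<Rightarrow>
   (real ^ 'd) measure \<Rightarrow> bool" where
  "implicit_ev_law \<alpha> D f \<nu> \<mu> \<longleftrightarrow>
     assumption_H f \<and>
     level_const f \<nu> < \<infinity> \<and>
     (\<exists>(M :: (nat \<Rightarrow> real ^ 'd) measure) X Xs a. implicit_extremes_limit \<alpha> a D f \<nu> M X Xs \<mu>) \<and>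
     restrict_space (distr \<mu> borel emb) (- D) = density \<nu> (implicit_ev_density \<alpha> f \<nu>)"

definition standard_frechet :: "real \<Rightarrow> 'a measure \<Rightarrow> ('a \<Rightarrow> real) \<Rightarrow> bool" where
  "standard_frechet \<alpha> Q Z \<longleftrightarrow>
     Z \<in> borel_measurable Q \<and>
     (\<forall>x>0. measure Q {\<omega> \<in> space Q. Z \<omega> \<le> x} = exp (- (x powr (- \<alpha>))))"

definition tilted_measure ::
  "real \<Rightarrow> (real ^ 'd::finite \<Rightarrow> real) \<Rightarrow> (real ^ 'd) measure \<Rightarrow> (real ^ 'd) measure" where
  "tilted_measure \<alpha> g \<sigma> = density \<sigma> (\<lambda>\<theta>. ennreal (g \<theta> powr \<alpha>))"

definition admissible_g ::
  "real \<Rightarrow> (('d::finite \<Rightarrow> ereal) \<Rightarrow> ennreal) \<Rightarrow> ('d \<Rightarrow> ereal) measure \<Rightarrow> (real ^ 'd \<Rightarrow> real) \<Rightarrow> bool"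
  where
  "admissible_g \<alpha> \<tau> \<nu> g \<longleftrightarrow>
     g \<in> borel_measurable (restrict_space borel (tau_sphere \<tau>)) \<and>
     (\<forall>\<theta>\<in>tau_sphere \<tau>. g \<theta> \<ge> 0) \<and>
     (\<integral>\<^sup>+ \<theta>. ennreal (g \<theta> powr \<alpha>) \<partial>spectral_measure \<tau> \<nu>) = 1"

text \<open>
  \<open>\<mu>\<close> is the law of \<open>Z \<Theta> / g(\<Theta>)\<close>.  The sample space \<open>real \<times> real ^ 'd\<close> is large enough to
  carry the pair \<open>(Z, \<Theta>)\<close>.  Independence is stated through the generated sigma-algebras because
  \<open>indep_var\<close> forces both variables to have the same type.
\<close>

definition polar_representation ::
  "real \<Rightarrow> (('d::finite \<Rightarrow> ereal) \<Rightarrow> ennreal) \<Rightarrow> ('d \<Rightarrow> ereal) measure \<Rightarrow> (real ^ 'd) measure \<Rightarrow>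
   (real ^ 'd \<Rightarrow> real) \<Rightarrow> bool" where
  "polar_representation \<alpha> \<tau> \<nu> \<mu> g \<longleftrightarrow>
     admissible_g \<alpha> \<tau> \<nu> g \<and>
     (\<exists>(Q :: (real \<times> real ^ 'd) measure) Z \<Theta>.
        prob_space Q \<and>
        standard_frechet \<alpha> Q Z \<and>
        \<Theta> \<in> measurable Q (restrict_space borel (tau_sphere \<tau>)) \<and>
        distr Q (restrict_space borel (tau_sphere \<tau>)) \<Theta>
          = tilted_measure \<alpha> g (spectral_measure \<tau> \<nu>) \<and>
        prob_space.indep_set Q
          {Z -` A \<inter> space Q | A. A \<in> sets borel}
          {\<Theta> -` B \<inter> space Q | B. B \<in> sets (restrict_space borel (tau_sphere \<tau>))} \<and>
        \<mu> = distr Q borel (\<lambda>\<omega>. Z \<omega> *\<^sub>R (\<Theta> \<omega> /\<^sub>R g (\<Theta> \<omega>))))"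

end

theory Submission
  imports Defs
begin

text \<open>
  A measure of regular variation is homogeneous, \<open>\<nu>(\<lambda> A) = \<lambda>\<^sup>-\<^sup>\<alpha> \<nu>(A)\<close>, so in polar coordinates it is the
  product of \<open>\<alpha> t\<^sup>-\<^sup>\<alpha>\<^sup>-\<^sup>1 dt\<close> and the spectral measure \<open>\<sigma>\<close>. On each ray \<open>f(t \<theta>) = t f(\<theta>)\<close>, hence the
  substitution \<open>z = t g(\<theta>)\<close> with \<open>g = C\<^sup>-\<^sup>1\<^sup>/\<^sup>\<alpha> f\<close> turns \<open>exp(- C f(x)\<^sup>-\<^sup>\<alpha>) \<nu>(dx)\<close> into the law of
  \<open>Z \<Theta> / g(\<Theta>)\<close>; conversely every \<open>g\<close> extends homogeneously to a loss function with \<open>C = 1\<close>, and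
  \<open>g\<close> can be recovered from the density.

  For the convergence of implicit extremes it suffices to bound the limit from below, because the
  candidate limit already has mass 1. The bound comes from the event that the maximum of the loss is
  attained at one index only, and it involves \<open>P(f(X) < y)\<^sup>n\<^sup>-\<^sup>1\<close>, which tends to \<open>exp(- C y\<^sup>-\<^sup>\<alpha>)\<close>. For
  arbitrary measurable \<open>g\<close> one takes for \<open>X\<close> a normalized restriction of \<open>\<nu>\<close> itself and uses Fatou's
  lemma; under assumptions F and C the vague convergence is enough.
\<close>

section \<open>Test functions on the compactified space\<close>

text \<open>A lower bound suffices because it is applied to a test function u and to 1 - u together:
  the two bounds add up to 1 on both sides, so neither can be strict. The probability that all other
  losses are smaller has to be evaluated at the loss of the sample point itself, a level that varies
  with the point. Given laws obeying F and C therefore need a bound uniform in the level, whereas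
  for the law cut from \<nu> the exceedance probability is at most C y^(-\<alpha>) / n for every n.
  The two situations differ in what may be chosen: in the equivalence the sampling law is free,
  while for the formula g = C^(-1/\<alpha>) f the law of X and the sequence a_n are given.
  Homogeneity is not part of the definition of regular variation; it results from comparing the
  indices n and floor(b n) with b = c^(-\<alpha>). Vague convergence sees only functions supported
  away from D, so each approximation has to carry a compact support off D.\<close>

lemma compact_UNIV_ereal_fun: "compact (UNIV :: ('d::finite \<Rightarrow> ereal) set)"
proof -
  have "compact_space (product_topology (\<lambda>_::'d. euclidean :: ereal topology) UNIV)"
  proof -
    have "compact_space (euclidean :: ereal topology)"
      using compact_UNIV by (simp add: compact_space_def)
    then show ?thesis by (simp add: compact_space_product_topology)
  qed
  then show ?thesis
    by (simp add: euclidean_product_topology compact_space_def)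
qed

lemma compact_closed_ereal_fun: "closed A \<Longrightarrow> compact (A :: ('d::finite \<Rightarrow> ereal) set)"
  using compact_Int_closed[OF compact_UNIV_ereal_fun, of A] by simp

definition arctan_ereal :: "ereal \<Rightarrow> real" where
  "arctan_ereal x = (if x = \<infinity> then pi / 2 else if x = -\<infinity> then - pi / 2 else arctan (real_of_ereal x))"

lemma arctan_ereal_simps [simp]:
  "arctan_ereal (ereal r) = arctan r" "arctan_ereal (\<infinity>::ereal) = pi / 2" "arctan_ereal (-\<infinity>::ereal) = - pi / 2"
  by (simp_all add: arctan_ereal_def)

lemma strict_mono_arctan_ereal: "strict_mono arctan_ereal"
proof (rule strict_monoI)
  fix x y :: ereal assume xy: "x < y"
  have b: "- pi / 2 < arctan r" "arctan r < pi / 2" for r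
    using arctan_lbound arctan_ubound by auto
  have "- pi / 2 < pi / 2" using pi_gt_zero by linarith
  then show "arctan_ereal x < arctan_ereal y"
    using xy b by (cases x; cases y) (simp_all add: arctan_monotone)
qed

lemma arctan_ereal_bounds: "- pi / 2 \<le> arctan_ereal x" "arctan_ereal x \<le> pi / 2"
proof -
  have b: "- pi / 2 \<le> arctan r" "arctan r \<le> pi / 2" for r
    using arctan_lbound[of r] arctan_ubound[of r] by linarith+
  have "- pi / 2 \<le> pi / 2" using pi_gt_zero by linarith
  then show "- pi / 2 \<le> arctan_ereal x" "arctan_ereal x \<le> pi / 2"
    using b by (cases x; simp)+
qed

lemma arctan_ereal_tan: "\<lbrakk>- pi / 2 < b; b < pi / 2\<rbrakk> \<Longrightarrow> arctan_ereal (ereal (tan b)) = b"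
  by (simp add: arctan_tan)

text \<open>Any value strictly between a bound inside the interval and \<open>arctan_ereal x\<close>
  is attained at a finite point \<open>tan b\<close>, and the half-line cut off at that point is a
  neighbourhood of \<open>x\<close>. Bounds outside the interval hold everywhere.\<close>

lemma continuous_arctan_ereal: "continuous_on UNIV arctan_ereal"
  unfolding continuous_on_def
proof safe
  fix x :: ereal
  show "(arctan_ereal \<longlongrightarrow> arctan_ereal x) (at x)"
  proof (rule order_tendstoI)
    fix a assume a: "a < arctan_ereal x"
    have "\<exists>y. y < x \<and> a < arctan_ereal y \<or> (\<forall>z. a < arctan_ereal z)"
    proof (cases "a < - pi / 2")
      case True
      then show ?thesis using arctan_ereal_bounds(1) less_le_trans by blast
    next
      case False
      define b where "b = (a + arctan_ereal x) / 2"
      have b: "a < b" "b < arctan_ereal x" using a by (auto simp: b_def field_simps)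
      have eq: "arctan_ereal (ereal (tan b)) = b"
        using b False arctan_ereal_bounds(2)[of x] by (intro arctan_ereal_tan) linarith+
      then have "ereal (tan b) < x"
        using b strict_mono_less[OF strict_mono_arctan_ereal, of "ereal (tan b)" x] by metis
      then show ?thesis using b(1) eq by metis
    qed
    then show "\<forall>\<^sub>F y in at x. a < arctan_ereal y"
    proof (elim exE disjE conjE)
      fix y assume y: "y < x" "a < arctan_ereal y"
      have "\<forall>\<^sub>F z in at x. y < z" using y(1) by (rule order_tendstoD[OF tendsto_ident_at])
      then show ?thesis
        by eventually_elim (use y(2) strict_monoD[OF strict_mono_arctan_ereal] less_trans in blast)
    qed auto
  next
    fix a assume a: "a > arctan_ereal x"
    have "\<exists>y. y > x \<and> a > arctan_ereal y \<or> (\<forall>z. a > arctan_ereal z)"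
    proof (cases "a > pi / 2")
      case True
      then show ?thesis using arctan_ereal_bounds(2) le_less_trans by blast
    next
      case False
      define b where "b = (a + arctan_ereal x) / 2"
      have b: "a > b" "b > arctan_ereal x" using a by (auto simp: b_def field_simps)
      have eq: "arctan_ereal (ereal (tan b)) = b"
        using b False arctan_ereal_bounds(1)[of x] by (intro arctan_ereal_tan) linarith+
      then have "ereal (tan b) > x"
        using b strict_mono_less[OF strict_mono_arctan_ereal, of x "ereal (tan b)"] by metis
      then show ?thesis using b(1) eq by metis
    qed
    then show "\<forall>\<^sub>F y in at x. a > arctan_ereal y"
    proof (elim exE disjE conjE)
      fix y assume y: "y > x" "a > arctan_ereal y"
      have "\<forall>\<^sub>F z in at x. y > z" using y(1) by (rule order_tendstoD[OF tendsto_ident_at])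
      then show ?thesis
        by eventually_elim (use y(2) strict_monoD[OF strict_mono_arctan_ereal] less_trans in blast)
    qed auto
  qed
qed

text \<open>An embedding of the compactified space into a metric space; through it the distance to a
  closed set becomes available.\<close>

definition squash :: "('d::finite \<Rightarrow> ereal) \<Rightarrow> real ^ 'd" where
  "squash x = (\<chi> i. arctan_ereal (x i))"

lemma continuous_squash: "continuous_on UNIV squash"
  unfolding squash_def
  by (intro continuous_on_vec_lambda continuous_on_compose2[OF continuous_arctan_ereal]
      continuous_on_product_then_coordinatewise[OF continuous_on_id]) auto

lemma inj_squash: "inj squash"
  by (rule injI) (simp add: squash_def vec_eq_iff fun_eq_iff
      strict_mono_eq[OF strict_mono_arctan_ereal])

text \<open>\<open>squash\<close> is injective and continuous into a metric space, so
  \<open>K\<close> is the preimage of its own compact, hence closed, image.\<close>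

lemma compact_imp_closed_ereal_fun:
  fixes K :: "('d::finite \<Rightarrow> ereal) set"
  assumes "compact K"
  shows "closed K"
proof -
  have "closed (squash ` K)"
    by (intro compact_imp_closed compact_continuous_image assms
        continuous_on_subset[OF continuous_squash]) auto
  then have "closed (squash -` squash ` K)"
    using continuous_squash by (rule closed_vimage)
  then show ?thesis
    by (simp add: inj_vimage_image_eq[OF inj_squash])
qed

definition gap :: "('d::finite \<Rightarrow> ereal) set \<Rightarrow> ('d \<Rightarrow> ereal) \<Rightarrow> real" where
  "gap K x = infdist (squash x) (squash ` K)"

lemma continuous_gap: "continuous_on UNIV (gap K)"
  unfolding gap_def by (intro continuous_intros continuous_squash)

lemma gap_nonneg [simp]: "gap K x \<ge> 0"
  by (simp add: gap_def infdist_nonneg)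

text \<open>\<open>infdist\<close> to the empty set is 0, hence the assumption that \<open>K\<close>
  is non-empty. For \<open>K = D\<close> it is supplied by \<open>emb_0_in_D\<close>.\<close>

lemma gap_eq_0_iff:
  assumes "closed K" "K \<noteq> {}"
  shows "gap K x = 0 \<longleftrightarrow> x \<in> K"
proof -
  have "closed (squash ` K)"
    by (intro compact_imp_closed compact_continuous_image compact_closed_ereal_fun assms
        continuous_on_subset[OF continuous_squash]) auto
  then have "gap K x = 0 \<longleftrightarrow> squash x \<in> squash ` K"
    using assms in_closed_iff_infdist_zero[of "squash ` K" "squash x"] by (auto simp: gap_def)
  then show ?thesis
    using inj_squash by (auto simp: inj_def)
qed

text \<open>Only test functions that extend continuously by 0 to all of the compact space are needed.\<close>

definition test_fun :: "('d::finite \<Rightarrow> ereal) set \<Rightarrow> (('d \<Rightarrow> ereal) \<Rightarrow> real) \<Rightarrow> bool" where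
  "test_fun D h \<longleftrightarrow> continuous_on UNIV h \<and> (\<forall>x. 0 \<le> h x \<and> h x \<le> 1) \<and>
     (\<exists>K. compact K \<and> K \<subseteq> - D \<and> (\<forall>x. x \<notin> K \<longrightarrow> h x = 0))"

lemma test_funD:
  assumes "test_fun D h"
  shows "continuous_on UNIV h" "0 \<le> h x" "h x \<le> 1" "h \<in> borel_measurable borel"
    "x \<in> D \<Longrightarrow> h x = 0"
  using assms by (auto simp: test_fun_def intro: borel_measurable_continuous_onI)

text \<open>Subtracting 1 makes the function vanish wherever \<open>real j * gap (- U) x\<close> is
  at most 1. Its support is then contained in a closed, hence compact, subset of \<open>U\<close>
  instead of reaching up to the boundary.\<close>

definition open_approx :: "('d::finite \<Rightarrow> ereal) set \<Rightarrow> nat \<Rightarrow> ('d \<Rightarrow> ereal) \<Rightarrow> real" where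
  "open_approx U j x = max 0 (min 1 (real j * gap (- U) x - 1))"

lemma open_approx:
  assumes "open U" "U \<subseteq> - D" "D \<noteq> {}"
  shows test_fun_open_approx: "test_fun D (open_approx U j)"
    and open_approx_outside: "x \<notin> U \<Longrightarrow> open_approx U j x = 0"
    and incseq_open_approx: "incseq (\<lambda>j. open_approx U j x)"
    and open_approx_tendsto: "(\<lambda>j. open_approx U j x) \<longlonglongrightarrow> indicator U x"
proof -
  have U: "closed (- U)" "- U \<noteq> {}" using assms by auto
  note gap = gap_eq_0_iff[OF U]
  have cont: "continuous_on UNIV (open_approx U j)"
    unfolding open_approx_def by (intro continuous_intros continuous_gap)
  let ?K = "{x. 1 \<le> real j * gap (- U) x}"
  have "closed ?K"
    using continuous_on_closed_Collect_le[OF continuous_on_const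
        continuous_on_mult[OF continuous_on_const continuous_gap] closed_UNIV, of 1 "real j" "- U"] by simp
  then have "compact ?K" by (rule compact_closed_ereal_fun)
  moreover have "?K \<subseteq> - D"
  proof
    fix x assume "x \<in> ?K"
    then have "gap (- U) x \<noteq> 0" by auto
    then show "x \<in> - D" using gap[of x] assms(2) by auto
  qed
  moreover have "\<forall>x. x \<notin> ?K \<longrightarrow> open_approx U j x = 0" by (auto simp: open_approx_def)
  ultimately show "test_fun D (open_approx U j)"
    unfolding test_fun_def using cont by (auto simp: open_approx_def)
  show "x \<notin> U \<Longrightarrow> open_approx U j x = 0"
    using gap[of x] by (simp add: open_approx_def)
  show "incseq (\<lambda>j. open_approx U j x)"
    unfolding open_approx_def
    by (intro incseq_SucI max.mono min.mono diff_mono mult_right_mono order_refl) auto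
  show "(\<lambda>j. open_approx U j x) \<longlonglongrightarrow> indicator U x"
  proof (cases "x \<in> U")
    case False
    then show ?thesis using gap[of x] by (simp add: open_approx_def)
  next
    case True
    then have pos: "gap (- U) x > 0" using gap[of x] gap_nonneg[of "-U" x] by (auto simp del: gap_nonneg)
    obtain j0 :: nat where j0: "2 / gap (- U) x \<le> real j0" using real_arch_simple by blast
    have "open_approx U j x = 1" if "j \<ge> j0" for j
    proof -
      have "2 / gap (- U) x \<le> real j" using j0 that by linarith
      then show ?thesis using pos by (simp add: open_approx_def field_simps)
    qed
    then have "\<forall>\<^sub>F j in sequentially. open_approx U j x = 1"
      by (auto simp: eventually_sequentially)
    then show ?thesis using True by (simp add: tendsto_eventually)
  qed
qed

text \<open>The compact set \<open>K\<close> keeps a positive distance from \<open>D\<close>, so one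
  member of the sequence \<open>open_approx (- D)\<close> already equals 1 on all of
  \<open>K\<close>.\<close>

lemma urysohn_test_fun:
  assumes "closed D" "D \<noteq> {}" "compact K" "K \<subseteq> - D"
  obtains h where "test_fun D h" "\<And>x. x \<in> K \<Longrightarrow> h x = 1"
proof (cases "K = {}")
  case True
  have "test_fun D (\<lambda>_. 0)" by (auto simp: test_fun_def intro!: exI[of _ "{}"])
  then show ?thesis using that True by auto
next
  case False
  obtain x0 where x0: "x0 \<in> K" "\<And>x. x \<in> K \<Longrightarrow> gap D x0 \<le> gap D x"
    using continuous_attains_inf[OF assms(3) False continuous_on_subset[OF continuous_gap]] by blast
  have "gap D x0 \<noteq> 0" using gap_eq_0_iff[OF assms(1,2)] x0(1) assms(4) by blast
  then have pos: "gap D x0 > 0" using gap_nonneg[of D x0] by linarith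
  \<comment> \<open>The numerator 2 makes up for the 1 subtracted in
    \<open>open_approx\<close>.\<close>
  obtain j :: nat where j: "2 / gap D x0 \<le> real j" using real_arch_simple by blast
  have "open_approx (- D) j x = 1" if "x \<in> K" for x
  proof -
    have "2 \<le> real j * gap D x0" using j pos by (simp add: field_simps)
    also have "\<dots> \<le> real j * gap D x" using x0(2)[OF that] by (simp add: mult_left_mono)
    finally show ?thesis by (simp add: open_approx_def)
  qed
  then show ?thesis using that test_fun_open_approx[of "-D" D j] assms by auto
qed

text \<open>Tents of slope \<open>j\<close> around \<open>K\<close>, multiplied by a Urysohn
  function \<open>h\<close>. The tents alone can be positive on \<open>D\<close>; the factor
  \<open>h\<close> gives compact support off \<open>D\<close>, and \<open>v 0 = h\<close> is the
  integrable majorant for dominated convergence.\<close>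

lemma decreasing_test_funs:
  assumes "closed D" "D \<noteq> {}" "compact K" "K \<subseteq> - D"
  obtains v :: "nat \<Rightarrow> ('d::finite \<Rightarrow> ereal) \<Rightarrow> real"
  where "\<And>j. test_fun D (v j)" "\<And>j x. x \<in> K \<Longrightarrow> v j x = 1" "\<And>j x. v j x \<le> v 0 x"
    "\<And>x. (\<lambda>j. v j x) \<longlonglongrightarrow> indicator K x"
proof (cases "K = {}")
  case True
  have "test_fun D (\<lambda>_. 0)" by (auto simp: test_fun_def intro!: exI[of _ "{}"])
  then show ?thesis using that[of "\<lambda>_ _. 0"] True by auto
next
  case False
  obtain h where h: "test_fun D h" "\<And>x. x \<in> K \<Longrightarrow> h x = 1"
    using urysohn_test_fun[OF assms] by blast
  have closed: "closed K" using assms(3) by (rule compact_imp_closed_ereal_fun)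
  note gap = gap_eq_0_iff[OF closed False]
  define v where "v = (\<lambda>(j::nat) x. h x * max 0 (1 - real j * gap K x))"
  show ?thesis
  proof (rule that[of v])
    show "test_fun D (v j)" for j
    proof -
      from h(1) obtain L where L: "compact L" "L \<subseteq> - D" "\<forall>x. x \<notin> L \<longrightarrow> h x = 0"
        by (auto simp: test_fun_def)
      have "continuous_on UNIV (v j)"
        unfolding v_def by (intro continuous_intros continuous_gap test_funD(1)[OF h(1)])
      moreover have "0 \<le> v j x \<and> v j x \<le> 1" for x
        using test_funD(2,3)[OF h(1), of x] by (auto simp: v_def intro!: mult_le_one)
      ultimately show ?thesis
        unfolding test_fun_def using L by (auto simp: v_def intro!: exI[of _ L])
    qed
    show "x \<in> K \<Longrightarrow> v j x = 1" for j x using gap[of x] h(2) by (simp add: v_def)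
    show "v j x \<le> v 0 x" for j x
      using test_funD(2)[OF h(1), of x] by (auto simp: v_def intro!: mult_left_le)
    show "(\<lambda>j. v j x) \<longlonglongrightarrow> indicator K x" for x
    proof (cases "x \<in> K")
      case True
      then show ?thesis using gap[of x] h(2) by (simp add: v_def)
    next
      case x: False
      then have pos: "gap K x > 0" using gap[of x] gap_nonneg[of K x] by (auto simp del: gap_nonneg)
      obtain j0 :: nat where j0: "1 / gap K x \<le> real j0" using real_arch_simple by blast
      have "v j x = 0" if "j \<ge> j0" for j
      proof -
        have "1 / gap K x \<le> real j" using j0 that by linarith
        then show ?thesis using pos by (simp add: v_def field_simps)
      qed
      then have "\<forall>\<^sub>F j in sequentially. v j x = 0" by (auto simp: eventually_sequentially)
      then show ?thesis using x by (simp add: tendsto_eventually)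
    qed
  qed
qed

section \<open>Scaling of measures of regular variation\<close>

lemma range_emb_eq: "range (emb :: real ^ 'd \<Rightarrow> 'd::finite \<Rightarrow> ereal) = {x. \<forall>i. x i \<noteq> \<infinity> \<and> x i \<noteq> -\<infinity>}"
proof (safe)
  fix x :: "'d \<Rightarrow> ereal" assume *: "\<forall>i. x i \<noteq> \<infinity> \<and> x i \<noteq> -\<infinity>"
  have "x = emb (unemb x)"
    using * by (simp add: emb_def unemb_def fun_eq_iff) (metis real_of_ereal.simps(1) ereal_cases)
  then show "x \<in> range emb" by blast
qed (auto simp: emb_def)

lemma unemb_emb [simp]: "unemb (emb x) = x"
  by (simp add: emb_def unemb_def vec_eq_iff)

lemma emb_inject [simp]: "emb x = emb y \<longleftrightarrow> x = y"
  by (metis unemb_emb)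

lemma continuous_emb: "continuous_on UNIV (emb :: real ^ 'd \<Rightarrow> 'd::finite \<Rightarrow> ereal)"
  unfolding emb_def by (intro continuous_intros)

lemma measurable_emb [measurable]: "emb \<in> borel_measurable borel"
  by (intro borel_measurable_continuous_onI continuous_emb)

lemma measurable_component_borel [measurable]:
  "(\<lambda>x. x i) \<in> borel_measurable (borel :: ('d::finite \<Rightarrow> ereal) measure)"
  by (intro borel_measurable_continuous_onI continuous_on_product_then_coordinatewise[OF continuous_on_id])

lemma measurable_unemb [measurable]: "unemb \<in> borel_measurable (borel :: ('d::finite \<Rightarrow> ereal) measure)"
proof -
  have "(\<lambda>x. \<Sum>i\<in>UNIV. real_of_ereal (x i) *\<^sub>R axis i (1::real)) \<in> borel_measurable (borel :: ('d \<Rightarrow> ereal) measure)"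
    by measurable
  also have "(\<lambda>x. \<Sum>i\<in>UNIV. real_of_ereal (x i) *\<^sub>R axis i (1::real)) = (unemb :: ('d \<Rightarrow> ereal) \<Rightarrow> _)"
    by (auto simp: fun_eq_iff unemb_def vec_eq_iff axis_def if_distrib cong: if_cong)
  finally show ?thesis .
qed

lemma range_emb_borel [measurable]: "range (emb :: real ^ 'd \<Rightarrow> 'd::finite \<Rightarrow> ereal) \<in> sets borel"
  unfolding range_emb_eq by measurable

lemma dilate_emb: "dilate c (emb x) = emb (c *\<^sub>R x)"
  by (simp add: dilate_def emb_def)

lemma dilate_dilate: "0 < b \<Longrightarrow> dilate a (dilate b x) = dilate (a * b) x"
  by (simp add: dilate_def mult.assoc[symmetric] times_ereal.simps(1)[symmetric] del: times_ereal.simps(1))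

lemma dilate_1 [simp]: "dilate 1 x = x"
  by (simp add: dilate_def one_ereal_def[symmetric])

text \<open>Joint continuity, on a compact space of points, is what makes the estimate of
  \<open>uniform_dilate\<close> uniform. Finite positive factors avoid the products of 0 and
  infinity at which multiplication on \<open>ereal\<close> is discontinuous.\<close>

lemma continuous_dilate_prod:
  "continuous_on ({0<..} \<times> UNIV) (\<lambda>p. dilate (fst p) (snd p) :: 'd::finite \<Rightarrow> ereal)"
  unfolding dilate_def
proof (rule continuous_on_coordinatewise_then_product)
  fix i :: 'd
  have 1: "continuous_on ({0<..} \<times> UNIV) (\<lambda>p :: real \<times> ('d \<Rightarrow> ereal). ereal (fst p))"
    by (intro continuous_intros)
  have 2: "continuous_on ({0<..} \<times> UNIV) (\<lambda>p :: real \<times> ('d \<Rightarrow> ereal). snd p i)"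
    by (rule continuous_on_product_then_coordinatewise[OF continuous_on_snd[OF continuous_on_id]])
  show "continuous_on ({0<..} \<times> UNIV) (\<lambda>p :: real \<times> ('d \<Rightarrow> ereal). ereal (fst p) * snd p i)"
    using 1 2 unfolding continuous_on_def by (auto intro!: tendsto_mult_ereal)
qed

lemma continuous_dilate:
  assumes "0 < c"
  shows "continuous_on UNIV (dilate c :: ('d::finite \<Rightarrow> ereal) \<Rightarrow> _)"
proof -
  have "continuous_on UNIV (\<lambda>x. dilate (fst (c, x)) (snd (c, x)) :: 'd \<Rightarrow> ereal)"
    using assms by (intro continuous_on_compose2[OF continuous_dilate_prod, of UNIV "\<lambda>x. (c, x)"])
      (intro continuous_on_Pair continuous_on_const continuous_on_id, auto)
  then show ?thesis by simp
qed

lemma measurable_dilate: "0 < c \<Longrightarrow> dilate c \<in> borel_measurable borel"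
  by (intro borel_measurable_continuous_onI continuous_dilate)

definition scaled_law ::
  "('d::finite \<Rightarrow> ereal) set \<Rightarrow> (nat \<Rightarrow> real) \<Rightarrow> 'a measure \<Rightarrow> ('a \<Rightarrow> real ^ 'd) \<Rightarrow> nat \<Rightarrow> ('d \<Rightarrow> ereal) measure"
  where "scaled_law D a M X n = scale_measure (of_nat n)
     (restrict_space (distr M borel (\<lambda>\<omega>. emb (X \<omega> /\<^sub>R a n))) (- D))"

locale polar_space =
  fixes D :: "('d::finite \<Rightarrow> ereal) set" and \<tau> :: "('d \<Rightarrow> ereal) \<Rightarrow> ennreal"
  assumes closed_D: "closed D" and radial: "radial_function D \<tau>"
begin

lemma continuous_tau: "continuous_on UNIV \<tau>"
  and tau_eq_0: "\<tau> x = 0 \<longleftrightarrow> x \<in> D"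
  and tau_emb: "\<tau> (emb y) < \<infinity>"
  and tau_dilate: "c > 0 \<Longrightarrow> \<tau> (dilate c x) = ennreal c * \<tau> x"
  using radial by (auto simp: radial_function_def)

lemma measurable_tau [measurable]: "\<tau> \<in> borel_measurable borel"
  by (intro borel_measurable_continuous_onI continuous_tau)

lemma D_borel [measurable]: "D \<in> sets borel"
  using closed_D by simp

text \<open>The origin is fixed by dilation, so its finite radius equals its own double and
  vanishes.\<close>

lemma emb_0_in_D: "emb 0 \<in> D"
proof -
  have "\<tau> (emb 0) = 2 * \<tau> (emb 0)"
    using tau_dilate[of 2 "emb 0"] by (simp add: dilate_emb)
  moreover have "\<tau> (emb 0) < \<infinity>" by (rule tau_emb)
  ultimately have "\<tau> (emb 0) = 0"
    by (cases "\<tau> (emb 0)") (auto simp: ennreal_mult[symmetric] ennreal_numeral[symmetric] simp del: ennreal_numeral)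
  then show ?thesis by (simp add: tau_eq_0)
qed

lemma D_nonempty: "D \<noteq> {}"
  using emb_0_in_D by blast

lemma dilate_in_D_iff: "c > 0 \<Longrightarrow> dilate c x \<in> D \<longleftrightarrow> x \<in> D"
  by (simp add: tau_eq_0[symmetric] tau_dilate)

lemma space_off: "sets \<nu> = sets (restrict_space borel (- D)) \<Longrightarrow> space \<nu> = - D"
  by (simp add: sets_eq_imp_space_eq[of \<nu>] space_restrict_space)

lemma measurable_off: "sets \<nu> = sets (restrict_space borel (- D)) \<Longrightarrow> f \<in> measurable borel N \<Longrightarrow> f \<in> measurable \<nu> N"
  by (subst measurable_cong_sets[of \<nu> "restrict_space borel (- D)" N N]) (auto intro: measurable_restrict_space1)

lemma sets_off: "sets \<nu> = sets (restrict_space borel (- D)) \<Longrightarrow> A \<in> sets \<nu> \<longleftrightarrow> A \<in> sets borel \<and> A \<subseteq> - D"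
  by (auto simp: sets_restrict_space_iff)

lemma compact_superlevel: "0 < b \<Longrightarrow> compact {x. b \<le> \<tau> x}" and superlevel_subset: "0 < b \<Longrightarrow> {x. b \<le> \<tau> x} \<subseteq> - D"
  using closed_Collect_le[OF continuous_on_const continuous_tau, of b]
  by (auto intro: compact_closed_ereal_fun simp: tau_eq_0[symmetric])

lemma integrable_test_fun:
  assumes \<nu>: "radon_off D \<nu>" and h: "test_fun D h"
  shows "integrable \<nu> h" "(\<integral>\<^sup>+x. ennreal (h x) \<partial>\<nu>) = ennreal (\<integral>x. h x \<partial>\<nu>)"
proof -
  from h obtain K where K: "compact K" "K \<subseteq> - D" "\<forall>x. x \<notin> K \<longrightarrow> h x = 0"
    by (auto simp: test_fun_def)
  have sets: "sets \<nu> = sets (restrict_space borel (- D))" using \<nu> by (simp add: radon_off_def)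
  have "K \<in> sets \<nu>"
    using K compact_imp_closed_ereal_fun[of K] by (simp add: sets_off[OF sets])
  moreover have "emeasure \<nu> K < \<infinity>" using \<nu> K by (auto simp: radon_off_def)
  moreover have "h \<in> borel_measurable \<nu>" by (intro measurable_off[OF sets] test_funD(4)[OF h])
  ultimately show int: "integrable \<nu> h"
    using K test_funD(2,3)[OF h] by (intro integrableI_bounded_set[of K _ _ 1]) auto
  show "(\<integral>\<^sup>+x. ennreal (h x) \<partial>\<nu>) = ennreal (\<integral>x. h x \<partial>\<nu>)"
    using test_funD(2)[OF h] by (intro nn_integral_eq_integral int) auto
qed

lemma emeasure_open_eq_limit:
  assumes sets: "sets \<nu> = sets (restrict_space borel (- D))" and U: "open U" "U \<subseteq> - D"
  shows "(\<lambda>j. \<integral>\<^sup>+x. ennreal (open_approx U j x) \<partial>\<nu>) \<longlonglongrightarrow> emeasure \<nu> U"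
proof -
  note U' = U D_nonempty
  have "(\<lambda>j. \<integral>\<^sup>+x. ennreal (open_approx U j x) \<partial>\<nu>) \<longlonglongrightarrow> (\<integral>\<^sup>+x. indicator U x \<partial>\<nu>)"
  proof (rule nn_integral_LIMSEQ)
    show "incseq (\<lambda>j x. ennreal (open_approx U j x))"
      using incseq_open_approx[OF U'] by (auto simp: incseq_def le_fun_def intro!: ennreal_leI)
    show "(\<lambda>x. ennreal (open_approx U j x)) \<in> borel_measurable \<nu>" for j
      using test_funD(4)[OF test_fun_open_approx[OF U']] by (intro measurable_compose[OF measurable_off[OF sets] measurable_ennreal]) auto
    show "(\<lambda>j. ennreal (open_approx U j x)) \<longlonglongrightarrow> indicator U x" for x
      using tendsto_ennrealI[OF open_approx_tendsto[OF U', of x]] by (simp add: ennreal_indicator)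
  qed
  also have "(\<integral>\<^sup>+x. indicator U x \<partial>\<nu>) = emeasure \<nu> U"
    using U by (intro nn_integral_indicator) (simp add: sets_off[OF sets])
  finally show ?thesis .
qed

text \<open>As \<open>D\<close> is closed, the open subsets of \<open>- D\<close> are an
  intersection-stable generator of the trace sigma-algebra. The superlevel sets of
  \<open>\<tau>\<close> exhaust \<open>- D\<close> and lie in compact sets, which gives the
  finiteness that uniqueness requires.\<close>

lemma measure_off_eqI_open:
  assumes \<nu>: "radon_off D \<nu>" and sets': "sets \<nu>' = sets (restrict_space borel (- D))"
    and eq: "\<And>U. open U \<Longrightarrow> U \<subseteq> - D \<Longrightarrow> emeasure \<nu> U = emeasure \<nu>' U"
  shows "\<nu> = \<nu>'"
proof -
  have sets: "sets \<nu> = sets (restrict_space borel (- D))" using \<nu> by (simp add: radon_off_def)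
  let ?E = "{U. open U \<and> U \<subseteq> - D}"
  have "sigma_sets (- D) ?E = sets (restrict_space borel (- D))"
  proof -
    have "?E = (\<inter>) (- D) ` Collect open"
    proof safe
      fix U assume "open U" "U \<subseteq> - D"
      then show "U \<in> (\<inter>) (- D) ` Collect open" by (intro image_eqI[of _ _ U]) auto
    qed (use closed_D in \<open>auto intro: open_Int\<close>)
    moreover have "sets borel = sigma_sets UNIV (Collect open :: ('d \<Rightarrow> ereal) set set)"
      unfolding borel_def by (simp add: sets_measure_of)
    moreover have "- D \<in> sets borel" using D_borel by (rule borel_comp)
    ultimately show ?thesis
      by (simp add: sets_restrict_space sigma_sets_Int)
  qed
  note gen = this
  define A where "A = (\<lambda>j::nat. {x. ennreal (1 / Suc j) < \<tau> x})"
  show ?thesis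
  proof (rule measure_eqI_generator_eq[where E = ?E and \<Omega> = "- D" and A = A])
    show "Int_stable ?E" by (auto simp: Int_stable_def)
    show "?E \<subseteq> Pow (- D)" by auto
    show "range A \<subseteq> ?E"
    proof safe
      fix j show "open (A j)"
        unfolding A_def by (intro open_Collect_less continuous_on_const continuous_tau)
      fix x assume "x \<in> A j" "x \<in> D"
      then show False using tau_eq_0[of x] by (auto simp: A_def)
    qed
    show "(\<Union>j. A j) = - D"
    proof safe
      fix x assume "x \<notin> D"
      then have "\<tau> x > 0" using tau_eq_0[of x] by (simp add: zero_less_iff_neq_zero)
      show "x \<in> (\<Union>j. A j)"
      proof (cases "\<tau> x")
        case (real r)
        then have "r > 0" using \<open>\<tau> x > 0\<close> by simp
        then obtain j where "inverse (real (Suc j)) < r" using reals_Archimedean by blast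
        then show ?thesis using real by (auto simp: A_def ennreal_less_iff inverse_eq_divide)
      qed (auto simp: A_def)
    next
      fix x j assume "x \<in> A j" "x \<in> D"
      then show False using tau_eq_0[of x] by (auto simp: A_def)
    qed
    show "emeasure \<nu> (A j) \<noteq> \<infinity>" for j
    proof -
      let ?K = "{x. ennreal (1 / Suc j) \<le> \<tau> x}"
      have K: "compact ?K" "?K \<subseteq> - D" by (intro compact_superlevel superlevel_subset; simp)+
      then have "?K \<in> sets \<nu>"
        using compact_imp_closed_ereal_fun[of ?K] by (simp add: sets_off[OF sets])
      then have "emeasure \<nu> (A j) \<le> emeasure \<nu> ?K"
        by (intro emeasure_mono) (auto simp: A_def)
      also have "\<dots> < \<infinity>" using \<nu> K by (auto simp: radon_off_def)
      finally show ?thesis by simp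
    qed
  qed (use eq gen sets sets' in auto)
qed

lemma radon_off_eqI:
  assumes \<nu>: "radon_off D \<nu>" and \<nu>': "radon_off D \<nu>'"
    and eq: "\<And>h. test_fun D h \<Longrightarrow> (\<integral>x. h x \<partial>\<nu>) = (\<integral>x. h x \<partial>\<nu>')"
  shows "\<nu> = \<nu>'"
proof (rule measure_off_eqI_open[OF \<nu>])
  show sets': "sets \<nu>' = sets (restrict_space borel (- D))" using \<nu>' by (simp add: radon_off_def)
  fix U :: "('d \<Rightarrow> ereal) set" assume U: "open U" "U \<subseteq> - D"
  have "(\<integral>\<^sup>+x. ennreal (open_approx U j x) \<partial>\<nu>) = (\<integral>\<^sup>+x. ennreal (open_approx U j x) \<partial>\<nu>')" for j
    using eq[of "open_approx U j"] test_fun_open_approx[OF U D_nonempty, of j]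
    by (simp add: integrable_test_fun[OF \<nu>] integrable_test_fun[OF \<nu>'])
  then show "emeasure \<nu> U = emeasure \<nu>' U"
    using emeasure_open_eq_limit[OF _ U, of \<nu>] emeasure_open_eq_limit[OF sets' U] \<nu>
    by (intro LIMSEQ_unique) (auto simp: radon_off_def)
qed

lemma test_fun_dilate:
  assumes c: "c > 0" and h: "test_fun D h"
  shows "test_fun D (\<lambda>x. h (dilate c x))"
proof -
  from h obtain K where K: "compact K" "K \<subseteq> - D" "\<forall>x. x \<notin> K \<longrightarrow> h x = 0"
    by (auto simp: test_fun_def)
  have "continuous_on UNIV (\<lambda>x. h (dilate c x))"
    by (intro continuous_on_compose2[OF test_funD(1)[OF h] continuous_dilate] c) auto
  moreover have "compact (dilate c -` K)"
    by (rule compact_closed_ereal_fun[OF closed_vimage[OF compact_imp_closed_ereal_fun[OF K(1)] continuous_dilate[OF c]]])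
  moreover have "dilate c -` K \<subseteq> - D" using K(2) dilate_in_D_iff[OF c] by blast
  ultimately show ?thesis
    using test_funD(2,3)[OF h] K(3) unfolding test_fun_def
    by (intro conjI allI exI[of _ "dilate c -` K"]) auto
qed

text \<open>Uniform closeness alone is of no use against measures whose total mass may grow without
  bound. The error is therefore dominated by \<epsilon> times one fixed test function
  \<open>v\<close>, chosen before \<epsilon>.\<close>

lemma uniform_dilate:
  assumes c: "c > 0" and h: "test_fun D h"
  obtains v where "test_fun D v"
    "\<And>\<epsilon>. \<epsilon> > 0 \<Longrightarrow> \<forall>\<^sub>F s in nhds c. \<forall>x. \<bar>h (dilate s x) - h (dilate c x)\<bar> \<le> \<epsilon> * v x"
proof -
  from h obtain K where K: "compact K" "K \<subseteq> - D" "\<forall>x. x \<notin> K \<longrightarrow> h x = 0"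
    by (auto simp: test_fun_def)
  obtain t where t: "t > 0" "\<And>x. x \<in> K \<Longrightarrow> t \<le> \<tau> x"
  proof (cases "K = {}")
    case False
    obtain x0 where x0: "x0 \<in> K" "\<And>x. x \<in> K \<Longrightarrow> \<tau> x0 \<le> \<tau> x"
      using continuous_attains_inf[OF K(1) False continuous_on_subset[OF continuous_tau]] by blast
    moreover have "\<tau> x0 > 0" using x0(1) K(2) tau_eq_0[of x0] by (auto simp: zero_less_iff_neq_zero)
    ultimately show ?thesis using that by blast
  qed (use that[of 1] in auto)
  \<comment> \<open>For \<open>s < 2 * c\<close> a point with
    \<open>\<tau> (dilate (2 * c) x) < t\<close> is sent off \<open>K\<close> by the dilations with
    \<open>s\<close> and with \<open>c\<close>, so both values of \<open>h\<close> are 0 outside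
    this set.\<close>
  let ?L = "dilate (2 * c) -` {x. t \<le> \<tau> x}"
  have L: "compact ?L" "?L \<subseteq> - D"
  proof -
    show "compact ?L" using c
      by (intro compact_closed_ereal_fun closed_vimage continuous_dilate
          compact_imp_closed_ereal_fun[OF compact_superlevel[OF t(1)]]) auto
    show "?L \<subseteq> - D" using superlevel_subset[OF t(1)] dilate_in_D_iff[of "2 * c"] c by auto
  qed
  obtain v where v: "test_fun D v" "\<And>x. x \<in> ?L \<Longrightarrow> v x = 1"
    using urysohn_test_fun[OF closed_D D_nonempty L] by blast
  have cont: "continuous_on ({0<..} \<times> UNIV) (\<lambda>p. h (dilate (fst p) (snd p)))"
    by (rule continuous_on_compose2[OF test_funD(1)[OF h] continuous_dilate_prod]) auto
  show ?thesis
  proof (rule that[OF v(1)])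
    fix \<epsilon> :: real assume \<epsilon>: "\<epsilon> > 0"
    obtain X0 where X0: "c \<in> X0" "open X0"
      "\<forall>s\<in>X0 \<inter> {0<..}. \<forall>x\<in>UNIV. dist (h (dilate (fst (s, x)) (snd (s, x)))) (h (dilate (fst (c, x)) (snd (c, x)))) \<le> \<epsilon>"
      using continuous_on_prod_compactE[OF cont compact_UNIV_ereal_fun _ \<epsilon>, of c] c by auto
    have "\<forall>\<^sub>F s in nhds c. s \<in> X0" using X0 by (simp add: eventually_nhds_in_open)
    moreover have "\<forall>\<^sub>F s in nhds c. s \<in> {0<..}"
      using c by (intro eventually_nhds_in_open) auto
    moreover have "\<forall>\<^sub>F s in nhds c. s \<in> {..<2 * c}" using c by (intro eventually_nhds_in_open) auto
    ultimately show "\<forall>\<^sub>F s in nhds c. \<forall>x. \<bar>h (dilate s x) - h (dilate c x)\<bar> \<le> \<epsilon> * v x"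
    proof eventually_elim
      case (elim s)
      have s: "s > 0" "s < 2 * c" using elim by auto
      show ?case
      proof
        fix x
        show "\<bar>h (dilate s x) - h (dilate c x)\<bar> \<le> \<epsilon> * v x"
        proof (cases "x \<in> ?L")
          case True
          then show ?thesis using elim(1,2) X0(3) v(2)[of x] by (auto simp: dist_real_def)
        next
          case False
          then have less: "\<not> t \<le> ennreal (2 * c) * \<tau> x" using c by (simp add: tau_dilate)
          have "dilate r x \<notin> K" if "0 < r" "r \<le> 2 * c" for r
          proof
            assume "dilate r x \<in> K"
            then have "t \<le> ennreal r * \<tau> x" using t(2) that by (metis tau_dilate)
            also have "\<dots> \<le> ennreal (2 * c) * \<tau> x"
              using that by (intro mult_right_mono ennreal_leI) auto
            finally show False using less by blast
          qed
          then have "h (dilate s x) = 0" "h (dilate c x) = 0" using s c K(3) by auto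
          then show ?thesis using test_funD(2)[OF v(1), of x] \<epsilon> by simp
        qed
      qed
    qed
  qed
qed

lemma sets_scaled_law: "sets (scaled_law D a M X n) = sets (restrict_space borel (- D))"
  by (simp add: scaled_law_def cong: sets_restrict_space_cong)

lemma nn_integral_scaled_law:
  assumes X: "X \<in> borel_measurable M" and G: "G \<in> borel_measurable borel"
  shows "(\<integral>\<^sup>+x. G x \<partial>scaled_law D a M X n) =
    of_nat n * (\<integral>\<^sup>+\<omega>. G (emb (X \<omega> /\<^sub>R a n)) * indicator (- D) (emb (X \<omega> /\<^sub>R a n)) \<partial>M)"
proof -
  note [measurable] = X G
  let ?d = "distr M borel (\<lambda>\<omega>. emb (X \<omega> /\<^sub>R a n))"
  have "G \<in> borel_measurable (restrict_space ?d (- D))"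
    by (intro measurable_restrict_space1) measurable
  then have "(\<integral>\<^sup>+x. G x \<partial>scaled_law D a M X n) = of_nat n * (\<integral>\<^sup>+x. G x * indicator (- D) x \<partial>?d)"
    unfolding scaled_law_def by (simp add: nn_integral_scale_measure nn_integral_restrict_space)
  also have "(\<integral>\<^sup>+x. G x * indicator (- D) x \<partial>?d) =
      (\<integral>\<^sup>+\<omega>. G (emb (X \<omega> /\<^sub>R a n)) * indicator (- D) (emb (X \<omega> /\<^sub>R a n)) \<partial>M)"
    by (rule nn_integral_distr) measurable
  finally show ?thesis .
qed

lemma integral_scaled_law:
  assumes X: "X \<in> borel_measurable M" and h: "test_fun D h"
  shows "(\<integral>x. h x \<partial>scaled_law D a M X n) = real n * (\<integral>\<omega>. h (emb (X \<omega> /\<^sub>R a n)) \<partial>M)"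
proof -
  note [measurable] = X test_funD(4)[OF h]
  have "(\<integral>x. h x \<partial>scaled_law D a M X n) = enn2real (\<integral>\<^sup>+x. ennreal (h x) \<partial>scaled_law D a M X n)"
    using test_funD(2)[OF h] by (intro integral_eq_nn_integral measurable_off[OF sets_scaled_law]) auto
  also have "(\<integral>\<^sup>+x. ennreal (h x) \<partial>scaled_law D a M X n) =
      of_nat n * (\<integral>\<^sup>+\<omega>. ennreal (h (emb (X \<omega> /\<^sub>R a n))) * indicator (- D) (emb (X \<omega> /\<^sub>R a n)) \<partial>M)"
    by (intro nn_integral_scaled_law) measurable
  also have "(\<integral>\<^sup>+\<omega>. ennreal (h (emb (X \<omega> /\<^sub>R a n))) * indicator (- D) (emb (X \<omega> /\<^sub>R a n)) \<partial>M) =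
      (\<integral>\<^sup>+\<omega>. ennreal (h (emb (X \<omega> /\<^sub>R a n))) \<partial>M)"
    using test_funD(5)[OF h] by (intro nn_integral_cong) (auto simp: indicator_def)
  finally have "(\<integral>x. h x \<partial>scaled_law D a M X n) = real n * enn2real (\<integral>\<^sup>+\<omega>. ennreal (h (emb (X \<omega> /\<^sub>R a n))) \<partial>M)"
    by (simp add: enn2real_mult)
  also have "enn2real (\<integral>\<^sup>+\<omega>. ennreal (h (emb (X \<omega> /\<^sub>R a n))) \<partial>M) = (\<integral>\<omega>. h (emb (X \<omega> /\<^sub>R a n)) \<partial>M)"
    using test_funD(2)[OF h] by (intro integral_eq_nn_integral[symmetric]) auto
  finally show ?thesis .
qed

lemma regularly_varying_test_fun:
  assumes "regularly_varying \<alpha> a D \<nu> M X" and h: "test_fun D h"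
  shows "(\<lambda>n. real n * (\<integral>\<omega>. h (emb (X \<omega> /\<^sub>R a n)) \<partial>M)) \<longlonglongrightarrow> (\<integral>x. h x \<partial>\<nu>)"
proof -
  from h obtain K where "compact K" "K \<subseteq> - D" "\<forall>x. x \<notin> K \<longrightarrow> h x = 0"
    by (auto simp: test_fun_def)
  moreover have "continuous_on (- D) h" by (rule continuous_on_subset[OF test_funD(1)[OF h]]) simp
  ultimately have "(\<lambda>n. \<integral>x. h x \<partial>scaled_law D a M X n) \<longlonglongrightarrow> (\<integral>x. h x \<partial>\<nu>)"
    using assms(1) unfolding regularly_varying_def vague_conv_def scaled_law_def by blast
  then show ?thesis
    using assms(1) by (simp add: integral_scaled_law[OF _ h] regularly_varying_def)
qed

text \<open>\<open>X / a (m n)\<close> is \<open>X / a n\<close> dilated by \<open>s n\<close>, and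
  \<open>m n / n\<close> tends to \<open>b\<close>. The limit along \<open>m\<close> thus evaluates
  \<open>h\<close> after a dilation whose factor tends to \<open>c\<close>, at the price of the
  factor \<open>b\<close>; \<open>uniform_dilate\<close> replaces \<open>s n\<close> by
  \<open>c\<close>.\<close>

lemma regularly_varying_scaling_test_fun:
  assumes rv: "regularly_varying \<alpha> a D \<nu> M X" and \<alpha>: "\<alpha> > 0" and h: "test_fun D h" and c: "c > 0"
  shows "(\<integral>x. h (dilate c x) \<partial>\<nu>) = c powr \<alpha> * (\<integral>x. h x \<partial>\<nu>)"
proof -
  have X [measurable]: "X \<in> borel_measurable M" and a: "\<And>n. n \<ge> 1 \<Longrightarrow> a n > 0"
    and rvs: "regularly_varying_seq (1 / \<alpha>) a" and "prob_space M"
    using rv by (auto simp: regularly_varying_def)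
  interpret prob_space M by fact
  note [measurable] = test_funD(4)[OF h]
  \<comment> \<open>Chosen so that \<open>b powr (1 / \<alpha>) = 1 / c\<close>, hence
    \<open>a (m n) / a n\<close> tends to \<open>1 / c\<close>.\<close>
  define b where "b = c powr (- \<alpha>)"
  have b: "b > 0" using c by (simp add: b_def)
  define m where "m = (\<lambda>n. nat \<lfloor>b * real n\<rfloor>)"
  define s where "s = (\<lambda>n. a n / a (m n))"
  define Y where "Y = (\<lambda>n \<omega>. emb (X \<omega> /\<^sub>R a n))"
  have Y [measurable]: "Y n \<in> borel_measurable M" for n unfolding Y_def by measurable
  define E where "E = (\<lambda>h n. real n * (\<integral>\<omega>. h (Y n \<omega>) \<partial>M))"
  have E: "E h \<longlonglongrightarrow> (\<integral>x. h x \<partial>\<nu>)" if "test_fun D h" for h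
    using regularly_varying_test_fun[OF rv that] by (simp add: E_def Y_def)
  have mlim: "(\<lambda>n. real (m n) / real n) \<longlonglongrightarrow> b"
    unfolding m_def using b by real_asymp
  have mtop: "filterlim m at_top sequentially"
    unfolding m_def using b by real_asymp
  have "(\<lambda>n. a (m n) / a n) \<longlonglongrightarrow> b powr (1 / \<alpha>)"
    using rvs b by (simp add: regularly_varying_seq_def m_def)
  also have "b powr (1 / \<alpha>) = inverse c"
    using c \<alpha> by (simp add: b_def powr_powr) (simp add: powr_minus divide_inverse)
  finally have "(\<lambda>n. inverse (a (m n) / a n)) \<longlonglongrightarrow> inverse (inverse c)"
    using c by (intro tendsto_inverse) auto
  then have slim: "s \<longlonglongrightarrow> c" by (simp add: s_def inverse_eq_divide)
  have ev: "\<forall>\<^sub>F n in sequentially. n \<ge> 1 \<and> m n \<ge> 1"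
    using eventually_ge_at_top[of 1] mtop by (auto simp: filterlim_at_top eventually_conj_iff)
  have eq: "E h (m n) = real (m n) / real n * (real n * (\<integral>\<omega>. h (dilate (s n) (Y n \<omega>)) \<partial>M))"
    if "n \<ge> 1" "m n \<ge> 1" for n
  proof -
    have "Y (m n) \<omega> = dilate (s n) (Y n \<omega>)" for \<omega>
      using a[OF that(1)] by (simp add: Y_def dilate_emb s_def divide_inverse)
    then show ?thesis using that by (simp add: E_def)
  qed
  have 1: "(\<lambda>n. real n * (\<integral>\<omega>. h (dilate (s n) (Y n \<omega>)) \<partial>M)) \<longlonglongrightarrow> (\<integral>x. h x \<partial>\<nu>) / b"
  proof (rule Lim_transform_eventually)
    have "(\<lambda>n. E h (m n)) \<longlonglongrightarrow> (\<integral>x. h x \<partial>\<nu>)"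
      using filterlim_compose[OF E[OF h] mtop] .
    then show "(\<lambda>n. E h (m n) / (real (m n) / real n)) \<longlonglongrightarrow> (\<integral>x. h x \<partial>\<nu>) / b"
      using b by (intro tendsto_divide mlim) auto
    show "\<forall>\<^sub>F n in sequentially. E h (m n) / (real (m n) / real n) = real n * (\<integral>\<omega>. h (dilate (s n) (Y n \<omega>)) \<partial>M)"
      using ev by eventually_elim (simp add: eq)
  qed
  have h': "test_fun D (\<lambda>x. h (dilate c x))" by (rule test_fun_dilate[OF c h])
  obtain v where v: "test_fun D v"
    "\<And>\<epsilon>. \<epsilon> > 0 \<Longrightarrow> \<forall>\<^sub>F s in nhds c. \<forall>x. \<bar>h (dilate s x) - h (dilate c x)\<bar> \<le> \<epsilon> * v x"
    using uniform_dilate[OF c h] by blast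
  have diff: "(\<lambda>n. real n * (\<integral>\<omega>. h (dilate (s n) (Y n \<omega>)) \<partial>M) - E (\<lambda>x. h (dilate c x)) n) \<longlonglongrightarrow> 0"
  proof (rule tendstoI)
    fix e :: real assume e: "e > 0"
    \<comment> \<open>\<open>B\<close> eventually bounds the scaled expectations of the majorant
      \<open>v\<close>; adding 1 keeps it positive even if \<open>v\<close> has integral 0.\<close>
    define B where "B = (\<integral>x. v x \<partial>\<nu>) + 1"
    have B: "B > 0" using test_funD(2)[OF v(1)] by (simp add: B_def add_nonneg_pos)
    have "\<forall>\<^sub>F n in sequentially. E v n < B"
      using order_tendstoD(2)[OF E[OF v(1)], of B] by (simp add: B_def)
    moreover have "\<forall>\<^sub>F n in sequentially. \<forall>x. \<bar>h (dilate (s n) x) - h (dilate c x)\<bar> \<le> e / (2 * B) * v x"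
      using eventually_compose_filterlim[OF v(2) slim, of "e / (2 * B)"] e B by simp
    moreover have "\<forall>\<^sub>F n in sequentially. s n > 0" using order_tendstoD(1)[OF slim c] .
    ultimately show "\<forall>\<^sub>F n in sequentially.
        dist (real n * (\<integral>\<omega>. h (dilate (s n) (Y n \<omega>)) \<partial>M) - E (\<lambda>x. h (dilate c x)) n) 0 < e"
    proof eventually_elim
      case (elim n)
      have int: "integrable M (\<lambda>\<omega>. h (dilate r (Y n \<omega>)))" if r: "r > 0" for r
      proof -
        note [measurable] = measurable_dilate[OF r]
        show ?thesis using test_funD(2,3)[OF h] by (intro integrable_const_bound[of _ 1]) auto
      qed
      have intv: "integrable M (\<lambda>\<omega>. v (Y n \<omega>))"
        using test_funD(2,3)[OF v(1)] measurable_compose[OF Y test_funD(4)[OF v(1)]]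
        by (intro integrable_const_bound[of _ 1]) auto
      have "\<bar>(\<integral>\<omega>. h (dilate (s n) (Y n \<omega>)) \<partial>M) - (\<integral>\<omega>. h (dilate c (Y n \<omega>)) \<partial>M)\<bar> =
          \<bar>\<integral>\<omega>. h (dilate (s n) (Y n \<omega>)) - h (dilate c (Y n \<omega>)) \<partial>M\<bar>"
        using int elim(3) c by (simp add: Bochner_Integration.integral_diff)
      also have "\<dots> \<le> (\<integral>\<omega>. \<bar>h (dilate (s n) (Y n \<omega>)) - h (dilate c (Y n \<omega>))\<bar> \<partial>M)"
        by (rule integral_abs_bound)
      also have "\<dots> \<le> (\<integral>\<omega>. e / (2 * B) * v (Y n \<omega>) \<partial>M)"
        using int elim(2,3) c intv by (intro integral_mono) auto
      also have "\<dots> = e / (2 * B) * (\<integral>\<omega>. v (Y n \<omega>) \<partial>M)" by simp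
      finally have "real n * \<bar>(\<integral>\<omega>. h (dilate (s n) (Y n \<omega>)) \<partial>M) - (\<integral>\<omega>. h (dilate c (Y n \<omega>)) \<partial>M)\<bar>
          \<le> real n * (e / (2 * B) * (\<integral>\<omega>. v (Y n \<omega>) \<partial>M))" by (intro mult_left_mono) auto
      also have "\<dots> = e / (2 * B) * E v n" by (simp add: E_def)
      also have "\<dots> \<le> e / (2 * B) * B" using elim(1) e B by (intro mult_left_mono) auto
      also have "\<dots> < e" using e B by simp
      finally show ?case
        by (simp add: dist_real_def E_def abs_mult[symmetric] right_diff_distrib[symmetric])
          (simp add: abs_mult)
    qed
  qed
  have "(\<lambda>n. real n * (\<integral>\<omega>. h (dilate (s n) (Y n \<omega>)) \<partial>M) -
      (real n * (\<integral>\<omega>. h (dilate (s n) (Y n \<omega>)) \<partial>M) - E (\<lambda>x. h (dilate c x)) n)) \<longlonglongrightarrow> (\<integral>x. h x \<partial>\<nu>) / b - 0"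
    by (intro tendsto_diff 1 diff)
  then have "E (\<lambda>x. h (dilate c x)) \<longlonglongrightarrow> (\<integral>x. h x \<partial>\<nu>) / b" by simp
  then have "(\<integral>x. h (dilate c x) \<partial>\<nu>) = (\<integral>x. h x \<partial>\<nu>) / b"
    using LIMSEQ_unique[OF E[OF h']] by blast
  then show ?thesis by (simp add: b_def powr_minus divide_inverse)
qed

text \<open>The image of \<nu> under dilation and the rescaled \<nu> are both finite on compact sets
  off \<open>D\<close>, since preimages of such sets under a dilation are of the same kind. They
  agree on test functions, which carries the identity over to every measurable
  \<open>G\<close>.\<close>

lemma regularly_varying_scaling:
  assumes rv: "regularly_varying \<alpha> a D \<nu> M X" and \<alpha>: "\<alpha> > 0" and c: "c > 0"
    and G: "G \<in> borel_measurable borel"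
  shows "(\<integral>\<^sup>+x. G (dilate c x) \<partial>\<nu>) = ennreal (c powr \<alpha>) * (\<integral>\<^sup>+x. G x \<partial>\<nu>)"
proof -
  have radon: "radon_off D \<nu>" using rv by (simp add: regularly_varying_def)
  then have sets: "sets \<nu> = sets (restrict_space borel (- D))" by (simp add: radon_off_def)
  have meas: "dilate c \<in> measurable \<nu> (restrict_space borel (- D))"
    using dilate_in_D_iff[OF c] space_off[OF sets]
    by (intro measurable_restrict_space2 measurable_off[OF sets] measurable_dilate[OF c]) auto
  let ?\<nu>1 = "distr \<nu> (restrict_space borel (- D)) (dilate c)"
  let ?\<nu>2 = "scale_measure (ennreal (c powr \<alpha>)) \<nu>"
  have "?\<nu>1 = ?\<nu>2"
  proof (rule radon_off_eqI)
    show "radon_off D ?\<nu>1"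
      unfolding radon_off_def
    proof (intro conjI allI impI, simp, elim conjE)
      fix K assume K: "compact K" "K \<subseteq> - D"
      have "compact (dilate c -` K)"
        by (rule compact_closed_ereal_fun[OF closed_vimage[OF compact_imp_closed_ereal_fun[OF K(1)] continuous_dilate[OF c]]])
      moreover have sub: "dilate c -` K \<subseteq> - D" using K(2) dilate_in_D_iff[OF c] by blast
      moreover have "K \<in> sets (restrict_space borel (- D))"
        using K compact_imp_closed_ereal_fun[of K] by (auto simp: sets_restrict_space_iff)
      moreover have "dilate c -` K \<inter> space \<nu> = dilate c -` K" using sub space_off[OF sets] by auto
      ultimately show "emeasure ?\<nu>1 K < \<infinity>"
        using radon meas by (simp add: emeasure_distr radon_off_def)
    qed
    show "radon_off D ?\<nu>2"
      using radon by (auto simp: radon_off_def ennreal_mult_less_top)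
    fix h assume h: "test_fun D h"
    have hm: "h \<in> borel_measurable (restrict_space borel (- D))"
      using test_funD(4)[OF h] by (rule measurable_restrict_space1)
    have h\<nu>: "h \<in> borel_measurable \<nu>" using test_funD(4)[OF h] by (rule measurable_off[OF sets])
    have "(\<integral>x. h x \<partial>?\<nu>1) = (\<integral>x. h (dilate c x) \<partial>\<nu>)"
      by (rule integral_distr[OF meas hm])
    also have "\<dots> = c powr \<alpha> * (\<integral>x. h x \<partial>\<nu>)"
      by (rule regularly_varying_scaling_test_fun[OF rv \<alpha> h c])
    also have "\<dots> = (\<integral>x. h x \<partial>?\<nu>2)"
    proof -
      have "(\<integral>x. h x \<partial>?\<nu>2) = enn2real (\<integral>\<^sup>+x. ennreal (h x) \<partial>?\<nu>2)"
        using test_funD(2)[OF h] h\<nu> by (intro integral_eq_nn_integral) auto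
      also have "\<dots> = c powr \<alpha> * enn2real (\<integral>\<^sup>+x. ennreal (h x) \<partial>\<nu>)"
        using h\<nu> by (simp add: nn_integral_scale_measure enn2real_mult)
      also have "\<dots> = c powr \<alpha> * (\<integral>x. h x \<partial>\<nu>)"
        using test_funD(2)[OF h] h\<nu> by (subst integral_eq_nn_integral) auto
      finally show ?thesis by simp
    qed
    finally show "(\<integral>x. h x \<partial>?\<nu>1) = (\<integral>x. h x \<partial>?\<nu>2)" .
  qed
  note eq = this
  have "(\<integral>\<^sup>+x. G (dilate c x) \<partial>\<nu>) = (\<integral>\<^sup>+x. G x \<partial>?\<nu>1)"
    using G by (intro nn_integral_distr[OF meas, symmetric]) (simp add: measurable_restrict_space1)
  also have "\<dots> = ennreal (c powr \<alpha>) * (\<integral>\<^sup>+x. G x \<partial>\<nu>)"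
    unfolding eq by (intro nn_integral_scale_measure measurable_off[OF sets] G)
  finally show ?thesis .
qed

end

section \<open>Integration in polar coordinates\<close>

lemma nn_integral_has_integral_on:
  fixes f :: "real \<Rightarrow> real"
  assumes "f \<in> borel_measurable borel" "A \<in> sets borel" "\<And>x. 0 \<le> f x" "(f has_integral I) A"
  shows "(\<integral>\<^sup>+x. ennreal (f x) * indicator A x \<partial>lborel) = ennreal I"
proof -
  have "((\<lambda>x. f x * indicator A x) has_integral I) UNIV"
  proof -
    have "(\<lambda>x. f x * indicator A x) = (\<lambda>x. if x \<in> A then f x else 0)" by (auto simp: indicator_def)
    then show ?thesis using assms(4) by (simp only: has_integral_restrict_UNIV)
  qed
  then have "(\<integral>\<^sup>+x. ennreal (f x * indicator A x) \<partial>lborel) = ennreal I"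
    using assms(1-3) by (intro nn_integral_has_integral_lborel) auto
  then show ?thesis
    by (simp add: ennreal_mult'' ennreal_indicator assms)
qed

lemma nn_integral_powr_from_0:
  assumes "\<alpha> > 0" "r > 0"
  shows "(\<integral>\<^sup>+s. ennreal (\<alpha> * s powr (\<alpha> - 1)) * indicator {0<..<r} s \<partial>lborel) = ennreal (r powr \<alpha>)"
proof -
  have "((\<lambda>s. \<alpha> * s powr (\<alpha> - 1)) has_integral \<alpha> * (r powr (\<alpha> - 1 + 1) / (\<alpha> - 1 + 1))) {0..r}"
    using assms by (intro has_integral_mult_right has_integral_powr_from_0) auto
  then have "((\<lambda>s. \<alpha> * s powr (\<alpha> - 1)) has_integral r powr \<alpha>) {0..r}"
    using assms by simp
  then have "((\<lambda>s. \<alpha> * s powr (\<alpha> - 1)) has_integral r powr \<alpha>) {0<..<r}"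
    using has_integral_Icc_iff_Ioo by blast
  then show ?thesis
    using assms by (intro nn_integral_has_integral_on) auto
qed

lemma nn_integral_powr_to_inf:
  assumes "\<alpha> > 0" "r > 0"
  shows "(\<integral>\<^sup>+s. ennreal (\<alpha> * s powr (- \<alpha> - 1)) * indicator {r..} s \<partial>lborel) = ennreal (r powr (- \<alpha>))"
proof -
  have "((\<lambda>s. \<alpha> * s powr (- \<alpha> - 1)) has_integral \<alpha> * (- (r powr (- \<alpha> - 1 + 1)) / (- \<alpha> - 1 + 1))) {r..}"
    using assms by (intro has_integral_mult_right has_integral_powr_to_inf) auto
  then have "((\<lambda>s. \<alpha> * s powr (- \<alpha> - 1)) has_integral r powr (- \<alpha>)) {r..}"
    using assms by simp
  then show ?thesis
    using assms by (intro nn_integral_has_integral_on) auto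
qed

text \<open>The polar decomposition, the representation and its uniqueness depend on \<nu> only
  through these facts. \<open>scaling\<close> is the integrated form of \<nu>(\<lambda> A) =
  \<lambda>^(-\<alpha>) \<nu>(A), with the dilation on the integrand. Regular variation returns as
  an explicit hypothesis where a given \<open>X\<close> is sampled.\<close>

locale homogeneous_measure = polar_space D \<tau> for D :: "('d::finite \<Rightarrow> ereal) set" and \<tau> +
  fixes \<alpha> :: real and \<nu> :: "('d \<Rightarrow> ereal) measure"
  assumes \<alpha>: "\<alpha> > 0"
    and radon: "radon_off D \<nu>"
    and null_infinite: "emeasure \<nu> (space \<nu> - range emb) = 0"
    and nontrivial: "emeasure \<nu> (space \<nu>) \<noteq> 0"
    and scaling: "\<lbrakk>c > 0; G \<in> borel_measurable borel\<rbrakk> \<Longrightarrow>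
      (\<integral>\<^sup>+x. G (dilate c x) \<partial>\<nu>) = ennreal (c powr \<alpha>) * (\<integral>\<^sup>+x. G x \<partial>\<nu>)"
begin

abbreviation "S \<equiv> tau_sphere \<tau>"
abbreviation "\<sigma> \<equiv> spectral_measure \<tau> \<nu>"

lemma sets_nu: "sets \<nu> = sets (restrict_space borel (- D))"
  using radon by (simp add: radon_off_def)

lemmas space_nu = space_off[OF sets_nu]
lemmas measurable_nu = measurable_off[OF sets_nu]
lemmas sets_nu_iff = sets_off[OF sets_nu]

lemma S_borel [measurable]: "S \<in> sets borel"
proof -
  have "S = (\<lambda>y. \<tau> (emb y)) -` {1}" by (auto simp: tau_sphere_def)
  also have "\<dots> \<in> sets borel"
    using measurable_sets[of "\<lambda>y. \<tau> (emb y)" borel borel "{1}"] by simp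
  finally show ?thesis .
qed

lemma AE_finite: "AE x in \<nu>. x \<in> range emb"
  by (rule AE_I[OF _ null_infinite]) (auto simp: sets_nu_iff space_nu Diff_eq intro!: sets.Int range_emb_borel D_borel)

lemma emeasure_level_finite: "b > 0 \<Longrightarrow> emeasure \<nu> {x. b \<le> \<tau> x} < \<infinity>"
  using radon compact_superlevel superlevel_subset by (simp add: radon_off_def)

text \<open>Transporting \<open>\<nu>\<close> to the whole compactified space keeps measurability side conditions free of
  restrictions.\<close>

definition nu_ext :: "('d \<Rightarrow> ereal) measure" where
  "nu_ext = distr \<nu> borel (\<lambda>x. x)"

lemma sets_nu_ext [measurable_cong, simp]: "sets nu_ext = sets borel"
  by (simp add: nu_ext_def)

lemma space_nu_ext [simp]: "space nu_ext = UNIV"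
  by (simp add: nu_ext_def)

lemma nn_integral_nu_ext: "G \<in> borel_measurable borel \<Longrightarrow> (\<integral>\<^sup>+x. G x \<partial>nu_ext) = (\<integral>\<^sup>+x. G x \<partial>\<nu>)"
  unfolding nu_ext_def by (intro nn_integral_distr measurable_nu) auto

lemma emeasure_nu_ext: "A \<in> sets borel \<Longrightarrow> emeasure nu_ext A = emeasure \<nu> (A - D)"
  unfolding nu_ext_def using measurable_nu[of "\<lambda>x. x" borel]
  by (subst emeasure_distr) (auto simp: space_nu Diff_eq)

lemma AE_nu_ext: "AE x in nu_ext. x \<in> range emb \<and> x \<notin> D"
proof -
  have "AE x in \<nu>. x \<in> range emb \<and> x \<notin> D"
    using AE_finite AE_space by eventually_elim (auto simp: space_nu)
  then show ?thesis
    unfolding nu_ext_def using measurable_nu[of "\<lambda>x. x" borel]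
    by (subst AE_distr_iff) auto
qed

text \<open>Required for exchanging the order of integration. The cover consists of superlevel sets
  of \<open>\<tau>\<close>, which are compact and so of finite mass, and of \<open>D\<close>, which
  has mass 0 under \<open>nu_ext\<close>.\<close>

sublocale nu_ext: sigma_finite_measure nu_ext
proof
  let ?A = "insert D (range (\<lambda>j::nat. {x. ennreal (1 / Suc j) \<le> \<tau> x}))"
  have "(\<Union>?A) = UNIV"
  proof (intro equalityI subsetI)
    fix x :: "'d \<Rightarrow> ereal"
    show "x \<in> \<Union>?A"
    proof (cases "x \<in> D")
      case False
      then have "\<tau> x > 0" using tau_eq_0[of x] by (simp add: zero_less_iff_neq_zero)
      have "\<exists>j::nat. ennreal (1 / Suc j) \<le> \<tau> x"
      proof (cases "\<tau> x")
        case (real r)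
        then have "r > 0" using \<open>\<tau> x > 0\<close> by simp
        then obtain j where "inverse (real (Suc j)) < r" using reals_Archimedean by blast
        then show ?thesis using real by (intro exI[of _ j]) (auto simp: inverse_eq_divide intro!: ennreal_leI)
      qed auto
      then show ?thesis by auto
    qed auto
  qed auto
  moreover have "emeasure nu_ext a \<noteq> \<infinity>" if "a \<in> ?A" for a
    using that
  proof safe
    assume "emeasure nu_ext D = \<infinity>"
    then show False by (simp add: emeasure_nu_ext)
  next
    fix j :: nat
    let ?B = "{x. ennreal (1 / Suc j) \<le> \<tau> x}"
    assume *: "emeasure nu_ext ?B = \<infinity>"
    have "emeasure nu_ext ?B = emeasure \<nu> ?B"
      using superlevel_subset[of "ennreal (1 / Suc j)"]
      by (subst emeasure_nu_ext) (auto intro!: arg_cong[of _ _ "emeasure \<nu>"])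
    moreover have "emeasure \<nu> ?B < \<infinity>" by (intro emeasure_level_finite) simp
    ultimately show False using * by simp
  qed
  moreover have "?A \<subseteq> sets nu_ext" by auto
  ultimately show "\<exists>A. countable A \<and> A \<subseteq> sets nu_ext \<and> \<Union> A = space nu_ext \<and> (\<forall>a\<in>A. emeasure nu_ext a \<noteq> \<infinity>)"
    by (intro exI[of _ ?A]) auto
qed

lemma scaling_nu_ext:
  "\<lbrakk>c > 0; G \<in> borel_measurable borel\<rbrakk> \<Longrightarrow>
      (\<integral>\<^sup>+x. G (dilate c x) \<partial>nu_ext) = ennreal (c powr \<alpha>) * (\<integral>\<^sup>+x. G x \<partial>nu_ext)"
  by (subst (1 2) nn_integral_nu_ext) (simp_all add: scaling measurable_compose[OF measurable_dilate])

lemma angle_in_S: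
  assumes "emb y \<notin> D"
  shows "angle \<tau> y \<in> S"
proof -
  have "\<tau> (emb y) \<noteq> 0" "\<tau> (emb y) < \<infinity>" using assms tau_emb tau_eq_0 by auto
  then obtain r where r: "\<tau> (emb y) = ennreal r" "r > 0"
    by (cases "\<tau> (emb y)") (auto simp: less_le)
  then have "\<tau> (emb (angle \<tau> y)) = ennreal (1 / r) * ennreal r"
    using tau_dilate[of "1 / r" "emb y"] by (simp add: angle_def dilate_emb divide_inverse)
  also have "\<dots> = 1" using r(2) by (simp add: ennreal_mult[symmetric])
  finally show ?thesis by (simp add: tau_sphere_def)
qed

lemma measurable_angle [measurable]: "angle \<tau> \<in> borel_measurable borel"
  unfolding angle_def by measurable

lemma sets_sigma [measurable_cong]: "sets \<sigma> = sets (restrict_space borel S)"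
  by (simp add: spectral_measure_def)

lemma space_sigma: "space \<sigma> = S"
  by (simp add: spectral_measure_def space_restrict_space)

lemma nn_integral_sigma:
  assumes G: "G \<in> borel_measurable borel"
  shows "(\<integral>\<^sup>+\<theta>. G \<theta> \<partial>\<sigma>) = (\<integral>\<^sup>+x. G (angle \<tau> (unemb x)) * indicator {x \<in> range emb. 1 < \<tau> x} x \<partial>nu_ext)"
proof -
  note [measurable] = G
  let ?B = "{x \<in> space \<nu>. x \<in> range emb \<and> \<tau> x > 1}"
  have B: "?B \<in> sets \<nu>"
    by (auto simp: sets_nu_iff space_nu)
  have meas: "(\<lambda>x. angle \<tau> (unemb x)) \<in> measurable (restrict_space \<nu> ?B) (restrict_space borel S)"
  proof (rule measurable_restrict_space2)
    show "(\<lambda>x. angle \<tau> (unemb x)) \<in> borel_measurable (restrict_space \<nu> ?B)"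
      by (intro measurable_restrict_space1 measurable_nu) measurable
    show "(\<lambda>x. angle \<tau> (unemb x)) \<in> space (restrict_space \<nu> ?B) \<rightarrow> S"
      using angle_in_S by (auto simp: space_restrict_space space_nu)
  qed
  have "(\<integral>\<^sup>+\<theta>. G \<theta> \<partial>\<sigma>) = (\<integral>\<^sup>+x. G (angle \<tau> (unemb x)) \<partial>restrict_space \<nu> ?B)"
    unfolding spectral_measure_def
    by (rule nn_integral_distr[OF meas]) (simp add: measurable_restrict_space1)
  also have "\<dots> = (\<integral>\<^sup>+x. G (angle \<tau> (unemb x)) * indicator ?B x \<partial>\<nu>)"
    using B by (intro nn_integral_restrict_space) (simp add: Int_absorb2 sets.sets_into_space)
  also have "\<dots> = (\<integral>\<^sup>+x. G (angle \<tau> (unemb x)) * indicator {x \<in> range emb. 1 < \<tau> x} x \<partial>\<nu>)"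
    by (intro nn_integral_cong) (auto simp: indicator_def)
  also have "\<dots> = (\<integral>\<^sup>+x. G (angle \<tau> (unemb x)) * indicator {x \<in> range emb. 1 < \<tau> x} x \<partial>nu_ext)"
    by (intro nn_integral_nu_ext[symmetric]) measurable
  finally show ?thesis .
qed

lemma measurable_dilate_prod [measurable]:
  assumes [measurable]: "f \<in> borel_measurable M" "g \<in> borel_measurable M"
  shows "(\<lambda>x. dilate (f x) (g x) :: 'd \<Rightarrow> ereal) \<in> borel_measurable M"
  unfolding dilate_def
  by (intro measurable_coordinatewise_then_product borel_measurable_ereal_times borel_measurable_ereal
      assms measurable_compose[OF assms(2) measurable_component_borel])

text \<open>The spectral measure lives on \<open>\<tau> > 1\<close>; exchanging the order of integration and rescaling by
  homogeneity replaces the condition \<open>\<tau> x > 1\<close> by \<open>\<tau> x > s\<close>, and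
  \<open>\<integral>\<^sub>0\<^sup>r \<alpha> s\<^sup>\<alpha>\<^sup>-\<^sup>1 ds = r\<^sup>\<alpha>\<close> with \<open>r = \<tau> x\<close> removes it.\<close>

lemma polar_integral:
  assumes G [measurable]: "G \<in> borel_measurable borel"
  shows "(\<integral>\<^sup>+x. G x \<partial>\<nu>) =
    (\<integral>\<^sup>+\<theta>. (\<integral>\<^sup>+t. G (emb (t *\<^sub>R \<theta>)) * ennreal (\<alpha> * t powr (- \<alpha> - 1)) * indicator {0<..} t \<partial>lborel) \<partial>\<sigma>)"
    (is "_ = ?R")
proof -
  interpret pair_sigma_finite nu_ext lborel ..
  \<comment> \<open>Measuring \<open>t\<close> in units of the radius \<open>r\<close> of
    \<open>x\<close> leaves the factor \<open>r * r powr (- \<alpha> - 1)\<close>. \<open>K\<close>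
    records it together with the truncation, whose threshold is a parameter so that rescaling can
    move it from 1 to \<open>s\<close>.\<close>
  define K where "K = (\<lambda>(s::real) x. ennreal (enn2real (\<tau> x) powr (- \<alpha>)) * indicator {x \<in> range emb. ennreal s < \<tau> x} x)"
  have K [measurable]: "(\<lambda>p. K (f p) (g p)) \<in> borel_measurable M"
    if [measurable]: "f \<in> borel_measurable M" "g \<in> borel_measurable M" for M :: "'z measure" and f g
  proof -
    have "(\<lambda>p. K (f p) (g p)) = (\<lambda>p. ennreal (enn2real (\<tau> (g p)) powr (- \<alpha>)) *
        (if g p \<in> range emb \<and> ennreal (f p) < \<tau> (g p) then 1 else 0))"
      by (auto simp: K_def fun_eq_iff indicator_def)
    also have "\<dots> \<in> borel_measurable M" by measurable
    finally show ?thesis .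
  qed
  define w where "w = (\<lambda>s::real. ennreal (\<alpha> * s powr (- \<alpha> - 1)) * indicator {0<..} s)"
  have [measurable]: "w \<in> borel_measurable borel" unfolding w_def by measurable
  have "?R = (\<integral>\<^sup>+x. (\<integral>\<^sup>+t. G (emb (t *\<^sub>R angle \<tau> (unemb x))) * ennreal (\<alpha> * t powr (- \<alpha> - 1)) * indicator {0<..} t \<partial>lborel)
      * indicator {x \<in> range emb. 1 < \<tau> x} x \<partial>nu_ext)"
    by (rule nn_integral_sigma) measurable
  also have "\<dots> = (\<integral>\<^sup>+x. (\<integral>\<^sup>+s. w s * (G (dilate s x) * K 1 x) \<partial>lborel) \<partial>nu_ext)"
  proof (rule nn_integral_cong)
    fix x
    show "(\<integral>\<^sup>+t. G (emb (t *\<^sub>R angle \<tau> (unemb x))) * ennreal (\<alpha> * t powr (- \<alpha> - 1)) * indicator {0<..} t \<partial>lborel)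
      * indicator {x \<in> range emb. 1 < \<tau> x} x = (\<integral>\<^sup>+s. w s * (G (dilate s x) * K 1 x) \<partial>lborel)"
    proof (cases "x \<in> range emb \<and> 1 < \<tau> x")
      case True
      then obtain y where y: "x = emb y" by auto
      obtain r where r: "\<tau> x = ennreal r" "r > 0"
        using True tau_emb[of y] y by (cases "\<tau> x") (auto simp: less_le)
      have K1: "K 1 x = ennreal (r powr (- \<alpha>))" using True r by (simp add: K_def)
      \<comment> \<open>Substitution \<open>t = r * s\<close>: the angle of \<open>x\<close> is
        \<open>x / r\<close>, so \<open>t\<close> times the angle becomes
        \<open>dilate s x\<close>.\<close>
      have "(\<integral>\<^sup>+t. G (emb (t *\<^sub>R angle \<tau> (unemb x))) * ennreal (\<alpha> * t powr (- \<alpha> - 1)) * indicator {0<..} t \<partial>lborel)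
          = ennreal \<bar>r\<bar> * (\<integral>\<^sup>+s. G (emb ((0 + r * s) *\<^sub>R angle \<tau> (unemb x))) * ennreal (\<alpha> * (0 + r * s) powr (- \<alpha> - 1)) * indicator {0<..} (0 + r * s) \<partial>lborel)"
        using r by (intro nn_integral_real_affine) auto
      also have "\<dots> = (\<integral>\<^sup>+s. ennreal \<bar>r\<bar> * (G (emb ((0 + r * s) *\<^sub>R angle \<tau> (unemb x))) * ennreal (\<alpha> * (0 + r * s) powr (- \<alpha> - 1)) * indicator {0<..} (0 + r * s)) \<partial>lborel)"
        by (rule nn_integral_cmult[symmetric]) measurable
      also have "\<dots> = (\<integral>\<^sup>+s. w s * (G (dilate s x) * K 1 x) \<partial>lborel)"
      proof (rule nn_integral_cong)
        fix s :: real
        show "ennreal \<bar>r\<bar> * (G (emb ((0 + r * s) *\<^sub>R angle \<tau> (unemb x))) * ennreal (\<alpha> * (0 + r * s) powr (- \<alpha> - 1)) * indicator {0<..} (0 + r * s))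
          = w s * (G (dilate s x) * K 1 x)"
        proof (cases "s > 0")
          case s: True
          have "emb ((0 + r * s) *\<^sub>R angle \<tau> (unemb x)) = dilate s x"
            using r by (simp add: y angle_def dilate_emb)
          moreover have "ennreal \<bar>r\<bar> * ennreal (\<alpha> * (0 + r * s) powr (- \<alpha> - 1)) =
              ennreal (\<alpha> * s powr (- \<alpha> - 1)) * ennreal (r powr (- \<alpha>))"
          proof -
            have "r * (\<alpha> * (r * s) powr (- \<alpha> - 1)) = \<alpha> * s powr (- \<alpha> - 1) * r powr (- \<alpha>)"
              using r s by (simp add: powr_mult powr_diff)
            then show ?thesis using r \<alpha> by (simp add: ennreal_mult[symmetric])
          qed
          moreover have "indicator {0<..} (0 + r * s) = (1::ennreal)" using r s by simp
          ultimately show ?thesis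
            using s by (simp add: w_def K1 mult.assoc mult.left_commute[of _ "G _"])
        next
          case False
          then have "indicator {0<..} (0 + r * s) = (0::ennreal)"
            using r by (simp add: indicator_def zero_less_mult_iff)
          then show ?thesis using False by (simp add: w_def)
        qed
      qed
      finally show ?thesis using True by simp
    next
      case False
      then have "K 1 x = 0" by (auto simp: K_def)
      then show ?thesis using False by auto
    qed
  qed
  also have "\<dots> = (\<integral>\<^sup>+s. (\<integral>\<^sup>+x. w s * (G (dilate s x) * K 1 x) \<partial>nu_ext) \<partial>lborel)"
    by (rule Fubini'[symmetric]) measurable
  also have "\<dots> = (\<integral>\<^sup>+s. (\<integral>\<^sup>+x. ennreal (\<alpha> * s powr (\<alpha> - 1)) * indicator {0<..} s * (G x * K s x) \<partial>nu_ext) \<partial>lborel)"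
  proof (rule nn_integral_cong)
    fix s :: real
    show "(\<integral>\<^sup>+x. w s * (G (dilate s x) * K 1 x) \<partial>nu_ext) =
       (\<integral>\<^sup>+x. ennreal (\<alpha> * s powr (\<alpha> - 1)) * indicator {0<..} s * (G x * K s x) \<partial>nu_ext)"
    proof (cases "s > 0")
      case s: True
      \<comment> \<open>\<open>K\<close> has degree \<open>- \<alpha>\<close> jointly in its
        threshold and its point.\<close>
      have K_dilate: "K 1 x = ennreal (s powr \<alpha>) * K s (dilate s x)" for x
      proof (cases "x \<in> range emb")
        case True
        then obtain y where y: "x = emb y" by auto
        obtain r where r: "\<tau> x = ennreal r" "r \<ge> 0" using tau_emb[of y] y by (cases "\<tau> x") auto
        have "\<tau> (dilate s x) = ennreal (s * r)" using r s by (simp add: tau_dilate ennreal_mult)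
        moreover have "dilate s x \<in> range emb" by (auto simp: y dilate_emb)
        moreover have "r powr (- \<alpha>) = s powr \<alpha> * (s * r) powr (- \<alpha>)"
          using s r by (simp add: powr_mult powr_minus)
        ultimately show ?thesis
          using r s True by (auto simp: K_def indicator_def ennreal_mult[symmetric] ennreal_less_iff)
      next
        case False
        have "dilate s x \<notin> range emb"
        proof
          assume "dilate s x \<in> range emb"
          then obtain y where "dilate s x = emb y" by auto
          then have "dilate (1 / s) (dilate s x) = emb (y /\<^sub>R s)"
            using s by (simp add: dilate_emb divide_inverse)
          then show False using False s by (simp add: dilate_dilate)
        qed
        then show ?thesis using False by (simp add: K_def)
      qed
      have "(\<integral>\<^sup>+x. w s * (G (dilate s x) * K 1 x) \<partial>nu_ext) =
          (\<integral>\<^sup>+x. (\<lambda>y. w s * (ennreal (s powr \<alpha>) * (G y * K s y))) (dilate s x) \<partial>nu_ext)"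
        by (simp add: K_dilate mult_ac)
      also have "\<dots> = ennreal (s powr \<alpha>) * (\<integral>\<^sup>+y. w s * (ennreal (s powr \<alpha>) * (G y * K s y)) \<partial>nu_ext)"
        using s by (intro scaling_nu_ext) measurable
      also have "\<dots> = (\<integral>\<^sup>+y. ennreal (s powr \<alpha>) * (w s * (ennreal (s powr \<alpha>) * (G y * K s y))) \<partial>nu_ext)"
        by (rule nn_integral_cmult[symmetric]) measurable
      also have "\<dots> = (\<integral>\<^sup>+x. ennreal (\<alpha> * s powr (\<alpha> - 1)) * indicator {0<..} s * (G x * K s x) \<partial>nu_ext)"
      proof (rule nn_integral_cong)
        fix y
        \<comment> \<open>One factor \<open>s powr \<alpha>\<close> stems from
          \<open>K_dilate\<close>, the other from the scaling of \<nu>; together they turn the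
          exponent \<open>- \<alpha> - 1\<close> into \<open>\<alpha> - 1\<close>, which is
          integrable at 0.\<close>
        have "s powr \<alpha> * (\<alpha> * s powr (- \<alpha> - 1) * s powr \<alpha>) = \<alpha> * s powr (\<alpha> - 1)"
          using s by (simp add: powr_diff powr_minus)
        then have "ennreal (s powr \<alpha>) * (w s * ennreal (s powr \<alpha>)) = ennreal (\<alpha> * s powr (\<alpha> - 1))"
          using s \<alpha> by (simp add: w_def ennreal_mult[symmetric])
        then show "ennreal (s powr \<alpha>) * (w s * (ennreal (s powr \<alpha>) * (G y * K s y))) =
            ennreal (\<alpha> * s powr (\<alpha> - 1)) * indicator {0<..} s * (G y * K s y)"
          using s by (simp add: mult.assoc[symmetric])
      qed
      finally show ?thesis .
    qed (simp add: w_def)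
  qed
  also have "\<dots> = (\<integral>\<^sup>+x. (\<integral>\<^sup>+s. ennreal (\<alpha> * s powr (\<alpha> - 1)) * indicator {0<..} s * (G x * K s x) \<partial>lborel) \<partial>nu_ext)"
    by (rule Fubini') measurable
  also have "\<dots> = (\<integral>\<^sup>+x. G x \<partial>nu_ext)"
  proof (rule nn_integral_cong_AE, use AE_nu_ext in eventually_elim)
    fix x :: "'d \<Rightarrow> ereal" assume x: "x \<in> range emb \<and> x \<notin> D"
    then obtain y where y: "x = emb y" by auto
    obtain r where r: "\<tau> x = ennreal r" "r > 0"
      using tau_emb[of y] y x tau_eq_0[of x] by (cases "\<tau> x") (auto simp: less_le)
    have "(\<integral>\<^sup>+s. ennreal (\<alpha> * s powr (\<alpha> - 1)) * indicator {0<..} s * (G x * K s x) \<partial>lborel) =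
        (\<integral>\<^sup>+s. G x * ennreal (r powr (- \<alpha>)) * (ennreal (\<alpha> * s powr (\<alpha> - 1)) * indicator {0<..<r} s) \<partial>lborel)"
    proof (rule nn_integral_cong)
      fix s :: real
      show "ennreal (\<alpha> * s powr (\<alpha> - 1)) * indicator {0<..} s * (G x * K s x) =
        G x * ennreal (r powr (- \<alpha>)) * (ennreal (\<alpha> * s powr (\<alpha> - 1)) * indicator {0<..<r} s)"
        using x r by (auto simp: K_def indicator_def ennreal_less_iff mult_ac)
    qed
    also have "\<dots> = G x * ennreal (r powr (- \<alpha>)) * ennreal (r powr \<alpha>)"
      using \<alpha> r by (subst nn_integral_cmult) (auto simp: nn_integral_powr_from_0)
    also have "\<dots> = G x"
      using r by (simp add: mult.assoc ennreal_mult[symmetric] powr_add[symmetric])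
    finally show "(\<integral>\<^sup>+s. ennreal (\<alpha> * s powr (\<alpha> - 1)) * indicator {0<..} s * (G x * K s x) \<partial>lborel) = G x" .
  qed
  also have "\<dots> = (\<integral>\<^sup>+x. G x \<partial>\<nu>)" by (rule nn_integral_nu_ext) measurable
  finally show ?thesis by simp
qed

end

section \<open>Frechet laws and level sets\<close>

definition frechet_density :: "real \<Rightarrow> real \<Rightarrow> real" where
  "frechet_density \<alpha> t = (if t > 0 then \<alpha> * t powr (- \<alpha> - 1) * exp (- (t powr (- \<alpha>))) else 0)"

definition frechet :: "real \<Rightarrow> real measure" where
  "frechet \<alpha> = density lborel (\<lambda>t. ennreal (frechet_density \<alpha> t))"

lemma measurable_frechet_density [measurable]: "frechet_density \<alpha> \<in> borel_measurable borel"
  unfolding frechet_density_def by measurable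

lemma sets_frechet [measurable_cong, simp]: "sets (frechet \<alpha>) = sets borel"
  and space_frechet [simp]: "space (frechet \<alpha>) = UNIV"
  by (simp_all add: frechet_def)

lemma frechet_density_nonneg: "\<alpha> > 0 \<Longrightarrow> 0 \<le> frechet_density \<alpha> t"
  by (simp add: frechet_density_def)

lemma emeasure_frechet_atMost:
  assumes \<alpha>: "\<alpha> > 0" and x: "x > 0"
  shows "emeasure (frechet \<alpha>) {..x} = ennreal (exp (- (x powr (- \<alpha>))))"
proof -
  \<comment> \<open>\<open>0 powr (- \<alpha>)\<close> is 0, so the bare formula has the value 1 at
    0. The case distinction restores continuity there.\<close>
  define F where "F = (\<lambda>t::real. if t \<le> 0 then 0 else exp (- (t powr (- \<alpha>))))"
  have "(frechet_density \<alpha> has_integral (F x - F 0)) {0..x}"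
  proof (rule fundamental_theorem_of_calculus_interior)
    show "0 \<le> x" using x by simp
    show "continuous_on {0..x} F"
    proof (rule continuous_on_eq_continuous_within[THEN iffD2], rule ballI)
      fix t assume t: "t \<in> {0..x}"
      show "continuous (at t within {0..x}) F"
      proof (cases "t = 0")
        case True
        have "((\<lambda>t. exp (- (t powr (- \<alpha>)))) \<longlongrightarrow> 0) (at_right (0::real))"
          using \<alpha> by real_asymp
        moreover have "\<forall>\<^sub>F t in at_right (0::real). exp (- (t powr (- \<alpha>))) = F t"
          using eventually_at_right_less[of 0] by eventually_elim (simp add: F_def)
        ultimately have "(F \<longlongrightarrow> 0) (at_right 0)" by (rule Lim_transform_eventually)
        then have "(F \<longlongrightarrow> F 0) (at 0 within {0..x})"
          using x by (simp add: at_within_Icc_at_right F_def)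
        then show ?thesis using True by (simp add: continuous_within)
      next
        case False
        then have t: "t > 0" using t by simp
        have "isCont (\<lambda>t. exp (- (t powr (- \<alpha>)))) t"
          using t by (intro continuous_intros) auto
        then have "isCont F t"
        proof (rule continuous_transform_within_openin[where S = "{0<..}" and T = UNIV, simplified])
        qed (use t in \<open>auto simp: F_def\<close>)
        then show ?thesis by (rule continuous_at_imp_continuous_at_within)
      qed
    qed
    fix t assume "t \<in> {0<..<x}"
    then have t: "t > 0" by simp
    have "((\<lambda>t. exp (- (t powr (- \<alpha>)))) has_real_derivative frechet_density \<alpha> t) (at t)"
      using t by (auto intro!: derivative_eq_intros simp: frechet_density_def mult_ac)
    then have "(F has_real_derivative frechet_density \<alpha> t) (at t)"
      by (rule has_field_derivative_transform_within_open[where S = "{0<..}"]) (use t in \<open>auto simp: F_def\<close>)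
    then show "(F has_vector_derivative frechet_density \<alpha> t) (at t)"
      by (simp add: has_real_derivative_iff_has_vector_derivative)
  qed
  then have "(\<integral>\<^sup>+t. ennreal (frechet_density \<alpha> t) * indicator {0..x} t \<partial>lborel) = ennreal (F x - F 0)"
    using \<alpha> by (intro nn_integral_has_integral_on frechet_density_nonneg) auto
  also have "(\<integral>\<^sup>+t. ennreal (frechet_density \<alpha> t) * indicator {0..x} t \<partial>lborel) =
      (\<integral>\<^sup>+t. ennreal (frechet_density \<alpha> t) * indicator {..x} t \<partial>lborel)"
    by (intro nn_integral_cong) (auto simp: indicator_def frechet_density_def)
  also have "\<dots> = emeasure (frechet \<alpha>) {..x}"
    unfolding frechet_def by (intro emeasure_density[symmetric]) auto
  finally show ?thesis using x by (simp add: F_def)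
qed

lemma prob_space_frechet:
  assumes \<alpha>: "\<alpha> > 0"
  shows "prob_space (frechet \<alpha>)"
proof
  have "(\<lambda>n. emeasure (frechet \<alpha>) {..real (Suc n)}) \<longlonglongrightarrow> emeasure (frechet \<alpha>) (\<Union>n. {..real (Suc n)})"
    by (intro Lim_emeasure_incseq) (auto simp: incseq_def)
  moreover have "(\<Union>n. {..real (Suc n)}) = UNIV"
    by (auto, metis real_arch_simple le_add_same_cancel2 of_nat_Suc order_trans zero_le_one add.commute)
  moreover have "(\<lambda>n. emeasure (frechet \<alpha>) {..real (Suc n)}) \<longlonglongrightarrow> ennreal 1"
  proof -
    have "(\<lambda>n. exp (- (real (Suc n) powr (- \<alpha>)))) \<longlonglongrightarrow> 1" using \<alpha> by real_asymp
    then have "(\<lambda>n. ennreal (exp (- (real (Suc n) powr (- \<alpha>))))) \<longlonglongrightarrow> ennreal 1" by (rule tendsto_ennrealI)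
    then show ?thesis using \<alpha> by (subst emeasure_frechet_atMost) auto
  qed
  ultimately show "emeasure (frechet \<alpha>) (space (frechet \<alpha>)) = 1"
    using LIMSEQ_unique by fastforce
qed

lemma standard_frechet_frechet:
  assumes \<alpha>: "\<alpha> > 0" and d: "distr M borel Z = frechet \<alpha>" and Z: "Z \<in> borel_measurable M"
  shows "standard_frechet \<alpha> M Z"
  unfolding standard_frechet_def
proof (intro conjI allI impI)
  fix x :: real assume x: "x > 0"
  have "emeasure M {\<omega> \<in> space M. Z \<omega> \<le> x} = emeasure (distr M borel Z) {..x}"
    using Z by (subst emeasure_distr) (auto intro!: arg_cong[of _ _ "emeasure M"])
  then show "measure M {\<omega> \<in> space M. Z \<omega> \<le> x} = exp (- (x powr (- \<alpha>)))"
    using emeasure_frechet_atMost[OF \<alpha> x] by (simp add: d measure_def)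
qed fact

text \<open>\<open>standard_frechet\<close> prescribes the distribution function at positive
  arguments only. At all others it is squeezed to 0 by the values at small positive arguments, and a
  law on the reals is determined by its distribution function.\<close>

lemma distr_standard_frechet:
  assumes \<alpha>: "\<alpha> > 0" and Q: "prob_space Q" and Z: "standard_frechet \<alpha> Q Z"
  shows "distr Q borel Z = frechet \<alpha>"
proof -
  have Zm [measurable]: "Z \<in> borel_measurable Q" using Z by (simp add: standard_frechet_def)
  interpret Q: prob_space Q by fact
  interpret d: prob_space "distr Q borel Z" by (rule Q.prob_space_distr) fact
  interpret f: prob_space "frechet \<alpha>" by (rule prob_space_frechet) fact
  have pos: "measure (distr Q borel Z) {..x} = exp (- (x powr (- \<alpha>)))" if "x > 0" for x
  proof -
    have "measure (distr Q borel Z) {..x} = measure Q {\<omega> \<in> space Q. Z \<omega> \<le> x}"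
      by (subst measure_distr) (auto intro!: arg_cong[of _ _ "measure Q"])
    then show ?thesis using Z that by (simp add: standard_frechet_def)
  qed
  have neg: "measure M {..x} = 0"
    if x: "x \<le> 0" and M: "finite_measure M" "sets M = sets borel" and eq: "\<And>x. x > 0 \<Longrightarrow> measure M {..x} = exp (- (x powr (- \<alpha>)))"
    for M x
  proof -
    interpret finite_measure M by fact
    have "((\<lambda>t. exp (- (t powr (- \<alpha>)))) \<longlongrightarrow> 0) (at_right (0::real))"
      using \<alpha> by real_asymp
    moreover have "\<forall>\<^sub>F t in at_right (0::real). measure M {..x} \<le> exp (- (t powr (- \<alpha>)))"
      using eventually_at_right_less[of 0]
    proof eventually_elim
      case (elim t)
      have "measure M {..x} \<le> measure M {..t}"
        using x elim M by (intro finite_measure_mono) auto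
      then show ?case using eq[OF elim] by simp
    qed
    ultimately have "measure M {..x} \<le> 0"
      by (intro tendsto_lowerbound[of _ _ "at_right (0::real)"]) auto
    then show ?thesis using measure_nonneg[of M "{..x}"] by linarith
  qed
  show ?thesis
  proof (rule cdf_unique')
    show "finite_borel_measure (distr Q borel Z)" "finite_borel_measure (frechet \<alpha>)"
      by unfold_locales auto
    show "cdf (distr Q borel Z) = cdf (frechet \<alpha>)"
    proof
      fix x
      have pos': "measure (frechet \<alpha>) {..x} = exp (- (x powr (- \<alpha>)))" if "x > 0" for x
        using emeasure_frechet_atMost[OF \<alpha> that] by (simp add: measure_def)
      show "cdf (distr Q borel Z) x = cdf (frechet \<alpha>) x"
      proof (cases "x > 0")
        case False
        then have "measure (distr Q borel Z) {..x} = 0" "measure (frechet \<alpha>) {..x} = 0"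
          using pos pos' by (intro neg d.finite_measure_axioms f.finite_measure_axioms; simp)+
        then show ?thesis by (simp add: cdf_def)
      qed (simp add: cdf_def pos pos')
    qed
  qed
qed

lemma nn_integral_frechet:
  assumes "G \<in> borel_measurable borel"
  shows "(\<integral>\<^sup>+t. G t \<partial>frechet \<alpha>) = (\<integral>\<^sup>+t. ennreal (frechet_density \<alpha> t) * G t \<partial>lborel)"
  unfolding frechet_def using assms by (intro nn_integral_density) auto


section \<open>Homogeneous losses in polar coordinates\<close>

lemma H_measurable: "assumption_H f \<Longrightarrow> f \<in> borel_measurable borel"
  and H_finite: "assumption_H f \<Longrightarrow> f (emb x) < \<infinity>"
  by (auto simp: assumption_H_def)

text \<open>The homogeneity in \<open>assumption_H\<close> leaves out the origin; there both sides
  are 0 because \<open>f (emb 0) = 0\<close>.\<close>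

lemma H_homogeneous: "assumption_H f \<Longrightarrow> c > 0 \<Longrightarrow> f (emb (c *\<^sub>R x)) = ennreal c * f (emb x)"
  by (cases "x = 0") (auto simp: assumption_H_def dilate_emb[symmetric])

lemma implicit_ev_density_measurable [measurable]:
  assumes [measurable]: "f \<in> borel_measurable M"
  shows "implicit_ev_density \<alpha> f \<nu> \<in> borel_measurable M"
  unfolding implicit_ev_density_def by measurable

context homogeneous_measure
begin

text \<open>The polar form of the constant C. The integration runs over finite points, where
  \<open>f\<close> is finite, so \<open>enn2real\<close> loses nothing.\<close>

definition f_moment :: "(('d \<Rightarrow> ereal) \<Rightarrow> ennreal) \<Rightarrow> ennreal" where
  "f_moment f = (\<integral>\<^sup>+\<theta>. ennreal (enn2real (f (emb \<theta>)) powr \<alpha>) \<partial>\<sigma>)"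

text \<open>With \<open>c\<close> the loss at the angle, a homogeneous loss equals
  \<open>t * c\<close> at radius \<open>t\<close>. For \<open>c > 0\<close> it reaches
  \<open>y\<close> from the radius \<open>y / c\<close> on, and that half-line has weight
  \<open>(y / c) powr (- \<alpha>)\<close>; for \<open>c = 0\<close> both sides vanish. The two
  versions differ in the single radius \<open>y / c\<close>, a null set.\<close>

lemma nn_integral_ray:
  assumes c: "c \<ge> 0" and y: "y > 0"
  shows "(\<integral>\<^sup>+t. indicator {t. y \<le> t * c} t * ennreal (\<alpha> * t powr (- \<alpha> - 1)) * indicator {0<..} t \<partial>lborel) =
    ennreal (y powr (- \<alpha>)) * ennreal (c powr \<alpha>)"
    and "(\<integral>\<^sup>+t. indicator {t. y < t * c} t * ennreal (\<alpha> * t powr (- \<alpha> - 1)) * indicator {0<..} t \<partial>lborel) =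
    ennreal (y powr (- \<alpha>)) * ennreal (c powr \<alpha>)"
proof -
  have "(\<integral>\<^sup>+t. indicator {t. y \<le> t * c} t * ennreal (\<alpha> * t powr (- \<alpha> - 1)) * indicator {0<..} t \<partial>lborel) =
    ennreal (y powr (- \<alpha>)) * ennreal (c powr \<alpha>) \<and>
    (\<integral>\<^sup>+t. indicator {t. y < t * c} t * ennreal (\<alpha> * t powr (- \<alpha> - 1)) * indicator {0<..} t \<partial>lborel) =
    ennreal (y powr (- \<alpha>)) * ennreal (c powr \<alpha>)"
  proof (cases "c = 0")
    case True
    then show ?thesis using y by simp
  next
    case False
    then have c: "c > 0" using c by simp
    have iff: "y \<le> t * c \<longleftrightarrow> y / c \<le> t" "y < t * c \<longleftrightarrow> y / c < t" for t
      using c by (auto simp: field_simps)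
    have pos: "t > 0" if "y / c \<le> t" for t using that c y divide_pos_pos[of y c] by linarith
    have "(\<integral>\<^sup>+t. indicator {t. y \<le> t * c} t * ennreal (\<alpha> * t powr (- \<alpha> - 1)) * indicator {0<..} t \<partial>lborel) =
        (\<integral>\<^sup>+t. ennreal (\<alpha> * t powr (- \<alpha> - 1)) * indicator {y / c..} t \<partial>lborel)"
      using pos by (intro nn_integral_cong) (auto simp: indicator_def iff)
    also have "\<dots> = ennreal ((y / c) powr (- \<alpha>))"
      using y c \<alpha> by (intro nn_integral_powr_to_inf) auto
    also have "(y / c) powr (- \<alpha>) = y powr (- \<alpha>) * c powr \<alpha>"
      using y c by (simp add: powr_divide powr_minus field_simps)
    finally have 1: "(\<integral>\<^sup>+t. indicator {t. y \<le> t * c} t * ennreal (\<alpha> * t powr (- \<alpha> - 1)) * indicator {0<..} t \<partial>lborel) =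
        ennreal (y powr (- \<alpha>)) * ennreal (c powr \<alpha>)"
      by (simp add: ennreal_mult)
    have "AE t in lborel. t \<noteq> y / c" by (rule AE_lborel_singleton)
    then have "(\<integral>\<^sup>+t. indicator {t. y < t * c} t * ennreal (\<alpha> * t powr (- \<alpha> - 1)) * indicator {0<..} t \<partial>lborel) =
      (\<integral>\<^sup>+t. indicator {t. y \<le> t * c} t * ennreal (\<alpha> * t powr (- \<alpha> - 1)) * indicator {0<..} t \<partial>lborel)"
      by (intro nn_integral_cong_AE, eventually_elim) (auto simp: indicator_def iff)
    with 1 show ?thesis by simp
  qed
  then show "(\<integral>\<^sup>+t. indicator {t. y \<le> t * c} t * ennreal (\<alpha> * t powr (- \<alpha> - 1)) * indicator {0<..} t \<partial>lborel) =
    ennreal (y powr (- \<alpha>)) * ennreal (c powr \<alpha>)"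
    "(\<integral>\<^sup>+t. indicator {t. y < t * c} t * ennreal (\<alpha> * t powr (- \<alpha> - 1)) * indicator {0<..} t \<partial>lborel) =
    ennreal (y powr (- \<alpha>)) * ennreal (c powr \<alpha>)" by blast+
qed

text \<open>Every ray meets the set in a half-line or not at all, so \<open>nn_integral_ray\<close>
  is integrated over the sphere. The strict form at \<open>y = 1\<close> is
  \<open>level_const\<close>; the weak form bounds the probability that another index does at least
  as well.\<close>

lemma
  assumes H: "assumption_H f" and y: "y > 0"
  shows emeasure_ge: "emeasure \<nu> {x \<in> space \<nu>. ennreal y \<le> f x} = ennreal (y powr (- \<alpha>)) * f_moment f"
    and emeasure_gt: "emeasure \<nu> {x \<in> space \<nu>. ennreal y < f x} = ennreal (y powr (- \<alpha>)) * f_moment f"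
proof -
  note [measurable] = H_measurable[OF H]
  have f\<nu>: "f \<in> borel_measurable \<nu>" by (intro measurable_nu) measurable
  have meas: "(\<lambda>\<theta>. ennreal (enn2real (f (emb \<theta>)) powr \<alpha>)) \<in> borel_measurable \<sigma>"
    by (subst measurable_cong_sets[OF sets_sigma refl]) (intro measurable_restrict_space1, measurable)
  have ray: "\<exists>c\<ge>0. f (emb \<theta>) = ennreal c \<and> (\<forall>t>0. f (emb (t *\<^sub>R \<theta>)) = ennreal (t * c))" for \<theta>
    using H_finite[OF H, of \<theta>] H_homogeneous[OF H, of _ \<theta>]
    by (cases "f (emb \<theta>)") (auto simp: ennreal_mult)
  have A: "{x. ennreal y \<le> f x} \<in> sets borel" and A': "{x. ennreal y < f x} \<in> sets borel"
    by measurable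
  have ge: "(\<integral>\<^sup>+t. indicator {x. ennreal y \<le> f x} (emb (t *\<^sub>R \<theta>)) * ennreal (\<alpha> * t powr (- \<alpha> - 1)) * indicator {0<..} t \<partial>lborel)
      = ennreal (y powr (- \<alpha>)) * ennreal (enn2real (f (emb \<theta>)) powr \<alpha>)" (is "?I = _")
    and gt: "(\<integral>\<^sup>+t. indicator {x. ennreal y < f x} (emb (t *\<^sub>R \<theta>)) * ennreal (\<alpha> * t powr (- \<alpha> - 1)) * indicator {0<..} t \<partial>lborel)
      = ennreal (y powr (- \<alpha>)) * ennreal (enn2real (f (emb \<theta>)) powr \<alpha>)" (is "?J = _") for \<theta>
  proof -
    obtain c where c: "c \<ge> 0" "f (emb \<theta>) = ennreal c" "\<And>t. t > 0 \<Longrightarrow> f (emb (t *\<^sub>R \<theta>)) = ennreal (t * c)"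
      using ray[of \<theta>] by blast
    have "?I = (\<integral>\<^sup>+t. indicator {t. y \<le> t * c} t * ennreal (\<alpha> * t powr (- \<alpha> - 1)) * indicator {0<..} t \<partial>lborel)"
      using c y by (intro nn_integral_cong) (auto simp: indicator_def)
    then show "?I = ennreal (y powr (- \<alpha>)) * ennreal (enn2real (f (emb \<theta>)) powr \<alpha>)"
      using nn_integral_ray(1)[OF c(1) y] c by simp
    have "?J = (\<integral>\<^sup>+t. indicator {t. y < t * c} t * ennreal (\<alpha> * t powr (- \<alpha> - 1)) * indicator {0<..} t \<partial>lborel)"
      using c y by (intro nn_integral_cong) (auto simp: indicator_def ennreal_less_iff)
    then show "?J = ennreal (y powr (- \<alpha>)) * ennreal (enn2real (f (emb \<theta>)) powr \<alpha>)"
      using nn_integral_ray(2)[OF c(1) y] c by simp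
  qed
  have "emeasure \<nu> {x \<in> space \<nu>. ennreal y \<le> f x} = (\<integral>\<^sup>+x. indicator {x \<in> space \<nu>. ennreal y \<le> f x} x \<partial>\<nu>)"
    by (intro nn_integral_indicator[symmetric] borel_measurable_le borel_measurable_less borel_measurable_const f\<nu>)
  also have "\<dots> = (\<integral>\<^sup>+x. indicator {x. ennreal y \<le> f x} x \<partial>\<nu>)"
    by (intro nn_integral_cong) (auto simp: indicator_def)
  also have "\<dots> = (\<integral>\<^sup>+\<theta>. ennreal (y powr (- \<alpha>)) * ennreal (enn2real (f (emb \<theta>)) powr \<alpha>) \<partial>\<sigma>)"
    using A by (subst polar_integral) (auto simp: ge)
  also have "\<dots> = ennreal (y powr (- \<alpha>)) * f_moment f"
    unfolding f_moment_def by (rule nn_integral_cmult[OF meas])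
  finally show "emeasure \<nu> {x \<in> space \<nu>. ennreal y \<le> f x} = ennreal (y powr (- \<alpha>)) * f_moment f" .
  have "emeasure \<nu> {x \<in> space \<nu>. ennreal y < f x} = (\<integral>\<^sup>+x. indicator {x \<in> space \<nu>. ennreal y < f x} x \<partial>\<nu>)"
    by (intro nn_integral_indicator[symmetric] borel_measurable_le borel_measurable_less borel_measurable_const f\<nu>)
  also have "\<dots> = (\<integral>\<^sup>+x. indicator {x. ennreal y < f x} x \<partial>\<nu>)"
    by (intro nn_integral_cong) (auto simp: indicator_def)
  also have "\<dots> = (\<integral>\<^sup>+\<theta>. ennreal (y powr (- \<alpha>)) * ennreal (enn2real (f (emb \<theta>)) powr \<alpha>) \<partial>\<sigma>)"
    using A' by (subst polar_integral) (auto simp: gt)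
  also have "\<dots> = ennreal (y powr (- \<alpha>)) * f_moment f"
    unfolding f_moment_def by (rule nn_integral_cmult[OF meas])
  finally show "emeasure \<nu> {x \<in> space \<nu>. ennreal y < f x} = ennreal (y powr (- \<alpha>)) * f_moment f" .
qed

lemma level_const_eq: "assumption_H f \<Longrightarrow> level_const f \<nu> = f_moment f"
  using emeasure_gt[of f 1] by (simp add: level_const_def)

section \<open>The polar representation\<close>

lemma measurable_sigma_cong: "measurable \<sigma> M = measurable (restrict_space borel S) M"
  by (rule measurable_cong_sets[OF sets_sigma refl])

lemma admissible_measurable:
  assumes "admissible_g \<alpha> \<tau> \<nu> g"
  shows "g \<in> borel_measurable (restrict_space borel S)"
  using assms by (simp add: admissible_g_def)

lemma sets_tilted: "sets (tilted_measure \<alpha> g \<sigma>) = sets (restrict_space borel S)"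
  by (simp add: tilted_measure_def sets_sigma)

lemma space_tilted: "space (tilted_measure \<alpha> g \<sigma>) = S"
  by (simp add: tilted_measure_def space_sigma)

lemma prob_space_tilted:
  assumes g: "admissible_g \<alpha> \<tau> \<nu> g"
  shows "prob_space (tilted_measure \<alpha> g \<sigma>)"
proof
  have "(\<lambda>\<theta>. ennreal (g \<theta> powr \<alpha>)) \<in> borel_measurable \<sigma>"
    using admissible_measurable[OF g] unfolding measurable_sigma_cong by measurable
  then have "emeasure (tilted_measure \<alpha> g \<sigma>) S = (\<integral>\<^sup>+\<theta>. ennreal (g \<theta> powr \<alpha>) * indicator S \<theta> \<partial>\<sigma>)"
    unfolding tilted_measure_def using sets.top[of \<sigma>] by (intro emeasure_density) (auto simp: space_sigma)
  also have "\<dots> = (\<integral>\<^sup>+\<theta>. ennreal (g \<theta> powr \<alpha>) \<partial>\<sigma>)"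
    by (intro nn_integral_cong) (auto simp: space_sigma)
  finally show "emeasure (tilted_measure \<alpha> g \<sigma>) (space (tilted_measure \<alpha> g \<sigma>)) = 1"
    using g by (simp add: space_tilted admissible_g_def)
qed

lemma tilted_zero_set:
  assumes g: "admissible_g \<alpha> \<tau> \<nu> g"
  shows "emeasure (tilted_measure \<alpha> g \<sigma>) {\<theta> \<in> S. g \<theta> = 0} = 0"
proof -
  have gm: "g \<in> borel_measurable \<sigma>"
    using admissible_measurable[OF g] unfolding measurable_sigma_cong .
  then have "{\<theta> \<in> space \<sigma>. g \<theta> = 0} \<in> sets \<sigma>" by measurable
  then have "{\<theta> \<in> S. g \<theta> = 0} \<in> sets \<sigma>" by (simp add: space_sigma)
  then have "emeasure (tilted_measure \<alpha> g \<sigma>) {\<theta> \<in> S. g \<theta> = 0} =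
      (\<integral>\<^sup>+\<theta>. ennreal (g \<theta> powr \<alpha>) * indicator {\<theta> \<in> S. g \<theta> = 0} \<theta> \<partial>\<sigma>)"
    unfolding tilted_measure_def using gm by (intro emeasure_density) auto
  also have "\<dots> = (\<integral>\<^sup>+\<theta>. 0 \<partial>\<sigma>)"
    by (intro nn_integral_cong) (auto simp: indicator_def)
  finally show ?thesis by simp
qed

text \<open>Under \<open>t = r * s\<close> the powers of \<open>r\<close> cancel: the Jacobian and
  the Frechet density contribute \<open>r powr (- \<alpha>)\<close>, which the weight
  \<open>r powr \<alpha>\<close> of the tilted measure absorbs. Only the exponential remembers
  \<open>r\<close>, and what remains is the radial part of \<nu>.\<close>

lemma frechet_ray_integral:
  assumes r: "r > 0" and G [measurable]: "G \<in> borel_measurable borel"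
  shows "ennreal (r powr \<alpha>) * (\<integral>\<^sup>+t. G (t / r) \<partial>frechet \<alpha>) =
    (\<integral>\<^sup>+s. G s * ennreal (exp (- ((s * r) powr (- \<alpha>)))) * ennreal (\<alpha> * s powr (- \<alpha> - 1)) * indicator {0<..} s \<partial>lborel)"
proof -
  have "ennreal (r powr \<alpha>) * (\<integral>\<^sup>+t. G (t / r) \<partial>frechet \<alpha>) =
      ennreal (r powr \<alpha>) * (\<integral>\<^sup>+t. ennreal (frechet_density \<alpha> t) * G (t / r) \<partial>lborel)"
    by (subst nn_integral_frechet) auto
  also have "(\<integral>\<^sup>+t. ennreal (frechet_density \<alpha> t) * G (t / r) \<partial>lborel) =
      ennreal \<bar>r\<bar> * (\<integral>\<^sup>+s. ennreal (frechet_density \<alpha> (0 + r * s)) * G ((0 + r * s) / r) \<partial>lborel)"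
    using r by (intro nn_integral_real_affine) auto
  also have "ennreal (r powr \<alpha>) * \<dots> =
      (\<integral>\<^sup>+s. ennreal (r powr \<alpha>) * (ennreal \<bar>r\<bar> * (ennreal (frechet_density \<alpha> (0 + r * s)) * G ((0 + r * s) / r))) \<partial>lborel)"
    by (subst nn_integral_cmult[symmetric], measurable)+
  also have "\<dots> = (\<integral>\<^sup>+s. G s * ennreal (exp (- ((s * r) powr (- \<alpha>)))) * ennreal (\<alpha> * s powr (- \<alpha> - 1)) * indicator {0<..} s \<partial>lborel)"
  proof (rule nn_integral_cong)
    fix s :: real
    show "ennreal (r powr \<alpha>) * (ennreal \<bar>r\<bar> * (ennreal (frechet_density \<alpha> (0 + r * s)) * G ((0 + r * s) / r))) =
      G s * ennreal (exp (- ((s * r) powr (- \<alpha>)))) * ennreal (\<alpha> * s powr (- \<alpha> - 1)) * indicator {0<..} s"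
    proof (cases "s > 0")
      case True
      have "r powr \<alpha> * (r * frechet_density \<alpha> (r * s)) = exp (- ((s * r) powr (- \<alpha>))) * (\<alpha> * s powr (- \<alpha> - 1))"
        using True r by (simp add: frechet_density_def powr_mult powr_diff powr_minus field_simps)
      then have "ennreal (r powr \<alpha>) * (ennreal r * ennreal (frechet_density \<alpha> (r * s))) =
          ennreal (exp (- ((s * r) powr (- \<alpha>)))) * ennreal (\<alpha> * s powr (- \<alpha> - 1))"
        using r \<alpha> frechet_density_nonneg[OF \<alpha>] by (simp add: ennreal_mult[symmetric])
      then show ?thesis using r True by (simp add: mult.assoc[symmetric]) (simp add: mult_ac)
    next
      case False
      then show ?thesis using r by (simp add: frechet_density_def zero_less_mult_iff)
    qed
  qed
  finally show ?thesis .
qed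

lemma sets_polar_representation: "polar_representation \<alpha> \<tau> \<nu> \<mu> g \<Longrightarrow> sets \<mu> = sets borel"
  by (auto simp: polar_representation_def)

text \<open>The pair of radius and angle has a product law, so the radius can be integrated out
  first at a fixed angle. On each ray \<open>frechet_ray_integral\<close> produces the radial part
  of \<nu> with the exponential weight, and \<open>polar_integral\<close> reassembles the
  rays.\<close>

lemma polar_representation_integral:
  assumes rep: "polar_representation \<alpha> \<tau> \<nu> \<mu> g" and H: "assumption_H f"
    and C: "level_const f \<nu> = ennreal C" "C > 0"
    and gf: "\<And>\<theta>. \<theta> \<in> S \<Longrightarrow> g \<theta> = C powr (- 1 / \<alpha>) * enn2real (f (emb \<theta>))"
    and G [measurable]: "G \<in> borel_measurable borel"
  shows "(\<integral>\<^sup>+y. G y \<partial>\<mu>) = (\<integral>\<^sup>+x. G (unemb x) * implicit_ev_density \<alpha> f \<nu> x \<partial>\<nu>)"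
proof -
  obtain Q :: "(real \<times> real ^ 'd) measure" and Z \<Theta> where Q: "prob_space Q"
    and Z: "standard_frechet \<alpha> Q Z" and \<Theta>: "\<Theta> \<in> measurable Q (restrict_space borel S)"
    and tilt: "distr Q (restrict_space borel S) \<Theta> = tilted_measure \<alpha> g \<sigma>"
    and indep: "prob_space.indep_set Q {Z -` A \<inter> space Q | A. A \<in> sets borel}
          {\<Theta> -` B \<inter> space Q | B. B \<in> sets (restrict_space borel S)}"
    and \<mu>: "\<mu> = distr Q borel (\<lambda>\<omega>. Z \<omega> *\<^sub>R (\<Theta> \<omega> /\<^sub>R g (\<Theta> \<omega>)))" and adm: "admissible_g \<alpha> \<tau> \<nu> g"
    using rep unfolding polar_representation_def by blast
  interpret Q: prob_space Q by fact
  note gm [measurable] = admissible_measurable[OF adm]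
  note fm [measurable] = H_measurable[OF H]
  have Zm [measurable]: "Z \<in> borel_measurable Q" using Z by (simp add: standard_frechet_def)
  note \<Theta> [measurable]
  interpret fre: prob_space "frechet \<alpha>" by (rule prob_space_frechet[OF \<alpha>])
  interpret til: prob_space "tilted_measure \<alpha> g \<sigma>" by (rule prob_space_tilted[OF adm])
  interpret pair_sigma_finite "frechet \<alpha>" "tilted_measure \<alpha> g \<sigma>" ..
  let ?R = "restrict_space borel S :: (real ^ 'd) measure"
  note sets_tilted [measurable_cong]
  \<comment> \<open>Independence is given on the generated sigma-algebras, that is, on rectangles,
    and these determine the product measure.\<close>
  have joint: "frechet \<alpha> \<Otimes>\<^sub>M tilted_measure \<alpha> g \<sigma> = distr Q (borel \<Otimes>\<^sub>M ?R) (\<lambda>\<omega>. (Z \<omega>, \<Theta> \<omega>))"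
  proof (rule pair_measure_eqI)
    fix A :: "real set" and B assume A: "A \<in> sets (frechet \<alpha>)" and B: "B \<in> sets (tilted_measure \<alpha> g \<sigma>)"
    have A': "A \<in> sets borel" and B': "B \<in> sets ?R" using A B by (simp_all add: sets_tilted)
    have "emeasure (distr Q (borel \<Otimes>\<^sub>M ?R) (\<lambda>\<omega>. (Z \<omega>, \<Theta> \<omega>))) (A \<times> B) =
        emeasure Q ((Z -` A \<inter> space Q) \<inter> (\<Theta> -` B \<inter> space Q))"
      using A' B' by (subst emeasure_distr) (auto intro!: arg_cong[of _ _ "emeasure Q"])
    also have "\<dots> = emeasure Q (Z -` A \<inter> space Q) * emeasure Q (\<Theta> -` B \<inter> space Q)"
    proof -
      have "measure Q ((Z -` A \<inter> space Q) \<inter> (\<Theta> -` B \<inter> space Q)) =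
          measure Q (Z -` A \<inter> space Q) * measure Q (\<Theta> -` B \<inter> space Q)"
        by (rule Q.indep_setD[OF indep]) (use A' B' in blast)+
      then show ?thesis by (simp add: Q.emeasure_eq_measure ennreal_mult)
    qed
    also have "emeasure Q (Z -` A \<inter> space Q) = emeasure (frechet \<alpha>) A"
      using A' by (simp add: distr_standard_frechet[OF \<alpha> Q Z, symmetric] emeasure_distr)
    also have "emeasure Q (\<Theta> -` B \<inter> space Q) = emeasure (tilted_measure \<alpha> g \<sigma>) B"
      using B' by (simp add: tilt[symmetric] emeasure_distr)
    finally show "emeasure (frechet \<alpha>) A * emeasure (tilted_measure \<alpha> g \<sigma>) B =
        emeasure (distr Q (borel \<Otimes>\<^sub>M ?R) (\<lambda>\<omega>. (Z \<omega>, \<Theta> \<omega>))) (A \<times> B)" by simp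
  qed (auto intro!: sets_pair_measure_cong simp: sets_tilted fre.sigma_finite_measure_axioms til.sigma_finite_measure_axioms)
  have Gm: "(\<lambda>p. G (fst p *\<^sub>R (snd p /\<^sub>R g (snd p)))) \<in> borel_measurable (borel \<Otimes>\<^sub>M ?R)"
  proof -
    have [measurable]: "(\<lambda>x. x) \<in> measurable ?R borel" by (rule measurable_restrict_space1) measurable
    have [measurable]: "snd \<in> measurable (borel \<Otimes>\<^sub>M ?R) (borel :: (real ^ 'd) measure)"
      using measurable_compose[OF measurable_snd, of "\<lambda>x. x" ?R borel] by measurable
    have [measurable]: "(\<lambda>p. g (snd p)) \<in> borel_measurable (borel \<Otimes>\<^sub>M ?R)"
      by (rule measurable_compose[OF measurable_snd gm])
    show ?thesis by measurable
  qed
  have "(\<lambda>\<omega>. Z \<omega> *\<^sub>R (\<Theta> \<omega> /\<^sub>R g (\<Theta> \<omega>))) \<in> borel_measurable Q"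
  proof -
    have [measurable]: "\<Theta> \<in> borel_measurable Q" using \<Theta> by (simp add: measurable_restrict_space2_iff)
    have [measurable]: "(\<lambda>\<omega>. g (\<Theta> \<omega>)) \<in> borel_measurable Q" by (rule measurable_compose[OF \<Theta> gm])
    show ?thesis by measurable
  qed
  then have "(\<integral>\<^sup>+y. G y \<partial>\<mu>) = (\<integral>\<^sup>+\<omega>. G (Z \<omega> *\<^sub>R (\<Theta> \<omega> /\<^sub>R g (\<Theta> \<omega>))) \<partial>Q)"
    unfolding \<mu> by (intro nn_integral_distr) auto
  also have "\<dots> = (\<integral>\<^sup>+p. G (fst p *\<^sub>R (snd p /\<^sub>R g (snd p))) \<partial>(frechet \<alpha> \<Otimes>\<^sub>M tilted_measure \<alpha> g \<sigma>))"
    unfolding joint using Gm by (subst nn_integral_distr) auto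
  also have "\<dots> = (\<integral>\<^sup>+\<theta>. (\<integral>\<^sup>+t. G (t *\<^sub>R (\<theta> /\<^sub>R g \<theta>)) \<partial>frechet \<alpha>) \<partial>tilted_measure \<alpha> g \<sigma>)"
    using Gm by (subst nn_integral_snd[symmetric]) (auto simp: measurable_cong_sets[OF sets_pair_measure_cong[OF sets_frechet sets_tilted] refl])
  also have "\<dots> = (\<integral>\<^sup>+\<theta>. ennreal (g \<theta> powr \<alpha>) * (\<integral>\<^sup>+t. G (t *\<^sub>R (\<theta> /\<^sub>R g \<theta>)) \<partial>frechet \<alpha>) \<partial>\<sigma>)"
  proof -
    have m1: "(\<lambda>\<theta>. ennreal (g \<theta> powr \<alpha>)) \<in> borel_measurable \<sigma>"
      using gm unfolding measurable_sigma_cong by measurable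
    have "(\<lambda>p. G (snd p *\<^sub>R (fst p /\<^sub>R g (fst p)))) \<in> borel_measurable (\<sigma> \<Otimes>\<^sub>M frechet \<alpha>)"
      using measurable_compose[OF measurable_pair_swap' Gm]
      by (simp add: case_prod_beta' measurable_cong_sets[OF sets_pair_measure_cong[OF sets_sigma sets_frechet] refl])
    then have "(\<lambda>\<theta>. \<integral>\<^sup>+t. G (t *\<^sub>R (\<theta> /\<^sub>R g \<theta>)) \<partial>frechet \<alpha>) \<in> borel_measurable \<sigma>"
      by (intro fre.borel_measurable_nn_integral) (simp add: case_prod_beta')
    then show ?thesis unfolding tilted_measure_def by (rule nn_integral_density[OF m1])
  qed
  also have "\<dots> = (\<integral>\<^sup>+\<theta>. (\<integral>\<^sup>+t. (G (unemb (emb (t *\<^sub>R \<theta>))) * implicit_ev_density \<alpha> f \<nu> (emb (t *\<^sub>R \<theta>))) * ennreal (\<alpha> * t powr (- \<alpha> - 1)) * indicator {0<..} t \<partial>lborel) \<partial>\<sigma>)"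
  proof (rule nn_integral_cong)
    fix \<theta> assume "\<theta> \<in> space \<sigma>"
    then have \<theta>: "\<theta> \<in> S" by (simp add: space_sigma)
    obtain c where c: "f (emb \<theta>) = ennreal c" "c \<ge> 0"
      using H_finite[OF H, of \<theta>] by (cases "f (emb \<theta>)") auto
    have g\<theta>: "g \<theta> = C powr (- 1 / \<alpha>) * c" using gf[OF \<theta>] c by simp
    have fray: "f (emb (t *\<^sub>R \<theta>)) = ennreal (t * c)" if "t > 0" for t
      using H_homogeneous[OF H that, of \<theta>] c that by (simp add: ennreal_mult)
    show "ennreal (g \<theta> powr \<alpha>) * (\<integral>\<^sup>+t. G (t *\<^sub>R (\<theta> /\<^sub>R g \<theta>)) \<partial>frechet \<alpha>) =
      (\<integral>\<^sup>+t. (G (unemb (emb (t *\<^sub>R \<theta>))) * implicit_ev_density \<alpha> f \<nu> (emb (t *\<^sub>R \<theta>))) * ennreal (\<alpha> * t powr (- \<alpha> - 1)) * indicator {0<..} t \<partial>lborel)"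
    \<comment> \<open>On a ray where \<open>f\<close> vanishes the weight
      \<open>g \<theta> powr \<alpha>\<close> and the density are both 0, so the two sides agree
      whatever value division by \<open>g \<theta> = 0\<close> takes.\<close>
    proof (cases "c = 0")
      case True
      have "(\<integral>\<^sup>+t. (G (unemb (emb (t *\<^sub>R \<theta>))) * implicit_ev_density \<alpha> f \<nu> (emb (t *\<^sub>R \<theta>))) * ennreal (\<alpha> * t powr (- \<alpha> - 1)) * indicator {0<..} t \<partial>lborel)
         = (\<integral>\<^sup>+t. 0 \<partial>(lborel :: real measure))"
        using fray True by (intro nn_integral_cong) (auto simp: indicator_def implicit_ev_density_def)
      then show ?thesis using True by (simp add: g\<theta>)
    next
      case False
      then have cpos: "c > 0" using c by simp
      then have gpos: "g \<theta> > 0" using C by (simp add: g\<theta>)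
      have "ennreal (g \<theta> powr \<alpha>) * (\<integral>\<^sup>+t. G (t *\<^sub>R (\<theta> /\<^sub>R g \<theta>)) \<partial>frechet \<alpha>) =
         ennreal (g \<theta> powr \<alpha>) * (\<integral>\<^sup>+t. (\<lambda>s. G (s *\<^sub>R \<theta>)) (t / g \<theta>) \<partial>frechet \<alpha>)"
        by (simp add: divide_inverse)
      also have "\<dots> = (\<integral>\<^sup>+s. (\<lambda>s. G (s *\<^sub>R \<theta>)) s * ennreal (exp (- ((s * g \<theta>) powr (- \<alpha>)))) * ennreal (\<alpha> * s powr (- \<alpha> - 1)) * indicator {0<..} s \<partial>lborel)"
        by (rule frechet_ray_integral[OF gpos]) measurable
      also have "\<dots> = (\<integral>\<^sup>+t. (G (unemb (emb (t *\<^sub>R \<theta>))) * implicit_ev_density \<alpha> f \<nu> (emb (t *\<^sub>R \<theta>))) * ennreal (\<alpha> * t powr (- \<alpha> - 1)) * indicator {0<..} t \<partial>lborel)"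
      proof (rule nn_integral_cong)
        fix t :: real
        show "(\<lambda>s. G (s *\<^sub>R \<theta>)) t * ennreal (exp (- ((t * g \<theta>) powr (- \<alpha>)))) * ennreal (\<alpha> * t powr (- \<alpha> - 1)) * indicator {0<..} t =
          (G (unemb (emb (t *\<^sub>R \<theta>))) * implicit_ev_density \<alpha> f \<nu> (emb (t *\<^sub>R \<theta>))) * ennreal (\<alpha> * t powr (- \<alpha> - 1)) * indicator {0<..} t"
        proof (cases "t > 0")
          case t: True
          \<comment> \<open>\<open>C\<close> enters \<open>g\<close> with exponent
            \<open>- 1 / \<alpha>\<close>, so the power \<open>- \<alpha>\<close> in the Frechet law
            gives back the factor \<open>C\<close> of the density.\<close>
          have "(C powr (- 1 / \<alpha>)) powr (- \<alpha>) = C" using C \<alpha> unfolding powr_powr by simp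
          then have "(t * g \<theta>) powr (- \<alpha>) = C * (t * c) powr (- \<alpha>)"
            using t cpos C by (simp add: g\<theta> powr_mult)
          then have "implicit_ev_density \<alpha> f \<nu> (emb (t *\<^sub>R \<theta>)) = ennreal (exp (- ((t * g \<theta>) powr (- \<alpha>))))"
            using t cpos C fray[OF t] by (simp add: implicit_ev_density_def)
          then show ?thesis by simp
        qed simp
      qed
      finally show ?thesis .
    qed
  qed
  also have "\<dots> = (\<integral>\<^sup>+x. G (unemb x) * implicit_ev_density \<alpha> f \<nu> x \<partial>\<nu>)"
    by (rule polar_integral[symmetric]) measurable
  finally show ?thesis .
qed

lemma admissible_f:
  assumes H: "assumption_H f" and C: "level_const f \<nu> = ennreal C" "C > 0"
  shows "admissible_g \<alpha> \<tau> \<nu> (\<lambda>\<theta>. C powr (- 1 / \<alpha>) * enn2real (f (emb \<theta>)))"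
  unfolding admissible_g_def
proof (intro conjI ballI)
  note [measurable] = H_measurable[OF H]
  show "(\<lambda>\<theta>. C powr (- 1 / \<alpha>) * enn2real (f (emb \<theta>))) \<in> borel_measurable (restrict_space borel S)"
    by (rule measurable_restrict_space1) measurable
  have "(\<lambda>\<theta>. ennreal (enn2real (f (emb \<theta>)) powr \<alpha>)) \<in> borel_measurable \<sigma>"
    unfolding measurable_sigma_cong by (rule measurable_restrict_space1) measurable
  then have "(\<integral>\<^sup>+\<theta>. ennreal (1 / C) * ennreal (enn2real (f (emb \<theta>)) powr \<alpha>) \<partial>\<sigma>) = ennreal (1 / C) * f_moment f"
    unfolding f_moment_def by (rule nn_integral_cmult)
  moreover have "ennreal ((C powr (- 1 / \<alpha>) * enn2real (f (emb \<theta>))) powr \<alpha>) = ennreal (1 / C) * ennreal (enn2real (f (emb \<theta>)) powr \<alpha>)" for \<theta>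
  proof -
    have "(C powr (- 1 / \<alpha>)) powr \<alpha> = 1 / C" using C \<alpha> unfolding powr_powr by simp
    then show ?thesis using C by (simp add: powr_mult ennreal_mult[symmetric])
  qed
  ultimately show "(\<integral>\<^sup>+\<theta>. ennreal ((C powr (- 1 / \<alpha>) * enn2real (f (emb \<theta>))) powr \<alpha>) \<partial>\<sigma>) = 1"
    using C by (simp add: level_const_eq[OF H, symmetric] ennreal_mult[symmetric])
qed simp

text \<open>The coordinates on the product of the Frechet law and the tilted measure are independent
  by construction. Existence is what allows a law known only through its density to be recognized as
  a polar representation.\<close>

lemma ex_polar_representation:
  assumes adm: "admissible_g \<alpha> \<tau> \<nu> g"
  shows "\<exists>\<mu>. polar_representation \<alpha> \<tau> \<nu> \<mu> g"
proof -
  interpret fre: prob_space "frechet \<alpha>" by (rule prob_space_frechet[OF \<alpha>])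
  interpret til: prob_space "tilted_measure \<alpha> g \<sigma>" by (rule prob_space_tilted[OF adm])
  interpret pair_prob_space "frechet \<alpha>" "tilted_measure \<alpha> g \<sigma>" ..
  let ?Q = "frechet \<alpha> \<Otimes>\<^sub>M tilted_measure \<alpha> g \<sigma>"
  let ?R = "restrict_space borel S :: (real ^ 'd) measure"
  note sets_tilted [measurable_cong]
  have snd [measurable]: "snd \<in> measurable ?Q ?R"
    using measurable_snd[of "frechet \<alpha>" "tilted_measure \<alpha> g \<sigma>"]
    by (simp add: measurable_cong_sets[OF refl sets_tilted])
  have fst [measurable]: "fst \<in> borel_measurable ?Q"
    using measurable_fst[of "frechet \<alpha>" "tilted_measure \<alpha> g \<sigma>"]
    by (simp add: measurable_cong_sets[OF refl sets_frechet])
  have fst_pre: "fst -` A \<inter> space ?Q = A \<times> S" and snd_pre: "snd -` B \<inter> space ?Q = UNIV \<times> (B \<inter> S)" for A B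
    by (auto simp: space_pair_measure space_tilted)
  have S: "S \<in> sets (tilted_measure \<alpha> g \<sigma>)" "emeasure (tilted_measure \<alpha> g \<sigma>) S = 1"
    using sets.top[of "tilted_measure \<alpha> g \<sigma>"] til.emeasure_space_1 by (simp_all add: space_tilted)
  have U: "emeasure (frechet \<alpha>) UNIV = 1" using fre.emeasure_space_1 by simp
  have eA: "emeasure ?Q (fst -` A \<inter> space ?Q) = emeasure (frechet \<alpha>) A" if "A \<in> sets borel" for A
    unfolding fst_pre using that S by (subst til.emeasure_pair_measure_Times) auto
  have eB: "emeasure ?Q (snd -` B \<inter> space ?Q) = emeasure (tilted_measure \<alpha> g \<sigma>) B" if "B \<in> sets ?R" for B
  proof -
    have "B \<inter> S = B" using that by (auto simp: sets_restrict_space)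
    then show ?thesis unfolding snd_pre using that U by (subst til.emeasure_pair_measure_Times) (auto simp: sets_tilted)
  qed
  have distr_fst: "distr ?Q borel fst = frechet \<alpha>"
    by (rule measure_eqI) (simp_all add: emeasure_distr eA)
  have distr_snd: "distr ?Q ?R snd = tilted_measure \<alpha> g \<sigma>"
    by (rule measure_eqI) (simp_all add: emeasure_distr eB sets_tilted)
  \<comment> \<open>The sample space of the definition, written \<open>real \<times> real ^ 'd\<close>, parses as \<open>(real \<times> real) ^ 'd\<close>.\<close>
  define Z where "Z = (\<lambda>v :: (real \<times> real) ^ 'd. fst (v $ undefined))"
  define \<Theta> where "\<Theta> = (\<lambda>v :: (real \<times> real) ^ 'd. \<chi> i. snd (v $ i))"
  \<comment> \<open>\<open>\<psi>\<close> repeats the radius in every coordinate, so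
    \<open>Z\<close> may read it off at an arbitrary index, here \<open>undefined\<close>; the
    second components form the angle.\<close>
  define \<psi> where "\<psi> = (\<lambda>p. (\<chi> i. (fst p, snd p $ i)) :: (real \<times> real) ^ 'd)"
  have Z\<psi>: "Z (\<psi> p) = fst p" and \<Theta>\<psi>: "\<Theta> (\<psi> p) = snd p" for p
    by (simp_all add: Z_def \<Theta>_def \<psi>_def)
  have [measurable]: "Z \<in> borel_measurable borel" "\<Theta> \<in> borel_measurable borel" "\<psi> \<in> borel_measurable borel"
    unfolding Z_def \<Theta>_def \<psi>_def by (intro borel_measurable_continuous_onI continuous_intros)+
  \<comment> \<open>Restricting to vectors with angle in \<open>S\<close> makes
    \<open>\<Theta>\<close> a map into the sphere on the whole sample space.\<close>
  define B where "B = (restrict_space borel {v. \<Theta> v \<in> S} :: ((real \<times> real) ^ 'd) measure)"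
  have Zm: "Z \<in> borel_measurable B" and \<Theta>m: "\<Theta> \<in> measurable B ?R"
    unfolding B_def by (intro measurable_restrict_space2 measurable_restrict_space1;
        auto simp: space_restrict_space)+
  have id: "(\<lambda>p. p) \<in> measurable ?Q borel"
  proof -
    have "snd \<in> borel_measurable ?Q" using snd by (simp add: measurable_restrict_space2_iff)
    then have "(\<lambda>p. (fst p, snd p)) \<in> borel_measurable ?Q" by (rule borel_measurable_Pair[OF fst])
    then show ?thesis by simp
  qed
  have \<psi>m: "\<psi> \<in> measurable ?Q B"
    unfolding B_def
    by (intro measurable_restrict_space2 measurable_compose[OF id])
      (auto simp: \<Theta>\<psi> space_pair_measure space_tilted)
  let ?P = "distr ?Q B \<psi>"
  have P1: "prob_space ?P" by (rule prob_space_distr[OF \<psi>m])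
  have P2: "standard_frechet \<alpha> ?P Z"
    using distr_fst \<psi>m Zm by (intro standard_frechet_frechet \<alpha>) (simp_all add: distr_distr comp_def Z\<psi>)
  have P3: "\<Theta> \<in> measurable ?P ?R" using \<Theta>m by simp
  have P4: "distr ?P ?R \<Theta> = tilted_measure \<alpha> g \<sigma>"
    using distr_snd \<psi>m \<Theta>m by (simp add: distr_distr comp_def \<Theta>\<psi>)
  have P5: "prob_space.indep_set ?P {Z -` A \<inter> space ?P |A. A \<in> sets borel} {\<Theta> -` B \<inter> space ?P |B. B \<in> sets ?R}"
  proof (rule prob_space.indep_setI[OF P1])
    show "{Z -` A \<inter> space ?P |A. A \<in> sets borel} \<subseteq> sets ?P"
      using measurable_sets[OF Zm] by auto
    show "{\<Theta> -` B \<inter> space ?P |B. B \<in> sets ?R} \<subseteq> sets ?P"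
      using measurable_sets[OF \<Theta>m] by auto
    fix a b assume "a \<in> {Z -` A \<inter> space ?P |A. A \<in> sets borel}" "b \<in> {\<Theta> -` B \<inter> space ?P |B. B \<in> sets ?R}"
    then obtain A E where A: "a = Z -` A \<inter> space B" "A \<in> sets borel" and E: "b = \<Theta> -` E \<inter> space B" "E \<in> sets ?R"
      by auto
    have ES: "E \<subseteq> S" using E by (auto simp: sets_restrict_space)
    have pre: "\<psi> -` a \<inter> space ?Q = fst -` A \<inter> space ?Q" "\<psi> -` b \<inter> space ?Q = snd -` E \<inter> space ?Q"
      "\<psi> -` (a \<inter> b) \<inter> space ?Q = A \<times> E"
      using measurable_space[OF \<psi>m] ES by (auto simp: A E Z\<psi> \<Theta>\<psi> space_pair_measure space_tilted)
    have sets: "a \<in> sets B" "b \<in> sets B"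
      using measurable_sets[OF Zm A(2)] measurable_sets[OF \<Theta>m E(2)] by (simp_all add: A E)
    then have "emeasure ?P (a \<inter> b) = emeasure ?Q (A \<times> E)"
      by (simp add: emeasure_distr[OF \<psi>m] pre del: vimage_Int)
    also have "\<dots> = emeasure (frechet \<alpha>) A * emeasure (tilted_measure \<alpha> g \<sigma>) E"
      using A E by (simp add: til.emeasure_pair_measure_Times sets_tilted)
    also have "\<dots> = emeasure ?P a * emeasure ?P b" using A(2) E(2) sets
      by (simp add: eA eB emeasure_distr[OF \<psi>m] pre)
    finally show "measure ?P (a \<inter> b) = measure ?P a * measure ?P b"
      by (simp add: measure_def enn2real_mult)
  qed
  show ?thesis
    unfolding polar_representation_def using adm P1 P2 P3 P4 P5 by blast
qed

text \<open>\<open>D\<close> is null for \<mu> and the infinite points are null for \<nu>. Up to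
  null sets \<open>emb\<close> and \<open>unemb\<close> are therefore mutually inverse, and equality
  of the measures off \<open>D\<close> becomes equality of integrals over
  \<open>real ^ 'd\<close>.\<close>

lemma law_eq_density_iff:
  assumes sets: "sets \<mu> = sets borel" and off: "emeasure \<mu> (emb -` D) = 0"
    and dens [measurable]: "d \<in> borel_measurable borel"
  shows "restrict_space (distr \<mu> borel emb) (- D) = density \<nu> d \<longleftrightarrow>
    (\<forall>G\<in>borel_measurable borel. (\<integral>\<^sup>+y. G y \<partial>\<mu>) = (\<integral>\<^sup>+x. G (unemb x) * d x \<partial>\<nu>))" (is "?L \<longleftrightarrow> ?R")
proof
  note [measurable_cong] = sets
  have space: "space \<mu> = UNIV" using sets_eq_imp_space_eq[OF sets] by simp
  have D': "emb -` D \<in> sets borel" using measurable_sets[OF measurable_emb D_borel] by simp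
  have AE: "AE y in \<mu>. emb y \<notin> D"
    by (rule AE_I[OF _ off]) (auto simp: sets D')
  have d\<nu>: "d \<in> borel_measurable \<nu>" by (rule measurable_nu[OF dens])
  {
    assume ?L
    show ?R
    proof
      fix G :: "real ^ 'd \<Rightarrow> ennreal" assume G [measurable]: "G \<in> borel_measurable borel"
      have Gu: "(\<lambda>x. G (unemb x)) \<in> borel_measurable \<nu>" by (rule measurable_nu) measurable
      have "(\<integral>\<^sup>+y. G y \<partial>\<mu>) = (\<integral>\<^sup>+y. G (unemb (emb y)) * indicator (- D) (emb y) \<partial>\<mu>)"
        using AE by (intro nn_integral_cong_AE) (auto elim: eventually_mono)
      also have "\<dots> = (\<integral>\<^sup>+x. G (unemb x) * indicator (- D) x \<partial>distr \<mu> borel emb)"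
        by (rule nn_integral_distr[symmetric]) measurable
      also have "\<dots> = (\<integral>\<^sup>+x. G (unemb x) \<partial>restrict_space (distr \<mu> borel emb) (- D))"
        using D_borel by (intro nn_integral_restrict_space[symmetric]) auto
      also have "\<dots> = (\<integral>\<^sup>+x. d x * G (unemb x) \<partial>\<nu>)"
        unfolding \<open>?L\<close> by (rule nn_integral_density[OF d\<nu> Gu])
      finally show "(\<integral>\<^sup>+y. G y \<partial>\<mu>) = (\<integral>\<^sup>+x. G (unemb x) * d x \<partial>\<nu>)" by (simp add: mult.commute)
    qed
  next
    assume R: ?R
    show ?L
    proof (rule measure_eqI)
      show "sets (restrict_space (distr \<mu> borel emb) (- D)) = sets (density \<nu> d)"
        by (simp add: sets_nu cong: sets_restrict_space_cong)
      fix A assume "A \<in> sets (restrict_space (distr \<mu> borel emb) (- D))"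
      then have A [measurable]: "A \<in> sets borel" and AD: "A \<subseteq> - D"
        using D_borel by (auto simp: sets_restrict_space_iff)
      have "emeasure (restrict_space (distr \<mu> borel emb) (- D)) A = emeasure (distr \<mu> borel emb) A"
        using AD D_borel by (intro emeasure_restrict_space) auto
      also have "\<dots> = (\<integral>\<^sup>+x. indicator A x \<partial>distr \<mu> borel emb)" by (simp add: A)
      also have "\<dots> = (\<integral>\<^sup>+y. indicator A (emb y) \<partial>\<mu>)" by (rule nn_integral_distr) measurable
      also have "\<dots> = (\<integral>\<^sup>+x. indicator A (emb (unemb x)) * d x \<partial>\<nu>)"
        by (rule R[rule_format]) measurable
      also have "\<dots> = (\<integral>\<^sup>+x. d x * indicator A x \<partial>\<nu>)"
        using AE_finite by (intro nn_integral_cong_AE) (auto elim!: eventually_mono simp: mult.commute)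
      also have "\<dots> = emeasure (density \<nu> d) A"
        using AD by (intro emeasure_density[symmetric] d\<nu>) (simp add: sets_nu_iff)
      finally show "emeasure (restrict_space (distr \<mu> borel emb) (- D)) A = emeasure (density \<nu> d) A" .
    qed
  }
qed

text \<open>Only the direction from left to right is a computation. For the converse, some law with
  this representation exists; it has the same integrals as \<mu> and therefore is \<mu>.\<close>

lemma polar_representation_iff_density:
  assumes H: "assumption_H f" and C: "level_const f \<nu> = ennreal C" "C > 0"
    and adm: "admissible_g \<alpha> \<tau> \<nu> g"
    and gf: "\<And>\<theta>. \<theta> \<in> S \<Longrightarrow> g \<theta> = C powr (- 1 / \<alpha>) * enn2real (f (emb \<theta>))"
    and sets: "sets \<mu> = sets borel" and off: "emeasure \<mu> (emb -` D) = 0"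
  shows "polar_representation \<alpha> \<tau> \<nu> \<mu> g \<longleftrightarrow>
    restrict_space (distr \<mu> borel emb) (- D) = density \<nu> (implicit_ev_density \<alpha> f \<nu>)"
proof -
  note [measurable] = H_measurable[OF H]
  note iff = law_eq_density_iff[OF sets off, of "implicit_ev_density \<alpha> f \<nu>", OF implicit_ev_density_measurable[OF H_measurable[OF H]]]
  show ?thesis
  proof
    assume "polar_representation \<alpha> \<tau> \<nu> \<mu> g"
    then show "restrict_space (distr \<mu> borel emb) (- D) = density \<nu> (implicit_ev_density \<alpha> f \<nu>)"
      unfolding iff using polar_representation_integral[OF _ H C gf] by blast
  next
    assume *: "restrict_space (distr \<mu> borel emb) (- D) = density \<nu> (implicit_ev_density \<alpha> f \<nu>)"
    obtain \<mu>' where \<mu>': "polar_representation \<alpha> \<tau> \<nu> \<mu>' g"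
      using ex_polar_representation[OF adm] by blast
    have "\<mu>' = \<mu>"
    proof (rule measure_eqI)
      show "sets \<mu>' = sets \<mu>" using sets_polar_representation[OF \<mu>'] sets by simp
      fix A assume "A \<in> sets \<mu>'"
      then have A [measurable]: "A \<in> sets borel" using sets_polar_representation[OF \<mu>'] by simp
      have "(\<integral>\<^sup>+y. indicator A y \<partial>\<mu>') = (\<integral>\<^sup>+y. indicator A y \<partial>\<mu>)"
        using *[unfolded iff, rule_format, of "indicator A"] polar_representation_integral[OF \<mu>' H C gf, of "indicator A"] by simp
      then show "emeasure \<mu>' A = emeasure \<mu> A"
        using sets_polar_representation[OF \<mu>'] sets by simp
    qed
    then show "polar_representation \<alpha> \<tau> \<nu> \<mu> g" using \<mu>' by simp
  qed
qed

end

section \<open>Implicit extremes\<close>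

lemma argmax_index_in:
  assumes "n \<ge> 1"
  shows "argmax_index f Xs n \<omega> \<in> {1..n}"
    and "f (emb (Xs (argmax_index f Xs n \<omega>) \<omega>)) = (MAX i\<in>{1..n}. f (emb (Xs i \<omega>)))"
proof -
  have "(MAX i\<in>{1..n}. f (emb (Xs i \<omega>))) \<in> (\<lambda>i. f (emb (Xs i \<omega>))) ` {1..n}"
    using assms by (intro Max_in) auto
  then have "\<exists>k. k \<in> {1..n} \<and> f (emb (Xs k \<omega>)) = (MAX i\<in>{1..n}. f (emb (Xs i \<omega>)))" by force
  from LeastI_ex[OF this]
  show "argmax_index f Xs n \<omega> \<in> {1..n}"
    and "f (emb (Xs (argmax_index f Xs n \<omega>) \<omega>)) = (MAX i\<in>{1..n}. f (emb (Xs i \<omega>)))"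
    unfolding argmax_index_def by blast+
qed

lemma argmax_index_eqI:
  assumes k: "k \<in> {1..n}" and less: "\<And>i. i \<in> {1..n} - {k} \<Longrightarrow> f (emb (Xs i \<omega>)) < f (emb (Xs k \<omega>))"
  shows "argmax_index f Xs n \<omega> = k"
proof (rule ccontr)
  assume ne: "argmax_index f Xs n \<omega> \<noteq> k"
  have n: "n \<ge> 1" using k by auto
  have "f (emb (Xs (argmax_index f Xs n \<omega>) \<omega>)) < f (emb (Xs k \<omega>))"
    using ne argmax_index_in(1)[OF n, of f Xs \<omega>] by (intro less) auto
  also have "\<dots> \<le> (MAX i\<in>{1..n}. f (emb (Xs i \<omega>)))" using k by (intro Max_ge) auto
  finally show False using argmax_index_in(2)[OF n, of f Xs \<omega>] by simp
qed

lemma independent_copies_measurable: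
  assumes "prob_space M" "independent_copies M X Xs" "i \<ge> 1"
  shows "Xs i \<in> borel_measurable M"
  using assms by (auto simp: independent_copies_def prob_space.indep_vars_def[OF assms(1)])

lemma measurable_argmax:
  assumes M: "prob_space M" and ind: "independent_copies M X Xs"
    and f [measurable]: "(\<lambda>y. f (emb y)) \<in> borel_measurable borel" and n: "n \<ge> 1"
  shows "(\<lambda>\<omega>. Xs (argmax_index f Xs n \<omega>) \<omega>) \<in> borel_measurable M"
proof (rule measurable_compose_countable'[where I = "{1..n}"])
  have Xm: "Xs i \<in> borel_measurable M" if "i \<in> {1..n}" for i
    using that by (intro independent_copies_measurable[OF M ind]) auto
  then show "\<And>i. i \<in> {1..n} \<Longrightarrow> Xs i \<in> borel_measurable M" .
  have fX [measurable]: "(\<lambda>\<omega>. f (emb (Xs i \<omega>))) \<in> borel_measurable M" if "i \<in> {1..n}" for i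
    by (rule measurable_compose[OF Xm[OF that] f])
  have [measurable]: "(\<lambda>\<omega>. MAX i\<in>{1..n}. f (emb (Xs i \<omega>))) \<in> borel_measurable M"
    by (rule borel_measurable_Max) (auto intro: fX)
  have "(\<lambda>\<omega>. argmax_index f Xs n \<omega>) \<in> measurable M (count_space UNIV)"
    unfolding argmax_index_def
  proof (rule measurable_Least)
    fix k
    show "Measurable.pred M (\<lambda>\<omega>. k \<in> {1..n} \<and> f (emb (Xs k \<omega>)) = (MAX i\<in>{1..n}. f (emb (Xs i \<omega>))))"
    proof (cases "k \<in> {1..n}")
      case True
      note fX[OF True, measurable]
      show ?thesis using True by simp
    qed simp
  qed
  then show "(\<lambda>\<omega>. argmax_index f Xs n \<omega>) \<in> measurable M (count_space {1..n})"
    using measurable_sets[of _ M "count_space UNIV"] argmax_index_in(1)[OF n, of f Xs]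
    by (subst measurable_count_space_eq2_countable) (auto simp: Pi_def)
qed simp

text \<open>Restricting to the event that the maximum is attained by a single index loses nothing in the
  limit, and it makes the contributions of the indices equal, without any discussion of ties.\<close>

lemma argmax_lower_bound:
  fixes Xs :: "nat \<Rightarrow> 'a \<Rightarrow> real ^ 'd::finite" and u :: "real ^ 'd \<Rightarrow> ennreal"
  assumes M: "prob_space M" and X [measurable]: "X \<in> borel_measurable M" and ind: "independent_copies M X Xs"
    and f: "(\<lambda>y. f (emb y)) \<in> borel_measurable borel" and u [measurable]: "u \<in> borel_measurable borel" and n: "n \<ge> 1"
  shows "of_nat n * (\<integral>\<^sup>+\<omega>. u (X \<omega>) * emeasure M {\<omega>' \<in> space M. f (emb (X \<omega>')) < f (emb (X \<omega>))} ^ (n - 1) \<partial>M)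
    \<le> (\<integral>\<^sup>+\<omega>. u (Xs (argmax_index f Xs n \<omega>) \<omega>) \<partial>M)"
proof -
  interpret prob_space M by fact
  define \<phi> where "\<phi> = (\<lambda>y. f (emb y))"
  have \<phi> [measurable]: "\<phi> \<in> borel_measurable borel" using f by (simp add: \<phi>_def)
  define P where "P = distr M borel X"
  interpret P: prob_space P unfolding P_def by (rule prob_space_distr) fact
  have sets_P [measurable_cong, simp]: "sets P = sets borel" by (simp add: P_def)
  have space_P [simp]: "space P = UNIV" by (simp add: P_def)
  define I where "I = {1..n}"
  have I: "finite I" "I \<noteq> {}" using n by (auto simp: I_def)
  have Xm: "Xs i \<in> borel_measurable M" if "i \<in> I" for i
    using that by (intro independent_copies_measurable[OF M ind]) (auto simp: I_def)
  interpret product_sigma_finite "\<lambda>_. P" ..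
  have "indep_vars (\<lambda>_. borel) Xs I"
    using ind by (auto simp: independent_copies_def I_def intro: indep_vars_subset)
  then have "distr M (\<Pi>\<^sub>M i\<in>I. borel) (\<lambda>\<omega>. \<lambda>i\<in>I. Xs i \<omega>) = (\<Pi>\<^sub>M i\<in>I. distr M borel (Xs i))"
    using indep_vars_iff_distr_eq_PiM'[of I Xs "\<lambda>_. borel"] I Xm by blast
  also have "\<dots> = (\<Pi>\<^sub>M i\<in>I. P)"
    using ind by (intro PiM_cong) (auto simp: independent_copies_def P_def I_def)
  finally have distr: "distr M (\<Pi>\<^sub>M i\<in>I. borel) (\<lambda>\<omega>. \<lambda>i\<in>I. Xs i \<omega>) = (\<Pi>\<^sub>M i\<in>I. P)" .
  have tuple: "(\<lambda>\<omega>. \<lambda>i\<in>I. Xs i \<omega>) \<in> measurable M (\<Pi>\<^sub>M i\<in>I. borel)"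
    by (intro measurable_restrict Xm)
  define w where "w = (\<lambda>y z. if \<phi> z < \<phi> y then 1 else 0 :: ennreal)"
  define q where "q = (\<lambda>y. \<integral>\<^sup>+z. w y z \<partial>P)"
  have w [measurable]: "(\<lambda>p. w (g p) (h p)) \<in> borel_measurable K"
    if [measurable]: "g \<in> borel_measurable K" "h \<in> borel_measurable K" for K :: "'z measure" and g h
    unfolding w_def by measurable
  have [measurable]: "q \<in> borel_measurable borel"
    unfolding q_def by (intro P.borel_measurable_nn_integral) (simp add: case_prod_beta')
  have q_eq: "q y = emeasure M {\<omega>' \<in> space M. f (emb (X \<omega>')) < \<phi> y}" for y
  proof -
    have "q y = (\<integral>\<^sup>+z. indicator {z. \<phi> z < \<phi> y} z \<partial>P)"
      unfolding q_def w_def by (intro nn_integral_cong) auto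
    also have "\<dots> = emeasure P {z. \<phi> z < \<phi> y}" by (rule nn_integral_indicator) measurable
    also have "\<dots> = emeasure M {\<omega>' \<in> space M. f (emb (X \<omega>')) < \<phi> y}"
    proof -
      have "{z. \<phi> z < \<phi> y} \<in> sets borel" by measurable
      then show ?thesis
        unfolding P_def by (subst emeasure_distr) (auto simp: \<phi>_def intro!: arg_cong[of _ _ "emeasure M"])
    qed
    finally show ?thesis .
  qed
  \<comment> \<open>\<open>T k x\<close> is \<open>u (x k)\<close> on the event that
    \<open>k\<close> is the only index of maximal loss, and 0 elsewhere.\<close>
  define T where "T = (\<lambda>k x. u (x k) * (\<Prod>i\<in>I - {k}. w (x k) (x i)) :: ennreal)"
  have comp: "(\<lambda>x. x i) \<in> borel_measurable (\<Pi>\<^sub>M i\<in>J. borel)" if "i \<in> J" for i and J :: "nat set"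
    using that by (rule measurable_component_singleton)
  have T_meas: "T k \<in> borel_measurable (\<Pi>\<^sub>M i\<in>I. borel)" if k: "k \<in> I" for k
  proof -
    have "(\<lambda>x. u (x k)) \<in> borel_measurable (\<Pi>\<^sub>M i\<in>I. borel)"
      by (rule measurable_compose[OF comp[OF k] u])
    moreover have "(\<lambda>x. \<Prod>i\<in>I - {k}. w (x k) (x i)) \<in> borel_measurable (\<Pi>\<^sub>M i\<in>I. borel)"
      by (rule borel_measurable_prod_ennreal) (rule w[OF comp[OF k] comp], simp)
    ultimately show ?thesis unfolding T_def by (rule borel_measurable_times_ennreal)
  qed
  have T_int: "(\<integral>\<^sup>+x. T k x \<partial>(\<Pi>\<^sub>M i\<in>I. P)) = (\<integral>\<^sup>+y. u y * q y ^ (n - 1) \<partial>P)" if k: "k \<in> I" for k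
  proof -
    let ?J = "I - {k}"
    have ins: "insert k ?J = I" using k by auto
    have T_meas': "T k \<in> borel_measurable (\<Pi>\<^sub>M i\<in>insert k ?J. P)"
      unfolding ins using T_meas[OF k] by (simp cong: measurable_cong_sets sets_PiM_cong)
    have "(\<integral>\<^sup>+x. T k x \<partial>(\<Pi>\<^sub>M i\<in>I. P)) = (\<integral>\<^sup>+x. T k x \<partial>(\<Pi>\<^sub>M i\<in>insert k ?J. P))" by (simp only: ins)
    \<comment> \<open>With the value \<open>y\<close> of coordinate \<open>k\<close> fixed, the
      other \<open>n - 1\<close> coordinates are independent and the product integrates to
      \<open>q y ^ (n - 1)\<close>.\<close>
    also have "\<dots> = (\<integral>\<^sup>+y. (\<integral>\<^sup>+x. T k (x(k := y)) \<partial>(\<Pi>\<^sub>M i\<in>?J. P)) \<partial>P)"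
      by (rule product_nn_integral_insert_rev) (use I T_meas' in auto)
    also have "\<dots> = (\<integral>\<^sup>+y. u y * q y ^ (n - 1) \<partial>P)"
    proof (rule nn_integral_cong)
      fix y
      have "T k (x(k := y)) = u y * (\<Prod>i\<in>?J. w y (x i))" for x
        unfolding T_def by (auto intro!: arg_cong[where f = "\<lambda>t. u y * t"] prod.cong)
      then have "(\<integral>\<^sup>+x. T k (x(k := y)) \<partial>(\<Pi>\<^sub>M i\<in>?J. P)) = (\<integral>\<^sup>+x. u y * (\<Prod>i\<in>?J. w y (x i)) \<partial>(\<Pi>\<^sub>M i\<in>?J. P))"
        by simp
      also have "\<dots> = u y * (\<integral>\<^sup>+x. (\<Prod>i\<in>?J. w y (x i)) \<partial>(\<Pi>\<^sub>M i\<in>?J. P))"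
      proof (rule nn_integral_cmult)
        have "(\<lambda>x. \<Prod>i\<in>?J. w y (x i)) \<in> borel_measurable (\<Pi>\<^sub>M i\<in>?J. borel)"
          by (rule borel_measurable_prod_ennreal) (rule w[OF measurable_const comp], simp_all)
        then show "(\<lambda>x. \<Prod>i\<in>?J. w y (x i)) \<in> borel_measurable (\<Pi>\<^sub>M i\<in>?J. P)"
          by (simp cong: measurable_cong_sets sets_PiM_cong)
      qed
      also have "(\<integral>\<^sup>+x. (\<Prod>i\<in>?J. w y (x i)) \<partial>(\<Pi>\<^sub>M i\<in>?J. P)) = (\<Prod>i\<in>?J. q y)"
        unfolding q_def using I by (intro product_nn_integral_prod) auto
      also have "\<dots> = q y ^ (n - 1)" using k by (simp add: I_def)
      finally show "(\<integral>\<^sup>+x. T k (x(k := y)) \<partial>(\<Pi>\<^sub>M i\<in>?J. P)) = u y * q y ^ (n - 1)" .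
    qed
    finally show ?thesis .
  qed
  have T_X: "(\<integral>\<^sup>+\<omega>. T k (\<lambda>i\<in>I. Xs i \<omega>) \<partial>M) = (\<integral>\<^sup>+y. u y * q y ^ (n - 1) \<partial>P)" if k: "k \<in> I" for k
    unfolding T_int[OF k, symmetric] distr[symmetric]
    by (rule nn_integral_distr[OF tuple, symmetric]) (simp add: T_meas[OF k])
  have T_meas_M: "(\<lambda>\<omega>. T k (\<lambda>i\<in>I. Xs i \<omega>)) \<in> borel_measurable M" if "k \<in> I" for k
    by (rule measurable_compose[OF tuple T_meas[OF that]])
  have "of_nat n * (\<integral>\<^sup>+\<omega>. u (X \<omega>) * emeasure M {\<omega>' \<in> space M. f (emb (X \<omega>')) < f (emb (X \<omega>))} ^ (n - 1) \<partial>M)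
      = of_nat n * (\<integral>\<^sup>+\<omega>. u (X \<omega>) * q (X \<omega>) ^ (n - 1) \<partial>M)"
    by (simp add: q_eq \<phi>_def)
  also have "(\<integral>\<^sup>+\<omega>. u (X \<omega>) * q (X \<omega>) ^ (n - 1) \<partial>M) = (\<integral>\<^sup>+y. u y * q y ^ (n - 1) \<partial>P)"
    unfolding P_def by (rule nn_integral_distr[symmetric]) auto
  also have "of_nat n * \<dots> = (\<Sum>k\<in>I. \<integral>\<^sup>+\<omega>. T k (\<lambda>i\<in>I. Xs i \<omega>) \<partial>M)"
    by (simp add: T_X) (simp add: I_def)
  also have "\<dots> = (\<integral>\<^sup>+\<omega>. (\<Sum>k\<in>I. T k (\<lambda>i\<in>I. Xs i \<omega>)) \<partial>M)"
    by (rule nn_integral_sum[symmetric]) (rule T_meas_M)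
  also have "\<dots> \<le> (\<integral>\<^sup>+\<omega>. u (Xs (argmax_index f Xs n \<omega>) \<omega>) \<partial>M)"
  proof (rule nn_integral_mono)
    fix \<omega>
    let ?k = "argmax_index f Xs n \<omega>"
    have kI: "?k \<in> I" using argmax_index_in(1)[OF n] by (simp add: I_def)
    \<comment> \<open>Two indices cannot both be the strict maximum, so at most the summand of the
      chosen index survives.\<close>
    have zero: "T k (\<lambda>i\<in>I. Xs i \<omega>) = 0" if k: "k \<in> I" "k \<noteq> ?k" for k
    proof -
      have "\<exists>i\<in>I - {k}. \<not> \<phi> (Xs i \<omega>) < \<phi> (Xs k \<omega>)"
      proof (rule ccontr)
        assume "\<not> ?thesis"
        then have "argmax_index f Xs n \<omega> = k"
          using k(1) by (intro argmax_index_eqI) (auto simp: I_def \<phi>_def)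
        then show False using k(2) by simp
      qed
      then have "\<exists>i\<in>I - {k}. w ((\<lambda>i\<in>I. Xs i \<omega>) k) ((\<lambda>i\<in>I. Xs i \<omega>) i) = 0"
        using k by (auto simp: w_def)
      then show ?thesis using I by (auto simp: T_def)
    qed
    have "(\<Sum>k\<in>I. T k (\<lambda>i\<in>I. Xs i \<omega>)) = T ?k (\<lambda>i\<in>I. Xs i \<omega>)"
      using zero kI I by (subst sum.remove[OF I(1) kI]) (auto intro!: sum.neutral)
    also have "\<dots> \<le> u (Xs ?k \<omega>) * 1"
      unfolding T_def using kI by (intro mult_mono prod_le_1) (auto simp: w_def)
    finally show "(\<Sum>k\<in>I. T k (\<lambda>i\<in>I. Xs i \<omega>)) \<le> u (Xs ?k \<omega>)" by simp
  qed
  finally show ?thesis .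
qed

section \<open>Extension of a function on the sphere to a loss, and uniqueness of
  \<open>g\<close>\<close>

context homogeneous_measure
begin

text \<open>Degree 1 and the values \<open>g\<close> on the sphere force this form at finite points
  off \<open>D\<close>. The remaining points form a set invariant under dilation, so the value 0
  there keeps the homogeneity.\<close>

definition homogeneous_ext :: "(real ^ 'd \<Rightarrow> real) \<Rightarrow> ('d \<Rightarrow> ereal) \<Rightarrow> ennreal" where
  "homogeneous_ext g x = (if x \<in> range emb \<and> x \<notin> D then \<tau> x * ennreal (g (angle \<tau> (unemb x))) else 0)"

lemma tau_S: "\<theta> \<in> S \<Longrightarrow> \<tau> (emb \<theta>) = 1"
  by (simp add: tau_sphere_def)

lemma S_off_D: "\<theta> \<in> S \<Longrightarrow> emb \<theta> \<notin> D"
  using tau_S[of \<theta>] tau_eq_0[of "emb \<theta>"] by auto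

lemma homogeneous_ext_S:
  assumes "\<theta> \<in> S"
  shows "homogeneous_ext g (emb \<theta>) = ennreal (g \<theta>)"
  using assms tau_S[OF assms] S_off_D[OF assms] by (simp add: homogeneous_ext_def angle_def)

lemma angle_scale:
  assumes "c > 0"
  shows "angle \<tau> (c *\<^sub>R y) = angle \<tau> y"
  using assms tau_dilate[OF assms, of "emb y"] by (simp add: angle_def dilate_emb enn2real_mult)

lemma assumption_H_homogeneous_ext:
  assumes adm: "admissible_g \<alpha> \<tau> \<nu> g"
  shows "assumption_H (homogeneous_ext g)"
  unfolding assumption_H_def
proof (intro conjI allI impI)
  note gm = admissible_measurable[OF adm]
  \<comment> \<open>\<open>g\<close> is measurable only on the sphere. Extended by 0 it can be
    composed with \<open>angle\<close>, whose values are known to lie on the sphere only off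
    \<open>D\<close>.\<close>
  have "(\<lambda>y. if y \<in> S then g y else 0) \<in> borel_measurable borel"
  proof -
    have "(\<lambda>y. indicator S y *\<^sub>R g y) \<in> borel_measurable borel"
      using gm by (subst (asm) borel_measurable_restrict_space_iff) auto
    also have "(\<lambda>y. indicator S y *\<^sub>R g y) = (\<lambda>y. if y \<in> S then g y else 0)"
      by (auto simp: fun_eq_iff indicator_def)
    finally show ?thesis .
  qed
  note [measurable] = this
  have "homogeneous_ext g = (\<lambda>x. if x \<in> range emb \<and> x \<notin> D then \<tau> x * ennreal ((\<lambda>y. if y \<in> S then g y else 0) (angle \<tau> (unemb x))) else 0)"
    by (auto simp: homogeneous_ext_def fun_eq_iff dest: angle_in_S)
  also have "\<dots> \<in> borel_measurable borel" by measurable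
  finally show "homogeneous_ext g \<in> borel_measurable borel" .
  show "homogeneous_ext g (emb y) < \<infinity>" for y
    using tau_emb[of y] by (simp add: homogeneous_ext_def ennreal_mult_less_top)
  show "homogeneous_ext g (emb 0) = 0"
    using emb_0_in_D by (simp add: homogeneous_ext_def)
  fix c :: real and x :: "'d \<Rightarrow> ereal" assume c: "c > 0"
  have "dilate c x \<in> range emb \<longleftrightarrow> x \<in> range emb"
  proof
    assume "dilate c x \<in> range emb"
    then obtain y where "dilate c x = emb y" by auto
    then have "dilate (1 / c) (dilate c x) = emb (y /\<^sub>R c)"
      using c by (simp add: dilate_emb divide_inverse)
    then show "x \<in> range emb" using c by (simp add: dilate_dilate)
  qed (auto simp: dilate_emb)
  then show "homogeneous_ext g (dilate c x) = ennreal c * homogeneous_ext g x"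
    using dilate_in_D_iff[OF c, of x] c
    by (auto simp: homogeneous_ext_def tau_dilate dilate_emb angle_scale mult.assoc)
qed

lemma level_const_homogeneous_ext:
  assumes adm: "admissible_g \<alpha> \<tau> \<nu> g"
  shows "level_const (homogeneous_ext g) \<nu> = 1"
proof -
  have "f_moment (homogeneous_ext g) = (\<integral>\<^sup>+\<theta>. ennreal (g \<theta> powr \<alpha>) \<partial>\<sigma>)"
    unfolding f_moment_def using adm
    by (intro nn_integral_cong) (auto simp: space_sigma homogeneous_ext_S admissible_g_def)
  then show ?thesis
    using adm by (simp add: level_const_eq[OF assumption_H_homogeneous_ext[OF adm]] admissible_g_def)
qed

text \<open>\<open>\<sigma>\<close> is the image under the angle of \<nu> restricted to finite
  points with radius above 1, so its null sets can be tested on \<nu>.\<close>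

lemma AE_sigmaI:
  assumes A: "A \<in> sets borel" and AE: "AE x in nu_ext. angle \<tau> (unemb x) \<in> A"
  shows "AE \<theta> in \<sigma>. \<theta> \<in> A"
proof -
  have "(\<integral>\<^sup>+\<theta>. indicator (- A) \<theta> \<partial>\<sigma>) = (\<integral>\<^sup>+x. indicator (- A) (angle \<tau> (unemb x)) * indicator {x \<in> range emb. 1 < \<tau> x} x \<partial>nu_ext)"
    using A by (intro nn_integral_sigma) auto
  also have "\<dots> = (\<integral>\<^sup>+x. 0 \<partial>nu_ext)"
    using AE by (intro nn_integral_cong_AE) (auto elim!: eventually_mono)
  finally have "(\<integral>\<^sup>+\<theta>. indicator (- A) \<theta> \<partial>\<sigma>) = 0" by simp
  moreover have "(indicator (- A) :: _ \<Rightarrow> ennreal) \<in> borel_measurable \<sigma>"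
    unfolding measurable_sigma_cong using A by (intro measurable_restrict_space1) auto
  ultimately have "AE \<theta> in \<sigma>. indicator (- A) \<theta> = (0::ennreal)"
    by (simp add: nn_integral_0_iff_AE)
  then show ?thesis by eventually_elim (auto simp: indicator_def split: if_splits)
qed

lemma prob_space_polar_representation:
  assumes rep: "polar_representation \<alpha> \<tau> \<nu> \<mu> g"
  shows "prob_space \<mu>"
proof -
  have adm: "admissible_g \<alpha> \<tau> \<nu> g" using rep by (simp add: polar_representation_def)
  obtain Q :: "(real \<times> real ^ 'd) measure" and Z \<Theta> where Q: "prob_space Q" "Z \<in> borel_measurable Q"
    "\<Theta> \<in> measurable Q (restrict_space borel S)" "\<mu> = distr Q borel (\<lambda>\<omega>. Z \<omega> *\<^sub>R (\<Theta> \<omega> /\<^sub>R g (\<Theta> \<omega>)))"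
    using rep unfolding polar_representation_def standard_frechet_def by blast
  have [measurable]: "\<Theta> \<in> borel_measurable Q" using Q(3) by (simp add: measurable_restrict_space2_iff)
  have [measurable]: "(\<lambda>\<omega>. g (\<Theta> \<omega>)) \<in> borel_measurable Q"
    by (rule measurable_compose[OF Q(3) admissible_measurable[OF adm]])
  note [measurable] = Q(2)
  show ?thesis unfolding Q(4) by (rule prob_space.prob_space_distr[OF Q(1)]) measurable
qed

text \<open>Both functions extend to losses with constant 1, and the law has both resulting
  densities with respect to \<nu>, so these agree almost everywhere. At a point of known radius the
  density determines the value of \<open>g\<close> at the angle, because exp(-s^(-\<alpha>)) is
  injective in s > 0.\<close>

lemma polar_representation_unique:
  assumes g: "polar_representation \<alpha> \<tau> \<nu> \<mu> g" and g': "polar_representation \<alpha> \<tau> \<nu> \<mu> g'"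
  shows "AE \<theta> in \<sigma>. g \<theta> = g' \<theta>"
proof -
  have adm: "admissible_g \<alpha> \<tau> \<nu> g" "admissible_g \<alpha> \<tau> \<nu> g'"
    using g g' by (auto simp: polar_representation_def)
  let ?d = "\<lambda>g. implicit_ev_density \<alpha> (homogeneous_ext g) \<nu>"
  have dm: "?d g \<in> borel_measurable borel" if "admissible_g \<alpha> \<tau> \<nu> g" for g
    by (intro implicit_ev_density_measurable H_measurable assumption_H_homogeneous_ext that)
  have int: "(\<integral>\<^sup>+y. G y \<partial>\<mu>) = (\<integral>\<^sup>+x. G (unemb x) * ?d g x \<partial>nu_ext)"
    if "polar_representation \<alpha> \<tau> \<nu> \<mu> g" "admissible_g \<alpha> \<tau> \<nu> g" and [measurable]: "G \<in> borel_measurable borel" for g G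
  proof -
    note [measurable] = dm[OF that(2)]
    have "(\<integral>\<^sup>+y. G y \<partial>\<mu>) = (\<integral>\<^sup>+x. G (unemb x) * ?d g x \<partial>\<nu>)"
      using level_const_homogeneous_ext[OF that(2)] that(2)
      by (intro polar_representation_integral[OF that(1) assumption_H_homogeneous_ext[OF that(2)], of 1])
        (auto simp: homogeneous_ext_S admissible_g_def)
    then show ?thesis by (subst nn_integral_nu_ext) auto
  qed
  \<comment> \<open>A finite integral is the condition under which equal density measures force the
    densities to agree almost everywhere; \<nu> itself may be infinite.\<close>
  have mass: "(\<integral>\<^sup>+x. ?d g x \<partial>nu_ext) = 1"
  proof -
    have "prob_space \<mu>" by (rule prob_space_polar_representation[OF g])
    then have "(\<integral>\<^sup>+y. 1 \<partial>\<mu>) = 1" by (simp add: prob_space.emeasure_space_1)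
    then show ?thesis using int[OF g adm(1), of "\<lambda>_. 1"] by simp
  qed
  have "density nu_ext (?d g) = density nu_ext (?d g')"
  proof (rule measure_eqI)
    fix A assume "A \<in> sets (density nu_ext (?d g))"
    then have A [measurable]: "A \<in> sets borel" by simp
    have emA: "emeasure (density nu_ext (?d h)) A = (\<integral>\<^sup>+y. indicator A (emb y) \<partial>\<mu>)"
      if h: "polar_representation \<alpha> \<tau> \<nu> \<mu> h" "admissible_g \<alpha> \<tau> \<nu> h" for h
    proof -
      have "emeasure (density nu_ext (?d h)) A = (\<integral>\<^sup>+x. ?d h x * indicator A x \<partial>nu_ext)"
        using dm[OF h(2)] by (intro emeasure_density) auto
      also have "\<dots> = (\<integral>\<^sup>+x. indicator A (emb (unemb x)) * ?d h x \<partial>nu_ext)"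
        using AE_nu_ext by (intro nn_integral_cong_AE) (auto elim!: eventually_mono simp: mult.commute)
      also have "\<dots> = (\<integral>\<^sup>+y. indicator A (emb y) \<partial>\<mu>)"
        by (rule int[OF h, symmetric]) measurable
      finally show ?thesis .
    qed
    show "emeasure (density nu_ext (?d g)) A = emeasure (density nu_ext (?d g')) A"
      using emA[OF g adm(1)] emA[OF g' adm(2)] by simp
  qed simp
  then have "AE x in nu_ext. ?d g x = ?d g' x"
    using dm[OF adm(1)] dm[OF adm(2)] mass by (subst (asm) finite_density_unique) auto
  with AE_nu_ext have "AE x in nu_ext. angle \<tau> (unemb x) \<in> {\<theta> \<in> S. g \<theta> = g' \<theta>}"
  proof eventually_elim
    case (elim x)
    then obtain y where y: "x = emb y" "emb y \<notin> D" by auto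
    have \<theta>: "angle \<tau> y \<in> S" using angle_in_S[OF y(2)] .
    obtain r where r: "\<tau> x = ennreal r" "r > 0"
      using tau_emb[of y] tau_eq_0[of x] y by (cases "\<tau> x") (auto simp: less_le)
    have nonneg: "0 \<le> g (angle \<tau> y)" "0 \<le> g' (angle \<tau> y)" using adm \<theta> by (auto simp: admissible_g_def)
    have ext: "homogeneous_ext h x = ennreal (r * h (angle \<tau> y))" if "0 \<le> h (angle \<tau> y)" for h
      using y r that by (simp add: homogeneous_ext_def ennreal_mult)
    have inj: "s = t" if "s > 0" "t > 0" "exp (- (s powr (- \<alpha>))) = exp (- (t powr (- \<alpha>)))" for s t :: real
    proof -
      have "s powr (- \<alpha>) = t powr (- \<alpha>)" using that by simp
      then have "(s powr (- \<alpha>)) powr (- 1 / \<alpha>) = (t powr (- \<alpha>)) powr (- 1 / \<alpha>)" by simp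
      then show ?thesis using \<alpha> that unfolding powr_powr by simp
    qed
    have d: "?d h x = (if h (angle \<tau> y) = 0 then 0 else ennreal (exp (- ((r * h (angle \<tau> y)) powr (- \<alpha>)))))"
      if "0 \<le> h (angle \<tau> y)" "admissible_g \<alpha> \<tau> \<nu> h" for h
      using that r ext[of h] by (auto simp: implicit_ev_density_def level_const_homogeneous_ext)
    have eq: "(if g (angle \<tau> y) = 0 then 0 else ennreal (exp (- ((r * g (angle \<tau> y)) powr (- \<alpha>))))) =
        (if g' (angle \<tau> y) = 0 then 0 else ennreal (exp (- ((r * g' (angle \<tau> y)) powr (- \<alpha>)))))"
      using elim(2) by (simp only: d[of g, OF nonneg(1) adm(1)] d[of g', OF nonneg(2) adm(2)])
    \<comment> \<open>The exponential is positive, so the density vanishes exactly where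
      \<open>g\<close> does. Zeros are compared before the exponents.\<close>
    have "g (angle \<tau> y) = g' (angle \<tau> y)"
    proof (cases "g (angle \<tau> y) = 0 \<or> g' (angle \<tau> y) = 0")
      case True
      then show ?thesis using eq by (metis ennreal_eq_0_iff exp_gt_zero not_le)
    next
      case False
      then have pos: "g (angle \<tau> y) > 0" "g' (angle \<tau> y) > 0" using nonneg by auto
      then have "exp (- ((r * g (angle \<tau> y)) powr (- \<alpha>))) = exp (- ((r * g' (angle \<tau> y)) powr (- \<alpha>)))"
        using eq by (simp add: less_imp_neq[symmetric])
      then have "r * g (angle \<tau> y) = r * g' (angle \<tau> y)"
        by (rule inj[OF mult_pos_pos[OF r(2) pos(1)] mult_pos_pos[OF r(2) pos(2)]])
      then show ?thesis using r by simp
    qed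
    then show ?case using \<theta> y by simp
  qed
  moreover have "{\<theta> \<in> S. g \<theta> = g' \<theta>} \<in> sets borel"
  proof -
    have "{\<theta> \<in> space (restrict_space borel S). g \<theta> = g' \<theta>} \<in> sets (restrict_space borel S)"
      using admissible_measurable[OF adm(1)] admissible_measurable[OF adm(2)] by measurable
    then show ?thesis by (simp add: space_restrict_space sets_restrict_space_iff)
  qed
  ultimately have "AE \<theta> in \<sigma>. \<theta> \<in> {\<theta> \<in> S. g \<theta> = g' \<theta>}" by (rule AE_sigmaI[rotated])
  then show ?thesis by eventually_elim simp
qed

end

text \<open>For \<open>1 - u\<close> the lower bound becomes an upper bound for \<open>u\<close>, as
  all laws have mass 1; affine rescaling then covers every bounded continuous function. Indices
  start at 1 because \<open>argmax_index\<close> searches an empty range at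
  \<open>n = 0\<close>.\<close>

lemma conv_in_distrI_liminf:
  fixes \<mu> :: "(real ^ 'd::finite) measure"
  assumes \<mu>: "prob_space \<mu>" "sets \<mu> = sets borel"
    and \<mu>s: "\<And>n. n \<ge> 1 \<Longrightarrow> prob_space (\<mu>s n)" "\<And>n. n \<ge> 1 \<Longrightarrow> sets (\<mu>s n) = sets borel"
    and lim: "\<And>u :: real ^ 'd \<Rightarrow> real. \<lbrakk>continuous_on UNIV u; \<And>y. 0 \<le> u y \<and> u y \<le> 1\<rbrakk> \<Longrightarrow>
      (\<integral>\<^sup>+y. ennreal (u y) \<partial>\<mu>) \<le> liminf (\<lambda>n. \<integral>\<^sup>+y. ennreal (u y) \<partial>\<mu>s n)"
  shows "conv_in_distr \<mu>s \<mu>"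
proof -
  have meas: "u \<in> borel_measurable K" if "continuous_on UNIV u" "sets K = sets borel"
    for u :: "real ^ 'd \<Rightarrow> real" and K
    using borel_measurable_continuous_onI[OF that(1)] by (simp add: measurable_cong_sets[OF that(2) refl])
  have int: "integrable K u" "(\<integral>\<^sup>+y. ennreal (u y) \<partial>K) = ennreal (\<integral>y. u y \<partial>K)"
    if "continuous_on UNIV u" "\<And>y. 0 \<le> u y \<and> u y \<le> 1" "prob_space K" "sets K = sets borel"
    for u :: "real ^ 'd \<Rightarrow> real" and K
  proof -
    interpret prob_space K by fact
    show "integrable K u"
      using that(2) by (intro integrable_const_bound[of _ 1] meas that) auto
    then show "(\<integral>\<^sup>+y. ennreal (u y) \<partial>K) = ennreal (\<integral>y. u y \<partial>K)"
      using that(2) by (intro nn_integral_eq_integral) auto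
  qed
  have lower: "\<forall>\<^sub>F n in sequentially. (\<integral>y. u y \<partial>\<mu>) - e < (\<integral>y. u y \<partial>\<mu>s n)"
    if u: "continuous_on UNIV u" "\<And>y. 0 \<le> u y \<and> u y \<le> 1" and e: "e > 0" for u :: "real ^ 'd \<Rightarrow> real" and e
  proof (cases "(\<integral>y. u y \<partial>\<mu>) - e < 0")
    case True
    have "0 \<le> (\<integral>y. u y \<partial>\<mu>s n)" for n using u by (intro integral_nonneg_AE) auto
    then show ?thesis using True by (intro always_eventually allI) (meson less_le_trans)
  next
    case False
    have "ennreal ((\<integral>y. u y \<partial>\<mu>) - e) < ennreal (\<integral>y. u y \<partial>\<mu>)"
      using False e by (intro ennreal_lessI) auto
    also have "\<dots> \<le> liminf (\<lambda>n. \<integral>\<^sup>+y. ennreal (u y) \<partial>\<mu>s n)"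
      using lim[OF u] int(2)[OF u \<mu>] by simp
    finally have "\<forall>\<^sub>F n in sequentially. ennreal ((\<integral>y. u y \<partial>\<mu>) - e) < (\<integral>\<^sup>+y. ennreal (u y) \<partial>\<mu>s n)"
      by (rule less_LiminfD)
    then show ?thesis
      using eventually_ge_at_top[of 1]
    proof eventually_elim
      case (elim n)
      then show ?case
        using int(2)[OF u \<mu>s(1)[OF elim(2)] \<mu>s(2)[OF elim(2)]] False by (simp add: ennreal_less_iff)
    qed
  qed
  have unit: "(\<lambda>n. \<integral>y. u y \<partial>\<mu>s n) \<longlonglongrightarrow> (\<integral>y. u y \<partial>\<mu>)"
    if u: "continuous_on UNIV u" "\<And>y. 0 \<le> u y \<and> u y \<le> 1" for u :: "real ^ 'd \<Rightarrow> real"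
  proof (rule tendstoI)
    fix e :: real assume e: "e > 0"
    have u': "continuous_on UNIV (\<lambda>y. 1 - u y)" "\<And>y. 0 \<le> 1 - u y \<and> 1 - u y \<le> 1"
      using u by (auto intro: continuous_intros)
    have compl: "(\<integral>y. 1 - u y \<partial>K) = 1 - (\<integral>y. u y \<partial>K)" if "prob_space K" "sets K = sets borel" for K
    proof -
      interpret prob_space K by fact
      show ?thesis using int(1)[OF u that] by (simp add: prob_space)
    qed
    show "\<forall>\<^sub>F n in sequentially. dist (\<integral>y. u y \<partial>\<mu>s n) (\<integral>y. u y \<partial>\<mu>) < e"
      using lower[OF u e] lower[OF u' e] eventually_ge_at_top[of 1]
    proof eventually_elim
      case (elim n)
      then show ?case
        using compl[OF \<mu>] compl[OF \<mu>s(1)[OF elim(3)] \<mu>s(2)[OF elim(3)]] by (simp add: dist_real_def)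
    qed
  qed
  show ?thesis
    unfolding conv_in_distr_def
  proof (intro allI impI)
    fix h :: "real ^ 'd \<Rightarrow> real" assume h: "continuous_on UNIV h \<and> bounded (range h)"
    then obtain B where "\<And>y. \<bar>h y\<bar> \<le> B" by (auto simp: bounded_iff)
    then have "\<bar>h y\<bar> \<le> max 1 B" for y by (meson le_max_iff_disj)
    \<comment> \<open>A bound of at least 1 permits division by \<open>2 * B\<close> even for
      \<open>h = 0\<close>.\<close>
    then obtain B where B: "\<And>y. \<bar>h y\<bar> \<le> B" "B \<ge> 1" by (meson max.cobounded1)
    define u where "u = (\<lambda>y. (h y + B) / (2 * B))"
    have u: "continuous_on UNIV u" "0 \<le> u y \<and> u y \<le> 1" for y
    proof -
      show "continuous_on UNIV u" unfolding u_def using h B(2) by (intro continuous_intros) auto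
      have "- B \<le> h y" "h y \<le> B" using B(1)[of y] by (simp_all add: abs_le_iff)
      then show "0 \<le> u y \<and> u y \<le> 1" using B(2) by (simp add: u_def field_simps)
    qed
    have eq: "(\<integral>y. h y \<partial>K) = 2 * B * (\<integral>y. u y \<partial>K) - B" if "prob_space K" "sets K = sets borel" for K
    proof -
      interpret prob_space K by fact
      have "(\<integral>y. h y \<partial>K) = (\<integral>y. 2 * B * u y - B \<partial>K)"
        using B(2) by (intro Bochner_Integration.integral_cong) (auto simp: u_def)
      also have "\<dots> = 2 * B * (\<integral>y. u y \<partial>K) - B"
        using int(1)[OF u that] by (simp add: prob_space)
      finally show ?thesis .
    qed
    show "(\<lambda>n. \<integral>y. h y \<partial>\<mu>s n) \<longlonglongrightarrow> (\<integral>y. h y \<partial>\<mu>)"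
    proof (rule Lim_transform_eventually)
      show "(\<lambda>n. 2 * B * (\<integral>y. u y \<partial>\<mu>s n) - B) \<longlonglongrightarrow> (\<integral>y. h y \<partial>\<mu>)"
        unfolding eq[OF \<mu>] by (intro tendsto_intros unit u)
      show "\<forall>\<^sub>F n in sequentially. 2 * B * (\<integral>y. u y \<partial>\<mu>s n) - B = (\<integral>y. h y \<partial>\<mu>s n)"
        using eventually_ge_at_top[of 1] by eventually_elim (simp add: eq[OF \<mu>s])
    qed
  qed
qed

text \<open>A common positive factor multiplies all losses alike, so it leaves the comparisons and
  the chosen index unchanged.\<close>

lemma Xs_argmax_scaled_lower:
  fixes Xs :: "nat \<Rightarrow> 'a \<Rightarrow> real ^ 'd::finite" and u :: "real ^ 'd \<Rightarrow> ennreal"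
  assumes M: "prob_space M" and X [measurable]: "X \<in> borel_measurable M" and ind: "independent_copies M X Xs"
    and H: "assumption_H f" and u [measurable]: "u \<in> borel_measurable borel" and n: "n \<ge> 1" and a: "a > 0"
  shows "of_nat n * (\<integral>\<^sup>+\<omega>. u (X \<omega> /\<^sub>R a) * emeasure M {\<omega>' \<in> space M. f (emb (X \<omega>' /\<^sub>R a)) < f (emb (X \<omega> /\<^sub>R a))} ^ (n - 1) \<partial>M)
    \<le> (\<integral>\<^sup>+\<omega>. u (Xs (argmax_index f Xs n \<omega>) \<omega> /\<^sub>R a) \<partial>M)"
proof -
  note [measurable] = H_measurable[OF H]
  have "f (emb (x /\<^sub>R a)) < f (emb (y /\<^sub>R a)) \<longleftrightarrow> f (emb x) < f (emb y)" for x y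
  proof -
    have "f (emb (x /\<^sub>R a)) = ennreal (inverse a) * f (emb x)" for x
      using H_homogeneous[OF H, of "inverse a" x] a by simp
    moreover obtain s t where "f (emb x) = ennreal s" "f (emb y) = ennreal t" "s \<ge> 0" "t \<ge> 0"
      using H_finite[OF H, of x] H_finite[OF H, of y] by (cases "f (emb x)"; cases "f (emb y)") auto
    ultimately show ?thesis using a by (simp add: ennreal_mult[symmetric] ennreal_less_iff)
  qed
  then show ?thesis
    using argmax_lower_bound[OF M X ind, of f "\<lambda>y. u (y /\<^sub>R a)" n] n by simp
qed

text \<open>The truncation at 0 changes finitely many terms. It keeps the base non-negative, so that
  its powers can be compared monotonically for every \<open>n\<close>.\<close>

lemma power_one_minus_tendsto_exp:
  "(\<lambda>n. max 0 (1 - c / real n) ^ n) \<longlonglongrightarrow> exp (- c)"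
proof (rule Lim_transform_eventually)
  show "(\<lambda>n. (1 + (- c) / real n) ^ n) \<longlonglongrightarrow> exp (- c)" by (rule tendsto_exp_limit_sequentially)
  obtain N :: nat where N: "\<bar>c\<bar> < real N" using reals_Archimedean2 by blast
  show "\<forall>\<^sub>F n in sequentially. (1 + (- c) / real n) ^ n = max 0 (1 - c / real n) ^ n"
    using eventually_ge_at_top[of N]
  proof eventually_elim
    case (elim n)
    then have "c \<le> real n" "real n > 0" using N by linarith+
    then have "0 \<le> 1 - c / real n" by (simp add: field_simps)
    then show ?case by simp
  qed
qed

text \<open>The exponents differ on purpose: only \<open>n - 1\<close> indices compete, while the
  exponential limit is stated for the power \<open>n\<close>. As the base is at most 1, the extra
  factor only weakens the lower bound.\<close>

lemma emeasure_less_ge: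
  assumes M: "prob_space M" and A: "{\<omega> \<in> space M. y \<le> g \<omega>} \<in> sets M" and c: "c \<ge> 0"
    and le: "emeasure M {\<omega> \<in> space M. y \<le> g \<omega>} \<le> ennreal (c / real n)" and n: "n \<ge> 1"
  shows "ennreal (max 0 (1 - c / real n) ^ n) \<le> emeasure M {\<omega> \<in> space M. g \<omega> < (y :: ennreal)} ^ (n - 1)"
proof -
  interpret prob_space M by fact
  have eq: "{\<omega> \<in> space M. g \<omega> < y} = space M - {\<omega> \<in> space M. y \<le> g \<omega>}" by auto
  have "prob {\<omega> \<in> space M. y \<le> g \<omega>} \<le> c / real n"
    using le c by (simp add: emeasure_eq_measure)
  then have "max 0 (1 - c / real n) \<le> prob {\<omega> \<in> space M. g \<omega> < y}"
    unfolding eq by (simp add: prob_compl[OF A])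
  then have "max 0 (1 - c / real n) ^ (n - 1) \<le> prob {\<omega> \<in> space M. g \<omega> < y} ^ (n - 1)"
    by (intro power_mono) auto
  moreover have "max 0 (1 - c / real n) ^ n \<le> max 0 (1 - c / real n) ^ (n - 1)"
    using c by (intro power_decreasing) auto
  ultimately show ?thesis
    by (simp add: emeasure_eq_measure ennreal_power)
qed

section \<open>Sampling from a law cut out of \<nu>\<close>

context homogeneous_measure
begin

lemma assumption_H_tau: "assumption_H \<tau>"
  using tau_emb emb_0_in_D by (auto simp: assumption_H_def tau_dilate tau_eq_0)

text \<open>By homogeneity a vanishing constant makes every level \<open>y > 0\<close> null, and the
  levels \<open>1 / Suc j\<close> exhaust the set where \<open>f\<close> is positive.\<close>

lemma AE_zero_if_level_zero:
  assumes H: "assumption_H f" and zero: "level_const f \<nu> = 0"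
  shows "AE x in \<nu>. f x = 0"
proof -
  have null: "emeasure \<nu> {x \<in> space \<nu>. ennreal y < f x} = 0" if "y > 0" for y
    using emeasure_gt[OF H that] zero by (simp add: level_const_eq[OF H])
  have "AE x in \<nu>. \<not> ennreal (1 / Suc j) < f x" for j
    using null[of "1 / Suc j"] measurable_nu[OF H_measurable[OF H]]
    by (subst AE_iff_measurable[OF _ refl]) auto
  then have "AE x in \<nu>. \<forall>j::nat. \<not> ennreal (1 / Suc j) < f x" by (simp add: AE_all_countable)
  then show ?thesis
  proof eventually_elim
    case (elim x)
    show ?case
    proof (cases "f x")
      case (real t)
      show ?thesis
      proof (rule ccontr)
        assume "f x \<noteq> 0"
        then have "t > 0" using real by (auto simp: less_le)
        then obtain j where "inverse (real (Suc j)) < t" using reals_Archimedean by blast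
        then show False using elim real by (auto simp: ennreal_less_iff inverse_eq_divide)
      qed
    next
      case top
      then show ?thesis using elim[rule_format, of 0] by simp
    qed
  qed
qed

text \<open>\<open>\<tau>\<close> is itself a homogeneous loss. Its level set lies in a compact set
  off \<open>D\<close>, so the constant is finite; it cannot be 0, since \<open>\<tau>\<close> is
  positive off \<open>D\<close> and \<nu> is non-trivial.\<close>

lemma tau_level: obtains s where "level_const \<tau> \<nu> = ennreal s" "s > 0"
proof -
  let ?s = "level_const \<tau> \<nu>"
  have "?s \<le> emeasure \<nu> {x. 1 \<le> \<tau> x}"
    unfolding level_const_def using superlevel_subset[of 1] compact_imp_closed_ereal_fun[OF compact_superlevel[of 1]]
    by (intro emeasure_mono) (auto simp: sets_nu_iff)
  also have "\<dots> < \<infinity>" by (intro emeasure_level_finite) simp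
  finally have fin: "?s < \<infinity>" .
  have "?s \<noteq> 0"
  proof
    assume "?s = 0"
    from AE_zero_if_level_zero[OF assumption_H_tau this] AE_space have "AE x in \<nu>. False"
      by eventually_elim (simp add: space_nu tau_eq_0)
    then show False using nontrivial by (simp add: AE_iff_measurable[OF _ refl])
  qed
  then show ?thesis using that fin by (cases ?s) (auto simp: less_le)
qed

text \<open>A concrete regularly varying law: \<open>\<nu>\<close> restricted to \<open>\<tau> > r\<close>, where \<open>r\<close> normalizes the mass.
  Scaling turns it into \<open>\<nu>\<close> restricted to \<open>\<tau> > r / a\<^sub>n\<close>, which increases to \<open>\<nu>\<close>, so that no
  continuity of the loss function is needed for the convergence of the implicit extremes.\<close>

definition cut_radius :: real where
  "cut_radius = enn2real (level_const \<tau> \<nu>) powr (1 / \<alpha>)"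

definition cut_law :: "(real ^ 'd) measure" where
  "cut_law = distr (density nu_ext (indicator {x. ennreal cut_radius < \<tau> x})) borel unemb"

lemma cut_radius_pos: "cut_radius > 0"
proof -
  obtain s where "level_const \<tau> \<nu> = ennreal s" "s > 0" by (rule tau_level)
  then show ?thesis by (simp add: cut_radius_def)
qed

lemma sets_cut_law [measurable_cong, simp]: "sets cut_law = sets borel"
  by (simp add: cut_law_def)

lemma space_cut_law [simp]: "space cut_law = UNIV"
  by (simp add: cut_law_def)

lemma nn_integral_cut_law:
  assumes [measurable]: "G \<in> borel_measurable borel"
  shows "(\<integral>\<^sup>+y. G y \<partial>cut_law) = (\<integral>\<^sup>+x. indicator {x. ennreal cut_radius < \<tau> x} x * G (unemb x) \<partial>nu_ext)"
  unfolding cut_law_def by (subst nn_integral_distr) (auto simp: nn_integral_density)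

lemma prob_space_cut_law: "prob_space cut_law"
proof
  obtain s where s: "level_const \<tau> \<nu> = ennreal s" "s > 0" by (rule tau_level)
  have "(\<integral>\<^sup>+y. 1 \<partial>cut_law) = (\<integral>\<^sup>+x. indicator {x. ennreal cut_radius < \<tau> x} x \<partial>nu_ext)"
    by (subst nn_integral_cut_law) auto
  also have "\<dots> = emeasure nu_ext {x. ennreal cut_radius < \<tau> x}" by simp
  also have "\<dots> = emeasure \<nu> {x \<in> space \<nu>. ennreal cut_radius < \<tau> x}"
    by (subst emeasure_nu_ext) (auto simp: space_nu intro!: arg_cong[of _ _ "emeasure \<nu>"])
  also have "\<dots> = ennreal (cut_radius powr (- \<alpha>)) * ennreal s"
    using emeasure_gt[OF assumption_H_tau cut_radius_pos] s by (simp add: level_const_eq[OF assumption_H_tau, symmetric])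
  \<comment> \<open>The set where \<open>\<tau>\<close> exceeds \<open>r\<close> has mass
    \<open>s * r powr (- \<alpha>)\<close>, and \<open>r = s powr (1 / \<alpha>)\<close> makes it
    1.\<close>
  also have "cut_radius powr (- \<alpha>) = 1 / s"
    using s \<alpha> unfolding cut_radius_def powr_powr by (simp add: powr_minus divide_inverse)
  finally show "emeasure cut_law (space cut_law) = 1"
    using s by (simp add: ennreal_mult[symmetric])
qed

text \<open>With the normalization \<open>n powr (1 / \<alpha>)\<close> the scaling of \<nu>
  contributes exactly \<open>1 / n\<close>, which cancels the factor \<open>n\<close>. The identity
  is exact for each \<open>n\<close>, and only the cut depends on \<open>n\<close>.\<close>

lemma nn_integral_cut_law_scaled:
  assumes G [measurable]: "G \<in> borel_measurable borel" and n: "n \<ge> 1"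
  shows "of_nat n * (\<integral>\<^sup>+y. G (y /\<^sub>R (real n powr (1 / \<alpha>))) \<partial>cut_law) =
    (\<integral>\<^sup>+x. indicator {x. ennreal (cut_radius / real n powr (1 / \<alpha>)) < \<tau> x} x * G (unemb x) \<partial>nu_ext)"
proof -
  define b where "b = real n powr (1 / \<alpha>)"
  have b: "b > 0" using n by (simp add: b_def)
  let ?F = "\<lambda>x. indicator {x. ennreal (cut_radius / b) < \<tau> x} x * G (unemb x)"
  have "(\<integral>\<^sup>+y. G (y /\<^sub>R b) \<partial>cut_law) = (\<integral>\<^sup>+x. indicator {x. ennreal cut_radius < \<tau> x} x * G (unemb x /\<^sub>R b) \<partial>nu_ext)"
    by (rule nn_integral_cut_law) measurable
  also have "\<dots> = (\<integral>\<^sup>+x. ?F (dilate (1 / b) x) \<partial>nu_ext)"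
  proof (rule nn_integral_cong_AE, use AE_nu_ext in eventually_elim)
    fix x :: "'d \<Rightarrow> ereal" assume "x \<in> range emb \<and> x \<notin> D"
    then obtain y where y: "x = emb y" by auto
    obtain t where t: "\<tau> x = ennreal t" "t \<ge> 0" using tau_emb[of y] y by (cases "\<tau> x") auto
    have "\<tau> (dilate (1 / b) x) = ennreal (t / b)" using t b by (simp add: tau_dilate ennreal_mult[symmetric])
    then have "ennreal (cut_radius / b) < \<tau> (dilate (1 / b) x) \<longleftrightarrow> ennreal cut_radius < \<tau> x"
      using t b cut_radius_pos by (simp add: ennreal_less_iff divide_less_cancel)
    moreover have "unemb (dilate (1 / b) x) = unemb x /\<^sub>R b" by (simp add: y dilate_emb divide_inverse)
    ultimately show "indicator {x. ennreal cut_radius < \<tau> x} x * G (unemb x /\<^sub>R b) = ?F (dilate (1 / b) x)"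
      by (simp add: indicator_def)
  qed
  also have "\<dots> = ennreal ((1 / b) powr \<alpha>) * (\<integral>\<^sup>+x. ?F x \<partial>nu_ext)"
    using b by (intro scaling_nu_ext) auto
  also have "(1 / b) powr \<alpha> = 1 / real n"
    using n \<alpha> by (simp add: b_def powr_divide powr_powr)
  finally have "of_nat n * (\<integral>\<^sup>+y. G (y /\<^sub>R b) \<partial>cut_law) = of_nat n * ennreal (1 / real n) * (\<integral>\<^sup>+x. ?F x \<partial>nu_ext)"
    by (simp add: mult.assoc)
  also have "of_nat n * ennreal (1 / real n) = 1"
    using n by (simp add: ennreal_of_nat_eq_real_of_nat ennreal_mult[symmetric])
  finally show ?thesis by (simp add: b_def)
qed

text \<open>The integrals of a test function are eventually constant: its support is compact off
  \<open>D\<close>, so \<open>\<tau>\<close> exceeds some \<open>t > 0\<close> there, and the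
  shrinking cut radius drops below \<open>t\<close>.\<close>

lemma regularly_varying_cut_law:
  fixes M :: "'z measure"
  assumes M: "prob_space M" and X [measurable]: "X \<in> borel_measurable M" and law: "distr M borel X = cut_law"
  shows "regularly_varying \<alpha> (\<lambda>n. real n powr (1 / \<alpha>)) D \<nu> M X"
  unfolding regularly_varying_def
proof (intro conjI allI impI)
  let ?a = "\<lambda>n. real n powr (1 / \<alpha>)"
  show "emeasure \<nu> (space \<nu>) \<noteq> 0" by (rule nontrivial)
  show "regularly_varying_seq (1 / \<alpha>) ?a"
    unfolding regularly_varying_seq_def
  proof (intro allI impI)
    fix c :: real assume c: "c > 0"
    have "(\<lambda>n. real (nat \<lfloor>c * real n\<rfloor>) / real n) \<longlonglongrightarrow> c" using c by real_asymp
    then have "(\<lambda>n. (real (nat \<lfloor>c * real n\<rfloor>) / real n) powr (1 / \<alpha>)) \<longlonglongrightarrow> c powr (1 / \<alpha>)"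
      using c by (intro tendsto_powr) auto
    then show "(\<lambda>n. ?a (nat \<lfloor>c * real n\<rfloor>) / ?a n) \<longlonglongrightarrow> c powr (1 / \<alpha>)"
      by (simp add: powr_divide)
  qed
  have scaled: "scaled_law D ?a M X n = density \<nu> (\<lambda>x. ennreal (indicator {x. ennreal (cut_radius / ?a n) < \<tau> x} x))"
    if n: "n \<ge> 1" for n
  proof (rule measure_eqI)
    show "sets (scaled_law D ?a M X n) = sets (density \<nu> (\<lambda>x. ennreal (indicator {x. ennreal (cut_radius / ?a n) < \<tau> x} x)))"
      by (simp add: sets_scaled_law sets_nu)
    fix A assume "A \<in> sets (scaled_law D ?a M X n)"
    then have A [measurable]: "A \<in> sets borel" and AD: "A \<subseteq> - D"
      by (simp_all add: sets_off[OF sets_scaled_law])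
    have A\<nu>: "A \<in> sets \<nu>" using A AD by (simp add: sets_nu_iff)
    have "emeasure (scaled_law D ?a M X n) A = (\<integral>\<^sup>+x. indicator A x \<partial>scaled_law D ?a M X n)"
      using A AD by (intro nn_integral_indicator[symmetric]) (simp add: sets_off[OF sets_scaled_law])
    also have "\<dots> = of_nat n * (\<integral>\<^sup>+\<omega>. indicator A (emb (X \<omega> /\<^sub>R ?a n)) * indicator (- D) (emb (X \<omega> /\<^sub>R ?a n)) \<partial>M)"
      by (rule nn_integral_scaled_law[OF X]) measurable
    also have "(\<integral>\<^sup>+\<omega>. indicator A (emb (X \<omega> /\<^sub>R ?a n)) * indicator (- D) (emb (X \<omega> /\<^sub>R ?a n)) \<partial>M) =
        (\<integral>\<^sup>+\<omega>. indicator A (emb (X \<omega> /\<^sub>R ?a n)) \<partial>M)"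
      using AD by (intro nn_integral_cong) (auto simp: indicator_def)
    also have "\<dots> = (\<integral>\<^sup>+y. indicator A (emb (y /\<^sub>R ?a n)) \<partial>cut_law)"
      unfolding law[symmetric] by (rule nn_integral_distr[symmetric]) measurable
    also have "of_nat n * \<dots> = (\<integral>\<^sup>+x. indicator {x. ennreal (cut_radius / ?a n) < \<tau> x} x * indicator A (emb (unemb x)) \<partial>nu_ext)"
      by (rule nn_integral_cut_law_scaled[OF _ n, of "\<lambda>y. indicator A (emb y)"]) measurable
    also have "\<dots> = (\<integral>\<^sup>+x. ennreal (indicator {x. ennreal (cut_radius / ?a n) < \<tau> x} x) * indicator A x \<partial>nu_ext)"
      using AE_nu_ext by (intro nn_integral_cong_AE) (auto elim!: eventually_mono simp: ennreal_indicator)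
    also have "\<dots> = (\<integral>\<^sup>+x. ennreal (indicator {x. ennreal (cut_radius / ?a n) < \<tau> x} x) * indicator A x \<partial>\<nu>)"
      by (rule nn_integral_nu_ext) measurable
    also have "\<dots> = emeasure (density \<nu> (\<lambda>x. ennreal (indicator {x. ennreal (cut_radius / ?a n) < \<tau> x} x))) A"
      by (intro emeasure_density[symmetric] measurable_nu A\<nu>) measurable
    finally show "emeasure (scaled_law D ?a M X n) A =
      emeasure (density \<nu> (\<lambda>x. ennreal (indicator {x. ennreal (cut_radius / ?a n) < \<tau> x} x))) A" .
  qed
  have "vague_conv D (scaled_law D ?a M X) \<nu>"
    unfolding vague_conv_def
  proof (intro allI impI, elim conjE exE)
    fix h :: "('d \<Rightarrow> ereal) \<Rightarrow> real" and K
    assume h: "continuous_on (- D) h" and K: "compact K" "K \<subseteq> - D" "\<forall>x\<in>- D - K. h x = 0"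
    have hm: "h \<in> borel_measurable \<nu>"
      using borel_measurable_continuous_on_restrict[OF h] by (simp add: measurable_cong_sets[OF sets_nu refl])
    obtain t where t: "t > 0" "\<And>x. x \<in> K \<Longrightarrow> ennreal t < \<tau> x"
    proof (cases "K = {}")
      case False
      obtain x0 where x0: "x0 \<in> K" "\<And>x. x \<in> K \<Longrightarrow> \<tau> x0 \<le> \<tau> x"
        using continuous_attains_inf[OF K(1) False continuous_on_subset[OF continuous_tau]] by blast
      moreover have "\<tau> x0 > 0" using x0(1) K(2) tau_eq_0[of x0] by (auto simp: zero_less_iff_neq_zero)
      then obtain z where z: "0 < z" "z < \<tau> x0" using dense by blast
      then obtain t where "z = ennreal t" "t > 0" by (cases z) auto
      then show ?thesis using that z x0(2) by (meson less_le_trans)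
    qed (use that[of 1] in auto)
    define p where "p = 1 / \<alpha>"
    have "p > 0" using \<alpha> by (simp add: p_def)
    then have "filterlim (\<lambda>n. real n powr p) at_top sequentially" by real_asymp
    then have "(\<lambda>n. cut_radius / ?a n) \<longlonglongrightarrow> 0"
      unfolding p_def by (rule real_tendsto_divide_at_top[OF tendsto_const])
    then have "\<forall>\<^sub>F n in sequentially. cut_radius / ?a n < t" using t(1) by (rule order_tendstoD)
    then have "\<forall>\<^sub>F n in sequentially. integral\<^sup>L \<nu> h = integral\<^sup>L (scaled_law D ?a M X n) h"
      using eventually_ge_at_top[of 1]
    proof eventually_elim
      case (elim n)
      have "integral\<^sup>L (scaled_law D ?a M X n) h = (\<integral>x. indicator {x. ennreal (cut_radius / ?a n) < \<tau> x} x *\<^sub>R h x \<partial>\<nu>)"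
        unfolding scaled[OF elim(2)] by (intro integral_density hm measurable_nu) auto
      also have "\<dots> = integral\<^sup>L \<nu> h"
      proof (rule Bochner_Integration.integral_cong)
        fix x assume "x \<in> space \<nu>"
        then have x: "x \<in> - D" by (simp add: space_nu)
        show "indicator {x. ennreal (cut_radius / ?a n) < \<tau> x} x *\<^sub>R h x = h x"
        proof (cases "x \<in> K")
          case True
          have "ennreal (cut_radius / ?a n) \<le> ennreal t" using elim(1) by (intro ennreal_leI) simp
          also have "\<dots> < \<tau> x" by (rule t(2)[OF True])
          finally show ?thesis by simp
        qed (use K(3) x in auto)
      qed simp
      finally show ?case by simp
    qed
    then show "(\<lambda>n. integral\<^sup>L (scaled_law D ?a M X n) h) \<longlonglongrightarrow> integral\<^sup>L \<nu> h"
      by (rule Lim_transform_eventually[OF tendsto_const])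
  qed
  then show "vague_conv D (\<lambda>n. scale_measure (of_nat n) (restrict_space (distr M borel (\<lambda>\<omega>. emb (X \<omega> /\<^sub>R ?a n))) (- D))) \<nu>"
    by (simp only: scaled_law_def[abs_def])
qed (use M X radon null_infinite in auto)


text \<open>Sampling from \<open>cut_law\<close> makes the exceedance probabilities explicit for
  each \<open>n\<close>, so the lower bound for the extremes is an integral against the fixed
  measure \<open>nu_ext\<close> of functions converging almost everywhere. This covers losses that
  may violate F and C, such as the extension of an arbitrary admissible \<open>g\<close>.\<close>

lemma implicit_ev_lawI:
  assumes H: "assumption_H f" and C: "level_const f \<nu> = ennreal C" "C > 0"
    and \<mu>: "prob_space \<mu>" "sets \<mu> = sets borel" "emeasure \<mu> (emb -` D) = 0"
    and dens: "restrict_space (distr \<mu> borel emb) (- D) = density \<nu> (implicit_ev_density \<alpha> f \<nu>)"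
  shows "implicit_ev_law \<alpha> D f \<nu> \<mu>"
proof -
  note [measurable] = H_measurable[OF H]
  let ?a = "\<lambda>n. real n powr (1 / \<alpha>)"
  define M where "M = (\<Pi>\<^sub>M i\<in>(UNIV :: nat set). cut_law)"
  define Xs where "Xs = (\<lambda>(i::nat) (\<omega> :: nat \<Rightarrow> real ^ 'd). \<omega> i)"
  have M: "prob_space M" unfolding M_def by (intro prob_space_PiM prob_space_cut_law)
  interpret M: prob_space M by (rule M)
  have Xs [measurable]: "Xs i \<in> borel_measurable M" for i
    unfolding M_def Xs_def using measurable_component_singleton[of i UNIV "\<lambda>_. cut_law"]
    by (simp add: measurable_cong_sets[OF refl sets_cut_law])
  have law: "distr M borel (Xs i) = cut_law" for i
  proof -
    have "distr M borel (Xs i) = distr M cut_law (\<lambda>\<omega>. \<omega> i)" by (intro distr_cong) (simp_all add: Xs_def)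
    also have "\<dots> = cut_law"
      unfolding M_def by (rule distr_PiM_component[of UNIV "\<lambda>_. cut_law"]) (simp_all add: prob_space_cut_law)
    finally show ?thesis .
  qed
  have ind: "independent_copies M (Xs 1) Xs"
    unfolding independent_copies_def
  proof (intro conjI allI impI)
    have "distr M (\<Pi>\<^sub>M i\<in>{1..}. borel) (\<lambda>\<omega>. \<lambda>i\<in>{1..}. Xs i \<omega>) = (\<Pi>\<^sub>M i\<in>{1..}. cut_law)"
    proof -
      have "distr M (\<Pi>\<^sub>M i\<in>{1::nat..}. borel) (\<lambda>\<omega>. \<lambda>i\<in>{1..}. Xs i \<omega>) =
          distr M (\<Pi>\<^sub>M i\<in>{1::nat..}. cut_law) (\<lambda>\<omega>. \<lambda>i\<in>{1..}. \<omega> i)"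
        by (intro distr_cong) (simp_all add: Xs_def cong: sets_PiM_cong)
      also have "\<dots> = (\<Pi>\<^sub>M i\<in>{1..}. cut_law)"
        unfolding M_def using distr_PiM_reindex[of UNIV "\<lambda>_. cut_law" "\<lambda>i. i" "{1::nat..}"] prob_space_cut_law by simp
      finally show ?thesis .
    qed
    then show "M.indep_vars (\<lambda>_. borel) Xs {1..}"
      by (subst M.indep_vars_iff_distr_eq_PiM') (auto simp: law)
    show "distr M borel (Xs i) = distr M borel (Xs 1)" for i by (simp add: law)
  qed
  have rv: "regularly_varying \<alpha> ?a D \<nu> M (Xs 1)"
    by (intro regularly_varying_cut_law M law Xs)
  let ?ex = "\<lambda>n \<omega>. Xs (argmax_index f Xs n \<omega>) \<omega> /\<^sub>R ?a n"
  have exm: "?ex n \<in> borel_measurable M" if "n \<ge> 1" for n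
    using measurable_argmax[OF M ind _ that, of f] by measurable
  have eq_mu: "(\<integral>\<^sup>+y. G y \<partial>\<mu>) = (\<integral>\<^sup>+x. G (unemb x) * implicit_ev_density \<alpha> f \<nu> x \<partial>nu_ext)"
    if [measurable]: "G \<in> borel_measurable borel" for G
  proof -
    have "(\<integral>\<^sup>+y. G y \<partial>\<mu>) = (\<integral>\<^sup>+x. G (unemb x) * implicit_ev_density \<alpha> f \<nu> x \<partial>\<nu>)"
      using law_eq_density_iff[OF \<mu>(2,3), of "implicit_ev_density \<alpha> f \<nu>"] dens that
        implicit_ev_density_measurable[OF H_measurable[OF H]] by blast
    then show ?thesis by (subst nn_integral_nu_ext) auto
  qed
  have conv: "conv_in_distr (\<lambda>n. distr M borel (?ex n)) \<mu>"
  proof (rule conv_in_distrI_liminf[OF \<mu>(1,2)])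
    show "prob_space (distr M borel (?ex n))" if "n \<ge> 1" for n by (rule M.prob_space_distr[OF exm[OF that]])
    show "sets (distr M borel (?ex n)) = sets borel" for n by simp
    fix u :: "real ^ 'd \<Rightarrow> real" assume u: "continuous_on UNIV u" "\<And>y. 0 \<le> u y \<and> u y \<le> 1"
    have [measurable]: "u \<in> borel_measurable borel" by (rule borel_measurable_continuous_onI[OF u(1)])
    \<comment> \<open>At finite points this bounds from below the probability that
      \<open>n - 1\<close> further losses stay below \<open>f x\<close>. Where \<open>f\<close>
      vanishes it is set to 0, as is the density; the formula would give 1 there because
      \<open>0 powr (- \<alpha>) = 0\<close>.\<close>
    define e where "e = (\<lambda>n x. if f x = 0 then 0 else max 0 (1 - C * enn2real (f x) powr (- \<alpha>) / real n) ^ n)"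
    define \<phi> where "\<phi> = (\<lambda>n x. indicator {x. ennreal (cut_radius / ?a n) < \<tau> x} x * (ennreal (u (unemb x)) * ennreal (e n x)))"
    have [measurable]: "\<phi> n \<in> borel_measurable borel" for n
      unfolding \<phi>_def e_def by measurable
    have lower: "(\<integral>\<^sup>+x. \<phi> n x \<partial>nu_ext) \<le> (\<integral>\<^sup>+y. ennreal (u y) \<partial>distr M borel (?ex n))" if n: "n \<ge> 1" for n
    proof -
      have an: "?a n > 0" using n by simp
      let ?p = "\<lambda>y. emeasure M {\<omega>' \<in> space M. f (emb (Xs 1 \<omega>' /\<^sub>R ?a n)) < y}"
      have p: "ennreal (e n (emb y)) \<le> ?p (f (emb y)) ^ (n - 1)" for y
      proof (cases "f (emb y) = 0")
        case False
        then obtain t where t: "f (emb y) = ennreal t" "t > 0"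
          using H_finite[OF H, of y] by (cases "f (emb y)") (auto simp: less_le)
        have "emeasure M {\<omega> \<in> space M. ennreal t \<le> f (emb (Xs 1 \<omega> /\<^sub>R ?a n))} =
            (\<integral>\<^sup>+\<omega>. indicator {y. ennreal t \<le> f (emb y)} (Xs 1 \<omega> /\<^sub>R ?a n) \<partial>M)"
        proof -
          have "{\<omega> \<in> space M. ennreal t \<le> f (emb (Xs 1 \<omega> /\<^sub>R ?a n))} \<in> sets M" by measurable
          then have "emeasure M {\<omega> \<in> space M. ennreal t \<le> f (emb (Xs 1 \<omega> /\<^sub>R ?a n))} =
              (\<integral>\<^sup>+\<omega>. indicator {\<omega> \<in> space M. ennreal t \<le> f (emb (Xs 1 \<omega> /\<^sub>R ?a n))} \<omega> \<partial>M)"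
            by (rule nn_integral_indicator[symmetric])
          also have "\<dots> = (\<integral>\<^sup>+\<omega>. indicator {y. ennreal t \<le> f (emb y)} (Xs 1 \<omega> /\<^sub>R ?a n) \<partial>M)"
            by (intro nn_integral_cong) (auto simp: indicator_def)
          finally show ?thesis .
        qed
        also have "\<dots> = (\<integral>\<^sup>+y. indicator {y. ennreal t \<le> f (emb y)} (y /\<^sub>R ?a n) \<partial>cut_law)"
          unfolding law[of 1, symmetric] by (rule nn_integral_distr[symmetric]) measurable
        finally have "of_nat n * emeasure M {\<omega> \<in> space M. ennreal t \<le> f (emb (Xs 1 \<omega> /\<^sub>R ?a n))} =
            of_nat n * (\<integral>\<^sup>+y. indicator {y. ennreal t \<le> f (emb y)} (y /\<^sub>R ?a n) \<partial>cut_law)" by simp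
        also have "\<dots> = (\<integral>\<^sup>+x. indicator {x. ennreal (cut_radius / ?a n) < \<tau> x} x * indicator {y. ennreal t \<le> f (emb y)} (unemb x) \<partial>nu_ext)"
          by (rule nn_integral_cut_law_scaled[OF _ n]) measurable
        \<comment> \<open>Dropping the cut only enlarges the set, so the estimate holds for each
          \<open>n\<close> and not merely in the limit.\<close>
        also have "\<dots> \<le> (\<integral>\<^sup>+x. indicator {x \<in> space \<nu>. ennreal t \<le> f x} x \<partial>nu_ext)"
          using AE_nu_ext by (intro nn_integral_mono_AE, eventually_elim) (auto simp: indicator_def space_nu)
        also have "\<dots> = emeasure nu_ext {x \<in> space \<nu>. ennreal t \<le> f x}"
          by (rule nn_integral_indicator) (simp add: space_nu)
        also have "\<dots> = emeasure \<nu> {x \<in> space \<nu>. ennreal t \<le> f x}"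
          by (subst emeasure_nu_ext) (auto simp: space_nu intro!: arg_cong[of _ _ "emeasure \<nu>"])
        also have "\<dots> = ennreal (C * t powr (- \<alpha>))"
          using emeasure_ge[OF H t(2)] C by (simp add: level_const_eq[OF H, symmetric] ennreal_mult mult.commute)
        finally have le: "of_nat n * emeasure M {\<omega> \<in> space M. ennreal t \<le> f (emb (Xs 1 \<omega> /\<^sub>R ?a n))} \<le> ennreal (C * t powr (- \<alpha>))" .
        have "emeasure M {\<omega> \<in> space M. ennreal t \<le> f (emb (Xs 1 \<omega> /\<^sub>R ?a n))} \<le> ennreal (C * t powr (- \<alpha>) / real n)"
          using le n C by (simp add: M.emeasure_eq_measure ennreal_of_nat_eq_real_of_nat ennreal_mult[symmetric] field_simps)
        then have "ennreal (max 0 (1 - C * t powr (- \<alpha>) / real n) ^ n) \<le> ?p (ennreal t) ^ (n - 1)"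
          using C n by (intro emeasure_less_ge[OF M]) auto
        then show ?thesis using t False by (simp add: e_def)
      qed (simp add: e_def)
      have "(\<integral>\<^sup>+x. \<phi> n x \<partial>nu_ext) = (\<integral>\<^sup>+x. indicator {x. ennreal (cut_radius / ?a n) < \<tau> x} x * (ennreal (u (unemb x)) * ennreal (e n (emb (unemb x)))) \<partial>nu_ext)"
        using AE_nu_ext by (intro nn_integral_cong_AE) (auto elim!: eventually_mono simp: \<phi>_def)
      also have "\<dots> = of_nat n * (\<integral>\<^sup>+y. ennreal (u (y /\<^sub>R ?a n)) * ennreal (e n (emb (y /\<^sub>R ?a n))) \<partial>cut_law)"
        unfolding e_def by (rule nn_integral_cut_law_scaled[OF _ n, symmetric]) measurable
      also have "(\<integral>\<^sup>+y. ennreal (u (y /\<^sub>R ?a n)) * ennreal (e n (emb (y /\<^sub>R ?a n))) \<partial>cut_law) =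
          (\<integral>\<^sup>+\<omega>. ennreal (u (Xs 1 \<omega> /\<^sub>R ?a n)) * ennreal (e n (emb (Xs 1 \<omega> /\<^sub>R ?a n))) \<partial>M)"
        unfolding law[of 1, symmetric] e_def by (rule nn_integral_distr) measurable
      also have "of_nat n * \<dots> \<le> of_nat n * (\<integral>\<^sup>+\<omega>. ennreal (u (Xs 1 \<omega> /\<^sub>R ?a n)) * ?p (f (emb (Xs 1 \<omega> /\<^sub>R ?a n))) ^ (n - 1) \<partial>M)"
        by (intro mult_left_mono nn_integral_mono p) auto
      also have "\<dots> \<le> (\<integral>\<^sup>+\<omega>. ennreal (u (?ex n \<omega>)) \<partial>M)"
        by (rule Xs_argmax_scaled_lower[OF M Xs ind H _ n an]) measurable
      also have "\<dots> = (\<integral>\<^sup>+y. ennreal (u y) \<partial>distr M borel (?ex n))"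
        by (rule nn_integral_distr[OF exm[OF n], symmetric]) measurable
      finally show ?thesis .
    qed
    have "(\<integral>\<^sup>+y. ennreal (u y) \<partial>\<mu>) = (\<integral>\<^sup>+x. ennreal (u (unemb x)) * implicit_ev_density \<alpha> f \<nu> x \<partial>nu_ext)"
      by (rule eq_mu) measurable
    also have "\<dots> = (\<integral>\<^sup>+x. liminf (\<lambda>n. \<phi> n x) \<partial>nu_ext)"
    proof (rule nn_integral_cong_AE, use AE_nu_ext in eventually_elim)
      fix x :: "'d \<Rightarrow> ereal" assume x: "x \<in> range emb \<and> x \<notin> D"
      then obtain y where y: "x = emb y" by auto
      obtain t where t: "\<tau> x = ennreal t" "t > 0"
        using tau_emb[of y] y x tau_eq_0[of x] by (cases "\<tau> x") (auto simp: less_le)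
      obtain c where c: "f x = ennreal c" "c \<ge> 0" using H_finite[OF H, of y] y by (cases "f x") auto
      have "(\<lambda>n. \<phi> n x) \<longlonglongrightarrow> ennreal (u (unemb x)) * implicit_ev_density \<alpha> f \<nu> x"
      proof (rule Lim_transform_eventually)
        show "\<forall>\<^sub>F n in sequentially. ennreal (u (unemb x) * e n x) = \<phi> n x"
        proof -
          \<comment> \<open>The cut radius tends to 0, so at the fixed point \<open>x\<close>, of
            radius \<open>t > 0\<close>, the indicator in \<open>\<phi> n\<close> is eventually
            1.\<close>
          define p where "p = 1 / \<alpha>"
          have "p > 0" using \<alpha> by (simp add: p_def)
          then have "filterlim (\<lambda>n. real n powr p) at_top sequentially" by real_asymp
          then have "(\<lambda>n. cut_radius / ?a n) \<longlonglongrightarrow> 0"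
            unfolding p_def by (rule real_tendsto_divide_at_top[OF tendsto_const])
          then have "\<forall>\<^sub>F n in sequentially. cut_radius / ?a n < t" using t(2) by (rule order_tendstoD)
          then show ?thesis
          proof eventually_elim
            case (elim n)
            have "0 \<le> e n x" by (simp add: e_def)
            then show ?case using elim t u(2) by (simp add: \<phi>_def ennreal_lessI ennreal_mult)
          qed
        qed
        have "(\<lambda>n. e n x) \<longlonglongrightarrow> (if f x = 0 then 0 else exp (- (C * c powr (- \<alpha>))))"
          using power_one_minus_tendsto_exp[of "C * c powr (- \<alpha>)"] c by (simp add: e_def)
        then have "(\<lambda>n. ennreal (u (unemb x) * e n x)) \<longlonglongrightarrow> ennreal (u (unemb x) * (if f x = 0 then 0 else exp (- (C * c powr (- \<alpha>)))))"
          by (intro tendsto_ennrealI tendsto_mult tendsto_const)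
        also have "ennreal (u (unemb x) * (if f x = 0 then 0 else exp (- (C * c powr (- \<alpha>))))) =
            ennreal (u (unemb x)) * implicit_ev_density \<alpha> f \<nu> x"
          using u(2) C c by (simp add: implicit_ev_density_def ennreal_mult)
        finally show "(\<lambda>n. ennreal (u (unemb x) * e n x)) \<longlonglongrightarrow> ennreal (u (unemb x)) * implicit_ev_density \<alpha> f \<nu> x" .
      qed
      then show "ennreal (u (unemb x)) * implicit_ev_density \<alpha> f \<nu> x = liminf (\<lambda>n. \<phi> n x)"
        by (intro lim_imp_Liminf[symmetric]) auto
    qed
    also have "\<dots> \<le> liminf (\<lambda>n. \<integral>\<^sup>+x. \<phi> n x \<partial>nu_ext)"
      by (intro nn_integral_liminf) measurable
    also have "\<dots> \<le> liminf (\<lambda>n. \<integral>\<^sup>+y. ennreal (u y) \<partial>distr M borel (?ex n))"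
      by (intro Liminf_mono, use eventually_ge_at_top[of 1] in eventually_elim) (rule lower)
    finally show "(\<integral>\<^sup>+y. ennreal (u y) \<partial>\<mu>) \<le> liminf (\<lambda>n. \<integral>\<^sup>+y. ennreal (u y) \<partial>distr M borel (?ex n))" .
  qed
  have "implicit_extremes_limit \<alpha> ?a D f \<nu> M (Xs 1) Xs \<mu>"
    unfolding implicit_extremes_limit_def using rv ind conv by blast
  then show ?thesis
    unfolding implicit_ev_law_def using H C dens by auto
qed

end

section \<open>Convergence under assumptions F and C\<close>

text \<open>As in Polya's theorem, the pointwise lower bound is uniform because both sides are monotone
  and \<open>\<psi>\<close> takes every value in the open unit interval.\<close>

lemma uniform_lower_bound:
  fixes \<psi> :: "real \<Rightarrow> real" and q :: "nat \<Rightarrow> real \<Rightarrow> real"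
  assumes surj: "\<And>t. 0 < t \<Longrightarrow> t < 1 \<Longrightarrow> \<exists>y>0. \<psi> y = t"
    and \<psi>_mono: "\<And>y z. y > 0 \<Longrightarrow> z > 0 \<Longrightarrow> \<psi> y \<le> \<psi> z \<Longrightarrow> y \<le> z"
    and \<psi>_range: "\<And>y. y > 0 \<Longrightarrow> 0 \<le> \<psi> y \<and> \<psi> y < 1"
    and q_mono: "\<And>n y z. 0 < y \<Longrightarrow> y \<le> z \<Longrightarrow> q n y \<le> q n z"
    and q_nonneg: "\<And>n y. 0 \<le> q n y"
    and lower: "\<And>y \<eta>. y > 0 \<Longrightarrow> \<eta> > 0 \<Longrightarrow> \<forall>\<^sub>F n in sequentially. \<psi> y - \<eta> \<le> q n y"
    and \<epsilon>: "\<epsilon> > 0"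
  shows "\<forall>\<^sub>F n in sequentially. \<forall>y>0. \<psi> y - \<epsilon> \<le> q n y"
proof -
  \<comment> \<open>A grid of mesh \<open>1 / m\<close> in the unit interval: one mesh is lost by
    rounding \<open>\<psi> y\<close> down, another in the pointwise bound at the grid point, hence
    \<open>2 / m < \<epsilon>\<close>.\<close>
  obtain m :: nat where m: "2 / \<epsilon> < real m" using reals_Archimedean2 by blast
  then have m0: "real m > 0" using \<epsilon> by (meson divide_pos_pos less_trans zero_less_numeral)
  have m2: "2 / real m < \<epsilon>" using m m0 \<epsilon> by (simp add: field_simps)
  have "\<exists>y>0. \<psi> y = real j / real m" if "j \<in> {1..<m}" for j
    using that m0 by (intro surj) auto
  then obtain z where z: "\<And>j. j \<in> {1..<m} \<Longrightarrow> z j > 0 \<and> \<psi> (z j) = real j / real m" by metis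
  have "\<forall>\<^sub>F n in sequentially. \<forall>j\<in>{1..<m}. \<psi> (z j) - 1 / real m \<le> q n (z j)"
    using z m0 by (intro eventually_ball_finite ballI lower) auto
  then show ?thesis
  proof eventually_elim
    case (elim n)
    show ?case
    proof (intro allI impI)
      fix y :: real assume y: "y > 0"
      define j where "j = nat \<lfloor>real m * \<psi> y\<rfloor>"
      have nonneg: "0 \<le> real m * \<psi> y" using \<psi>_range[OF y] by simp
      have j: "real j \<le> real m * \<psi> y" "real m * \<psi> y < real j + 1"
        using nonneg unfolding j_def by linarith+
      have "real m * \<psi> y < real m" using \<psi>_range[OF y] m0 by simp
      then have jm: "j < m" using j(1) by linarith
      have up: "\<psi> y < (real j + 1) / real m" using j(2) m0 by (simp add: field_simps)
      show "\<psi> y - \<epsilon> \<le> q n y"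
      \<comment> \<open>The lowest cell has no grid point below it, as \<open>surj\<close> speaks of
        positive values only. There \<open>\<psi> y < 1 / m\<close>, and the bound follows from
        \<open>q\<close> being non-negative.\<close>
      proof (cases "j = 0")
        case True
        have "1 / real m \<le> 2 / real m" using m0 by (simp add: divide_right_mono)
        then have "\<psi> y - \<epsilon> \<le> 0" using up m2 True by simp
        then show ?thesis using q_nonneg[of n y] by linarith
      next
        case False
        then have J: "j \<in> {1..<m}" using jm by simp
        have "real j / real m \<le> \<psi> y" using j(1) m0 by (simp add: field_simps)
        then have "\<psi> (z j) \<le> \<psi> y" using z[OF J] by simp
        then have zy: "z j \<le> y" using \<psi>_mono[of "z j" y] z[OF J] y by blast
        have "q n (z j) \<le> q n y" using q_mono[OF _ zy, of n] z[OF J] by blast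
        moreover have "real j / real m - 1 / real m \<le> q n (z j)" using bspec[OF elim J] z[OF J] by metis
        moreover have "(real j + 1) / real m = real j / real m - 1 / real m + 2 / real m" by (simp add: add_divide_distrib)
        ultimately show ?thesis using up m2 by linarith
      qed
    qed
  qed
qed

text \<open>\<open>\<psi>\<close> is a Frechet distribution function with scale C^(1/\<alpha>),
  strictly increasing on the positive half-line with an explicit inverse. These are the hypotheses
  of \<open>uniform_lower_bound\<close>.\<close>

lemma frechet_cdf_properties:
  fixes C \<alpha> :: real
  assumes C: "C > 0" and \<alpha>: "\<alpha> > 0"
  defines "\<psi> \<equiv> (\<lambda>y. exp (- (C * y powr (- \<alpha>))))"
  shows "0 < t \<Longrightarrow> t < 1 \<Longrightarrow> \<exists>y>0. \<psi> y = t"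
    and "y > 0 \<Longrightarrow> z > 0 \<Longrightarrow> \<psi> y \<le> \<psi> z \<Longrightarrow> y \<le> z"
    and "y > 0 \<Longrightarrow> 0 \<le> \<psi> y \<and> \<psi> y < 1"
proof -
  show "\<exists>y>0. \<psi> y = t" if t: "0 < t" "t < 1"
  proof (intro exI conjI)
    have pos: "- ln t / C > 0" using t C ln_less_zero[of t] by (simp add: divide_neg_pos)
    show "(- ln t / C) powr (- 1 / \<alpha>) > 0" using pos by (simp only: powr_gt_zero)
    have "((- ln t / C) powr (- 1 / \<alpha>)) powr (- \<alpha>) = - ln t / C"
    proof -
      have "(x powr (- 1 / \<alpha>)) powr (- \<alpha>) = x" if "x > 0" for x :: real
        using that \<alpha> unfolding powr_powr by simp
      then show ?thesis using pos by blast
    qed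
    then show "\<psi> ((- ln t / C) powr (- 1 / \<alpha>)) = t" using t C by (simp add: \<psi>_def)
  qed
  show "y \<le> z" if "y > 0" "z > 0" "\<psi> y \<le> \<psi> z"
  proof (rule ccontr)
    assume "\<not> y \<le> z"
    then have "z powr \<alpha> < y powr \<alpha>" using that \<alpha> by (intro powr_less_mono2) auto
    then have "y powr (- \<alpha>) < z powr (- \<alpha>)" using that by (simp add: powr_minus less_imp_inverse_less)
    then show False using that C by (simp add: \<psi>_def)
  qed
  show "0 \<le> \<psi> y \<and> \<psi> y < 1" if "y > 0" using that C by (simp add: \<psi>_def)
qed

section \<open>Loss levels of a given sampling law and identification of the limit\<close>

context homogeneous_measure
begin

text \<open>Assumption F speaks of strict levels, hence the step down to \<open>y / 2\<close>. The
  neighbourhood of \<open>D\<close> that it yields is open, so it also misses the closure.\<close>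

lemma assumption_F_closure:
  assumes F: "assumption_F D f" and y: "y > 0"
  shows "compact (closure {x. ennreal y \<le> f x})" "closure {x. ennreal y \<le> f x} \<subseteq> - D"
proof -
  have "bounded_away D {x. f x > ennreal (y / 2)}" using F y by (simp add: assumption_F_def)
  then obtain U where U: "open U" "D \<subseteq> U" "{x. f x > ennreal (y / 2)} \<subseteq> - U" unfolding bounded_away_def by blast
  have "ennreal (y / 2) < ennreal y" using y by (intro ennreal_lessI) auto
  then have "{x. ennreal y \<le> f x} \<subseteq> - U" using U(3) by (auto dest: less_le_trans)
  then have "closure {x. ennreal y \<le> f x} \<subseteq> - U" using U(1) by (intro closure_minimal) auto
  then show "closure {x. ennreal y \<le> f x} \<subseteq> - D" using U(2) by auto
  show "compact (closure {x. ennreal y \<le> f x})" by (intro compact_closed_ereal_fun closed_closure)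
qed

text \<open>The two halves of F give the two bounds. Levels bounded away from \<open>D\<close> have
  finite mass, and a positive lower bound \<delta> for \<open>f\<close> on the set where
  \<open>\<tau> x \<ge> 1\<close> makes the level \<delta> at least as heavy as the unit level of
  \<open>\<tau>\<close>.\<close>

lemma level_const_finite_pos:
  assumes H: "assumption_H f" and F: "assumption_F D f"
  obtains C where "level_const f \<nu> = ennreal C" "C > 0"
proof -
  have "level_const f \<nu> \<le> emeasure \<nu> (closure {x. ennreal 1 \<le> f x})"
    unfolding level_const_def
    using closure_subset[of "{x. ennreal 1 \<le> f x}"] assumption_F_closure[OF F, of 1]
    by (intro emeasure_mono) (auto simp: sets_nu_iff)
  also have "\<dots> < \<infinity>" using radon assumption_F_closure[OF F, of 1] by (simp add: radon_off_def)
  finally have fin: "level_const f \<nu> < \<infinity>" .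
  let ?K = "{x. 1 \<le> \<tau> x}"
  have K: "compact ?K" "?K \<subseteq> - D" by (intro compact_superlevel superlevel_subset; simp)+
  have "(INF x\<in>?K. f x) > 0" using F K by (simp add: assumption_F_def)
  then obtain d where d: "0 < d" "d < (INF x\<in>?K. f x)" using dense by blast
  then obtain \<delta> where \<delta>: "d = ennreal \<delta>" "\<delta> > 0" by (cases d) auto
  have "level_const f \<nu> \<noteq> 0"
  proof
    assume zero: "level_const f \<nu> = 0"
    obtain s where s: "level_const \<tau> \<nu> = ennreal s" "s > 0" by (rule tau_level)
    have meas: "{x \<in> space \<nu>. ennreal \<delta> \<le> f x} \<in> sets \<nu>"
      by (intro borel_measurable_le borel_measurable_const measurable_nu H_measurable[OF H])
    have "f x \<ge> ennreal \<delta>" if "\<tau> x > 1" for x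
    proof -
      have "(INF x\<in>?K. f x) \<le> f x" using that by (intro INF_lower) auto
      then show ?thesis using d(2) \<delta>(1) by (metis less_le_trans less_imp_le)
    qed
    then have "level_const \<tau> \<nu> \<le> emeasure \<nu> {x \<in> space \<nu>. ennreal \<delta> \<le> f x}"
      unfolding level_const_def by (intro emeasure_mono meas) auto
    also have "\<dots> = 0" using emeasure_ge[OF H \<delta>(2)] zero by (simp add: level_const_eq[OF H])
    finally show False using s by simp
  qed
  then show ?thesis using that fin by (cases "level_const f \<nu>") (auto simp: less_le)
qed

text \<open>Removing the closure of the discontinuities, and not just the discontinuities, leaves an
  open set. Since \<open>- D\<close> is open, limits within \<open>- D\<close> are full limits
  there.\<close>

lemma continuity_set:
  assumes C: "assumption_C D \<nu> f"
  obtains O' where "open O'" "O' \<subseteq> - D" "AE x in \<nu>. x \<in> O'" "\<And>x. x \<in> O' \<Longrightarrow> (f \<longlongrightarrow> f x) (at x)"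
proof -
  let ?E = "closure {x \<in> - D. \<not> (f \<longlongrightarrow> f x) (at x within - D)}"
  have openD: "open (- D)" using closed_D by (simp add: open_Compl)
  show ?thesis
  proof (rule that[of "- D - ?E"])
    show "open (- D - ?E)" using openD by (intro open_Diff) auto
    have "?E \<inter> - D \<in> sets \<nu>" using D_borel by (simp add: sets_nu_iff)
    then have "AE x in \<nu>. x \<notin> ?E \<inter> - D"
      using C by (intro AE_not_in) (simp add: null_sets_def assumption_C_def)
    then show "AE x in \<nu>. x \<in> - D - ?E"
      using AE_space by eventually_elim (auto simp: space_nu)
    fix x assume x: "x \<in> - D - ?E"
    then have "(f \<longlongrightarrow> f x) (at x within - D)"
      using closure_subset[of "{x \<in> - D. \<not> (f \<longlongrightarrow> f x) (at x within - D)}"] by blast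
    then show "(f \<longlongrightarrow> f x) (at x)"
      using x at_within_open[OF _ openD, of x] by simp
  qed auto
qed

text \<open>The upper half of the portmanteau theorem for the compact set
  \<open>closure {x. ennreal y \<le> f x}\<close>: test functions equal to 1 on it decrease to its
  indicator, so one of them has integral below \<open>c\<close>, and vague convergence carries this
  to large \<open>n\<close>.\<close>

lemma exceedance_limit:
  fixes M :: "'z measure"
  assumes rv: "regularly_varying \<alpha> a D \<nu> M X"
    and H: "assumption_H f" and F: "assumption_F D f" and C: "assumption_C D \<nu> f"
    and level: "level_const f \<nu> = ennreal C" "C > 0" and y: "y > 0" and c: "c > C * y powr (- \<alpha>)"
  shows "\<forall>\<^sub>F n in sequentially. emeasure M {\<omega> \<in> space M. ennreal y \<le> f (emb (X \<omega> /\<^sub>R a n))} \<le> ennreal (c / real n)"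
proof -
  have X [measurable]: "X \<in> borel_measurable M" and M: "prob_space M" using rv by (auto simp: regularly_varying_def)
  interpret prob_space M by fact
  note [measurable] = H_measurable[OF H]
  let ?K = "closure {x. ennreal y \<le> f x}"
  note K = assumption_F_closure[OF F y]
  have K_sets: "?K \<in> sets \<nu>" using K by (simp add: sets_nu_iff)
  have K_fin: "emeasure \<nu> ?K < \<infinity>" using radon K by (simp add: radon_off_def)
  obtain O' where O': "open O'" "O' \<subseteq> - D" "AE x in \<nu>. x \<in> O'" "\<And>x. x \<in> O' \<Longrightarrow> (f \<longlongrightarrow> f x) (at x)"
    using continuity_set[OF C] by blast
  \<comment> \<open>Taking the closure adds no mass: a continuity point with \<open>f x < y\<close>
    has a neighbourhood in which \<open>f\<close> stays below \<open>y\<close>.\<close>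
  have "AE x in \<nu>. x \<in> ?K \<longrightarrow> x \<in> {x \<in> space \<nu>. ennreal y \<le> f x}"
    using O'(3) AE_space
  proof eventually_elim
    case (elim x)
    show ?case
    proof (rule impI, rule ccontr)
      assume x: "x \<in> ?K" and "x \<notin> {x \<in> space \<nu>. ennreal y \<le> f x}"
      then have less: "f x < ennreal y" using elim by auto
      have "\<forall>\<^sub>F z in nhds x. f z < ennreal y"
        using O'(4)[OF elim(1), unfolded tendsto_at_iff_tendsto_nhds] less by (rule order_tendstoD(2))
      then obtain V where V: "open V" "x \<in> V" "\<And>z. z \<in> V \<Longrightarrow> f z < ennreal y"
        by (auto simp: eventually_nhds)
      have "V \<inter> {x. ennreal y \<le> f x} = {}" using V(3) by (auto simp: not_le[symmetric])
      then have "V \<inter> ?K = {}" using open_Int_closure_eq_empty[OF V(1)] by blast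
      then show False using V(2) x by blast
    qed
  qed
  moreover have "{x \<in> space \<nu>. ennreal y \<le> f x} \<in> sets \<nu>"
    by (intro borel_measurable_le borel_measurable_const measurable_nu H_measurable[OF H])
  ultimately have "emeasure \<nu> ?K \<le> emeasure \<nu> {x \<in> space \<nu>. ennreal y \<le> f x}"
    by (rule emeasure_mono_AE)
  also have "\<dots> = ennreal (C * y powr (- \<alpha>))"
    using emeasure_ge[OF H y] level by (simp add: level_const_eq[OF H, symmetric] ennreal_mult mult.commute)
  finally have K_le: "measure \<nu> ?K \<le> C * y powr (- \<alpha>)"
    using level by (simp add: measure_def enn2real_leI)
  obtain v where v: "\<And>j. test_fun D (v j)" "\<And>j x. x \<in> ?K \<Longrightarrow> v j x = 1" "\<And>j x. v j x \<le> v 0 x"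
    "\<And>x. (\<lambda>j. v j x) \<longlonglongrightarrow> indicator ?K x"
    using decreasing_test_funs[OF closed_D D_nonempty K] by blast
  have "(\<lambda>j. \<integral>x. v j x \<partial>\<nu>) \<longlonglongrightarrow> (\<integral>x. indicator ?K x \<partial>\<nu>)"
  proof (rule integral_dominated_convergence[where w = "v 0"])
    show "(\<lambda>x. indicator ?K x :: real) \<in> borel_measurable \<nu>" using K_sets by simp
    show "v j \<in> borel_measurable \<nu>" for j by (rule measurable_nu[OF test_funD(4)[OF v(1)]])
    show "integrable \<nu> (v 0)" by (rule integrable_test_fun(1)[OF radon v(1)])
    show "AE x in \<nu>. norm (v j x) \<le> v 0 x" for j using v(3) test_funD(2)[OF v(1)] by auto
  qed (use v(4) in auto)
  also have "(\<integral>x. indicator ?K x \<partial>\<nu>) = measure \<nu> ?K"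
    using K_sets K_fin sets.sets_into_space[OF K_sets] by (simp add: Int_absorb2)
  finally have lim: "(\<lambda>j. \<integral>x. v j x \<partial>\<nu>) \<longlonglongrightarrow> measure \<nu> ?K" .
  have "\<forall>\<^sub>F j in sequentially. (\<integral>x. v j x \<partial>\<nu>) < c"
    by (rule order_tendstoD(2)[OF lim]) (use K_le c in linarith)
  then obtain j where j: "(\<integral>x. v j x \<partial>\<nu>) < c" by (auto simp: eventually_sequentially)
  have "\<forall>\<^sub>F n in sequentially. real n * (\<integral>\<omega>. v j (emb (X \<omega> /\<^sub>R a n)) \<partial>M) < c"
    by (rule order_tendstoD(2)[OF regularly_varying_test_fun[OF rv v(1)] j])
  then show ?thesis using eventually_ge_at_top[of 1]
  proof eventually_elim
    case (elim n)
    note [measurable] = test_funD(4)[OF v(1), of j]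
    have "emeasure M {\<omega> \<in> space M. ennreal y \<le> f (emb (X \<omega> /\<^sub>R a n))} =
        (\<integral>\<^sup>+\<omega>. indicator {\<omega> \<in> space M. ennreal y \<le> f (emb (X \<omega> /\<^sub>R a n))} \<omega> \<partial>M)"
      by (rule nn_integral_indicator[symmetric]) measurable
    also have "\<dots> \<le> (\<integral>\<^sup>+\<omega>. ennreal (v j (emb (X \<omega> /\<^sub>R a n))) \<partial>M)"
    proof (rule nn_integral_mono)
      fix \<omega>
      have "v j x = 1" if "ennreal y \<le> f x" for x
        using v(2)[of x j] that closure_subset[of "{x. ennreal y \<le> f x}"] by blast
      then show "indicator {\<omega> \<in> space M. ennreal y \<le> f (emb (X \<omega> /\<^sub>R a n))} \<omega> \<le> ennreal (v j (emb (X \<omega> /\<^sub>R a n)))"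
        by (auto simp: indicator_def)
    qed
    also have "\<dots> = ennreal (\<integral>\<omega>. v j (emb (X \<omega> /\<^sub>R a n)) \<partial>M)"
      using test_funD(2,3)[OF v(1)] by (intro nn_integral_eq_integral integrable_const_bound[of _ 1]) auto
    also have "\<dots> \<le> ennreal (c / real n)"
      using elim by (intro ennreal_leI) (simp add: field_simps)
    finally show ?case .
  qed
qed

text \<open>\<open>exceedance_limit\<close> gives the bound at one level at a time, with an index
  depending on the level. Uniformity is added by \<open>uniform_lower_bound\<close>, because the
  level used later is the loss at the sample point.\<close>

lemma argmax_probability_lower:
  fixes M :: "'z measure"
  assumes rv: "regularly_varying \<alpha> a D \<nu> M X"
    and H: "assumption_H f" and F: "assumption_F D f" and C: "assumption_C D \<nu> f"
    and level: "level_const f \<nu> = ennreal C" "C > 0" and \<epsilon>: "\<epsilon> > 0"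
  shows "\<forall>\<^sub>F n in sequentially. \<forall>y>0. exp (- (C * y powr (- \<alpha>))) - \<epsilon> \<le>
    measure M {\<omega> \<in> space M. f (emb (X \<omega> /\<^sub>R a n)) < ennreal y} ^ (n - 1)"
proof -
  have X [measurable]: "X \<in> borel_measurable M" and M: "prob_space M" using rv by (auto simp: regularly_varying_def)
  interpret prob_space M by fact
  note [measurable] = H_measurable[OF H]
  show ?thesis
  proof (rule uniform_lower_bound[OF frechet_cdf_properties[OF level(2) \<alpha>] _ _ _ \<epsilon>])
    show "measure M {\<omega> \<in> space M. f (emb (X \<omega> /\<^sub>R a n)) < ennreal y} ^ (n - 1) \<le>
        measure M {\<omega> \<in> space M. f (emb (X \<omega> /\<^sub>R a n)) < ennreal z} ^ (n - 1)" if "0 < y" "y \<le> z" for n y z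
      using that by (intro power_mono finite_measure_mono) (auto dest: less_le_trans intro: ennreal_leI)
    show "0 \<le> measure M {\<omega> \<in> space M. f (emb (X \<omega> /\<^sub>R a n)) < ennreal y} ^ (n - 1)" for n y by simp
    fix y \<eta> :: real assume y: "y > 0" and \<eta>: "\<eta> > 0"
    define t where "t = C * y powr (- \<alpha>)"
    have t: "t \<ge> 0" using level by (simp add: t_def)
    \<comment> \<open>\<open>exceedance_limit\<close> needs \<open>c\<close> strictly above
      \<open>t\<close>. Raising the exponent by \<open>\<eta> / 2\<close> lowers
      \<open>exp (- t)\<close> by at most \<open>\<eta> / 2\<close>, which stays strictly within the
      tolerance.\<close>
    define c where "c = t + \<eta> / 2"
    have "exp (- t) - \<eta> < exp (- c)"
    proof -
      have "exp (- t) * (1 - \<eta> / 2) \<le> exp (- t) * exp (- (\<eta> / 2))"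
        using exp_ge_add_one_self[of "- (\<eta> / 2)"] by (intro mult_left_mono) auto
      also have "\<dots> = exp (- c)" by (simp add: c_def exp_add[symmetric])
      finally have "exp (- t) - exp (- t) * (\<eta> / 2) \<le> exp (- c)" by (simp add: right_diff_distrib)
      moreover have "exp (- t) * (\<eta> / 2) \<le> 1 * (\<eta> / 2)" using t \<eta> by (intro mult_right_mono) auto
      ultimately show ?thesis using \<eta> by linarith
    qed
    then have "\<forall>\<^sub>F n in sequentially. exp (- t) - \<eta> < max 0 (1 - c / real n) ^ n"
      by (rule order_tendstoD(1)[OF power_one_minus_tendsto_exp])
    moreover have "c > C * y powr (- \<alpha>)" using \<eta> by (simp add: c_def t_def)
    note exceedance_limit[OF rv H F C level y this]
    ultimately show "\<forall>\<^sub>F n in sequentially. exp (- (C * y powr (- \<alpha>))) - \<eta> \<le>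
        measure M {\<omega> \<in> space M. f (emb (X \<omega> /\<^sub>R a n)) < ennreal y} ^ (n - 1)"
      using eventually_ge_at_top[of 1]
    proof eventually_elim
      case (elim n)
      have "ennreal (max 0 (1 - c / real n) ^ n) \<le> emeasure M {\<omega> \<in> space M. f (emb (X \<omega> /\<^sub>R a n)) < ennreal y} ^ (n - 1)"
        using elim t \<eta> by (intro emeasure_less_ge[OF M]) (auto simp: c_def)
      then have "max 0 (1 - c / real n) ^ n \<le> measure M {\<omega> \<in> space M. f (emb (X \<omega> /\<^sub>R a n)) < ennreal y} ^ (n - 1)"
        by (simp add: emeasure_eq_measure ennreal_power)
      then show ?case using elim(1) by (simp add: t_def)
    qed
  qed auto
qed

text \<open>\<open>\<Phi>\<close> has compact support off \<open>D\<close>, so its scaled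
  expectations converge by vague convergence; \<open>u\<close> is only bounded and continuous and is
  handled by convergence in distribution. For large \<open>n\<close> the inequality between them is
  \<open>argmax_lower_bound\<close> with the uniform probability bound inserted.\<close>

lemma implicit_limit_lower_test:
  fixes M :: "'z measure"
  assumes rv: "regularly_varying \<alpha> a D \<nu> M X" and ind: "independent_copies M X Xs"
    and H: "assumption_H f" and F: "assumption_F D f" and C: "assumption_C D \<nu> f"
    and level: "level_const f \<nu> = ennreal C" "C > 0" and \<epsilon>: "\<epsilon> > 0"
    and conv: "conv_in_distr (\<lambda>n. distr M borel (\<lambda>\<omega>. Xs (argmax_index f Xs n \<omega>) \<omega> /\<^sub>R a n)) \<mu>"
    and u: "continuous_on UNIV u" "\<And>x. 0 \<le> u x \<and> u x \<le> 1"
    and \<Phi>: "test_fun D \<Phi>" "\<And>x. \<Phi> x > 0 \<Longrightarrow> \<exists>y>0. f x = ennreal y \<and> \<Phi> x \<le> u x * max 0 (exp (- (C * y powr (- \<alpha>))) - \<epsilon>)"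
  shows "(\<integral>x. \<Phi> x \<partial>\<nu>) \<le> (\<integral>y. u (emb y) \<partial>\<mu>)"
proof -
  have X [measurable]: "X \<in> borel_measurable M" and M: "prob_space M" and a: "\<And>n. n \<ge> 1 \<Longrightarrow> a n > 0"
    using rv by (auto simp: regularly_varying_def)
  interpret prob_space M by fact
  note [measurable] = H_measurable[OF H]
  have [measurable]: "u \<in> borel_measurable borel" by (rule borel_measurable_continuous_onI[OF u(1)])
  note [measurable] = test_funD(4)[OF \<Phi>(1)]
  let ?ex = "\<lambda>n \<omega>. Xs (argmax_index f Xs n \<omega>) \<omega> /\<^sub>R a n"
  have exm: "?ex n \<in> borel_measurable M" if "n \<ge> 1" for n
    using measurable_argmax[OF M ind _ that, of f] by measurable
  have lim_u: "(\<lambda>n. \<integral>y. u (emb y) \<partial>distr M borel (?ex n)) \<longlonglongrightarrow> (\<integral>y. u (emb y) \<partial>\<mu>)"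
  proof -
    have "continuous_on UNIV (\<lambda>y. u (emb y))" by (intro continuous_on_compose2[OF u(1) continuous_emb]) auto
    moreover have "bounded (range (\<lambda>y. u (emb y)))" using u(2) by (auto simp: bounded_iff intro!: exI[of _ 1])
    ultimately show ?thesis using conv unfolding conv_in_distr_def by blast
  qed
  have "\<forall>\<^sub>F n in sequentially. real n * (\<integral>\<omega>. \<Phi> (emb (X \<omega> /\<^sub>R a n)) \<partial>M) \<le> (\<integral>y. u (emb y) \<partial>distr M borel (?ex n))"
    using argmax_probability_lower[OF rv H F C level \<epsilon>] eventually_ge_at_top[of 1]
  proof eventually_elim
    case (elim n)
    let ?p = "\<lambda>y. emeasure M {\<omega>' \<in> space M. f (emb (X \<omega>' /\<^sub>R a n)) < y}"
    have le: "ennreal (\<Phi> x) \<le> ennreal (u x) * ?p (f x) ^ (n - 1)" for x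
    proof (cases "\<Phi> x > 0")
      case True
      then obtain y where y: "y > 0" "f x = ennreal y" "\<Phi> x \<le> u x * max 0 (exp (- (C * y powr (- \<alpha>))) - \<epsilon>)"
        using \<Phi>(2) by blast
      have "max 0 (exp (- (C * y powr (- \<alpha>))) - \<epsilon>) \<le> measure M {\<omega> \<in> space M. f (emb (X \<omega> /\<^sub>R a n)) < ennreal y} ^ (n - 1)"
        using elim(1) y(1) by simp
      then have "\<Phi> x \<le> u x * measure M {\<omega> \<in> space M. f (emb (X \<omega> /\<^sub>R a n)) < ennreal y} ^ (n - 1)"
        using y(3) u(2)[of x] by (meson mult_left_mono order_trans)
      then have "ennreal (\<Phi> x) \<le> ennreal (u x * measure M {\<omega> \<in> space M. f (emb (X \<omega> /\<^sub>R a n)) < ennreal y} ^ (n - 1))"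
        by (rule ennreal_leI)
      then show ?thesis using u(2)[of x] by (simp add: y(2) emeasure_eq_measure ennreal_mult ennreal_power)
    next
      case False
      then show ?thesis by (simp add: ennreal_neg)
    qed
    have "ennreal (real n * (\<integral>\<omega>. \<Phi> (emb (X \<omega> /\<^sub>R a n)) \<partial>M)) = of_nat n * (\<integral>\<^sup>+\<omega>. ennreal (\<Phi> (emb (X \<omega> /\<^sub>R a n))) \<partial>M)"
    proof -
      have "(\<integral>\<^sup>+\<omega>. ennreal (\<Phi> (emb (X \<omega> /\<^sub>R a n))) \<partial>M) = ennreal (\<integral>\<omega>. \<Phi> (emb (X \<omega> /\<^sub>R a n)) \<partial>M)"
        using test_funD(2,3)[OF \<Phi>(1)] by (intro nn_integral_eq_integral integrable_const_bound[of _ 1]) auto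
      then show ?thesis
        using test_funD(2)[OF \<Phi>(1)] by (simp add: ennreal_mult' ennreal_of_nat_eq_real_of_nat)
    qed
    also have "\<dots> \<le> of_nat n * (\<integral>\<^sup>+\<omega>. ennreal (u (emb (X \<omega> /\<^sub>R a n))) * ?p (f (emb (X \<omega> /\<^sub>R a n))) ^ (n - 1) \<partial>M)"
      by (intro mult_left_mono nn_integral_mono le) auto
    also have "\<dots> \<le> (\<integral>\<^sup>+\<omega>. ennreal (u (emb (?ex n \<omega>))) \<partial>M)"
      by (rule Xs_argmax_scaled_lower[OF M X ind H _ elim(2) a[OF elim(2)], of "\<lambda>y. ennreal (u (emb y))"]) measurable
    also have "\<dots> = ennreal (\<integral>\<omega>. u (emb (?ex n \<omega>)) \<partial>M)"
    proof -
      note [measurable] = exm[OF elim(2)]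
      show ?thesis using u(2) by (intro nn_integral_eq_integral integrable_const_bound[of _ 1]) auto
    qed
    also have "(\<integral>\<omega>. u (emb (?ex n \<omega>)) \<partial>M) = (\<integral>y. u (emb y) \<partial>distr M borel (?ex n))"
      by (rule integral_distr[OF exm[OF elim(2)], symmetric]) measurable
    finally show ?case
      using u(2) by (subst (asm) ennreal_le_iff) (auto intro!: integral_nonneg_AE)
  qed
  then show ?thesis
    by (rule tendsto_le[OF sequentially_bot lim_u regularly_varying_test_fun[OF rv \<Phi>(1)]])
qed

text \<open>The product of \<open>u\<close> and the density need not be a test function: it may be
  discontinuous, and its support may reach \<open>D\<close>. It is approximated from below by the
  test functions \<open>\<Phi> k\<close>, and Fatou's lemma passes the bound to the limit.\<close>

lemma implicit_limit_lower:
  fixes M :: "'z measure"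
  assumes rv: "regularly_varying \<alpha> a D \<nu> M X" and ind: "independent_copies M X Xs"
    and H: "assumption_H f" and F: "assumption_F D f" and C: "assumption_C D \<nu> f"
    and level: "level_const f \<nu> = ennreal C" "C > 0"
    and \<mu>: "prob_space \<mu>" "sets \<mu> = sets borel"
    and conv: "conv_in_distr (\<lambda>n. distr M borel (\<lambda>\<omega>. Xs (argmax_index f Xs n \<omega>) \<omega> /\<^sub>R a n)) \<mu>"
    and u: "continuous_on UNIV u" "\<And>x. 0 \<le> u x \<and> u x \<le> 1"
  shows "(\<integral>\<^sup>+x. ennreal (u x) * implicit_ev_density \<alpha> f \<nu> x \<partial>\<nu>) \<le> (\<integral>\<^sup>+y. ennreal (u (emb y)) \<partial>\<mu>)"
proof -
  interpret \<mu>: prob_space \<mu> by fact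
  note [measurable_cong] = \<mu>(2)
  note [measurable] = H_measurable[OF H]
  have [measurable]: "u \<in> borel_measurable borel" by (rule borel_measurable_continuous_onI[OF u(1)])
  obtain O1 where O1: "open O1" "O1 \<subseteq> - D" "AE x in \<nu>. x \<in> O1" "\<And>x. x \<in> O1 \<Longrightarrow> (f \<longlongrightarrow> f x) (at x)"
    using continuity_set[OF C] by blast
  have cont1: "continuous_on O1 f"
    unfolding continuous_on_def using O1(4) by (auto intro: tendsto_within_subset)
  \<comment> \<open>On \<open>U\<close> the loss is continuous, finite and positive, hence the
    density is continuous. In the rest of \<open>O1\<close> either \<open>f\<close> and the density
    vanish, or \<open>f\<close> is infinite, which by \<open>assumption_H\<close> happens at
    infinite points only, a null set.\<close>
  define U where "U = f -` {0<..<\<infinity>} \<inter> O1"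
  have U: "open U" "U \<subseteq> - D"
  proof -
    show "open U" unfolding U_def using cont1 continuous_on_open_vimage[OF O1(1), of f] by simp
    show "U \<subseteq> - D" using O1(2) by (auto simp: U_def)
  qed
  have U_cases: "\<exists>y>0. f x = ennreal y" if "x \<in> U" for x
    using that by (cases "f x") (auto simp: U_def)
  define g where "g = (\<lambda>x. exp (- (C * enn2real (f x) powr (- \<alpha>))))"
  have g_cont: "continuous_on U g"
  proof -
    have "continuous_on U (\<lambda>x. enn2real (f x))"
      unfolding continuous_on_def
    proof
      fix x assume x: "x \<in> U"
      then obtain y where y: "y > 0" "f x = ennreal y" using U_cases by blast
      have "(f \<longlongrightarrow> ennreal y) (at x within U)"
        using O1(4)[of x] x y by (auto simp: U_def intro: tendsto_within_subset)
      then show "((\<lambda>x. enn2real (f x)) \<longlongrightarrow> enn2real (f x)) (at x within U)"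
        using y by (simp add: tendsto_enn2real)
    qed
    moreover have "enn2real (f x) \<noteq> 0" if "x \<in> U" for x using U_cases[OF that] by auto
    ultimately show ?thesis unfolding g_def by (intro continuous_intros) auto
  qed
  have UC: "- (- U) = U" "U \<subseteq> - (- U)" by auto
  \<comment> \<open>\<open>open_approx U k\<close> confines the support to a compact part of
    \<open>U\<close>, and subtracting \<open>1 / Suc k\<close> matches the tolerance in
    \<open>implicit_limit_lower_test\<close>. Both effects vanish as \<open>k\<close> grows.\<close>
  define \<Phi> where "\<Phi> = (\<lambda>k x. open_approx U k x * (u x * max 0 (g x - 1 / real (Suc k))))"
  have g_le: "g x \<le> 1" "g x > 0" for x using level by (simp_all add: g_def)
  have \<Phi>_le: "0 \<le> \<Phi> k x" "\<Phi> k x \<le> 1" for k x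
  proof -
    have "0 \<le> open_approx U k x" "open_approx U k x \<le> 1"
      using test_funD(2,3)[OF test_fun_open_approx[OF U D_nonempty]] by auto
    moreover have "max 0 (g x - 1 / real (Suc k)) \<le> 1"
    proof (rule max.boundedI)
      have "0 \<le> 1 / real (Suc k)" by simp
      then show "g x - 1 / real (Suc k) \<le> 1" using g_le(1)[of x] by linarith
    qed simp
    ultimately show "0 \<le> \<Phi> k x" "\<Phi> k x \<le> 1" using u(2)[of x] unfolding \<Phi>_def
      by (auto intro!: mult_nonneg_nonneg mult_le_one)
  qed
  have \<Phi>_test: "test_fun D (\<Phi> k)" for k
  proof -
    have "\<exists>K. compact K \<and> K \<subseteq> U \<and> (\<forall>x. x \<notin> K \<longrightarrow> open_approx U k x = 0)"
    proof -
      have "- U \<noteq> {}" using U(2) D_nonempty by auto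
      then have "test_fun (- U) (open_approx U k)" using test_fun_open_approx[OF U(1), of "- U"] by simp
      then show ?thesis by (auto simp: test_fun_def)
    qed
    then obtain K where K: "compact K" "K \<subseteq> U" "\<And>x. x \<notin> K \<Longrightarrow> open_approx U k x = 0" by blast
    \<comment> \<open>Continuity of \<open>g\<close> is known on \<open>U\<close> only, but
      \<open>\<Phi> k\<close> is 0 off the compact set \<open>K\<close>, and the open sets
      \<open>U\<close> and \<open>- K\<close> cover the space.\<close>
    have "continuous_on (U \<union> - K) (\<Phi> k)"
    proof (rule continuous_on_open_Un)
      show "open (- K)" using compact_imp_closed_ereal_fun[OF K(1)] by (simp add: open_Compl)
      show "continuous_on U (\<Phi> k)"
        unfolding \<Phi>_def
        by (intro continuous_intros g_cont continuous_on_subset[OF u(1)]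
            continuous_on_subset[OF test_funD(1)[OF test_fun_open_approx[OF U D_nonempty]]]) auto
      have "continuous_on (- K) (\<lambda>_. 0 :: real)" by (rule continuous_on_const)
      then show "continuous_on (- K) (\<Phi> k)"
        by (rule continuous_on_eq) (simp add: \<Phi>_def K(3))
    qed fact
    moreover have "U \<union> - K = UNIV" using K(2) by auto
    ultimately show ?thesis
      unfolding test_fun_def using \<Phi>_le K U(2) by (auto simp: \<Phi>_def intro!: exI[of _ K])
  qed
  have lower: "(\<integral>\<^sup>+x. ennreal (\<Phi> k x) \<partial>\<nu>) \<le> (\<integral>\<^sup>+y. ennreal (u (emb y)) \<partial>\<mu>)" for k
  proof -
    have "(\<integral>x. \<Phi> k x \<partial>\<nu>) \<le> (\<integral>y. u (emb y) \<partial>\<mu>)"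
    proof (rule implicit_limit_lower_test[OF rv ind H F C level _ conv u \<Phi>_test, of "1 / real (Suc k)"])
      fix x assume pos: "0 < \<Phi> k x"
      have "x \<in> U"
      proof (rule ccontr)
        assume "x \<notin> U"
        then have "open_approx U k x = 0" by (rule open_approx_outside[OF U D_nonempty])
        then have "\<Phi> k x = 0" by (simp only: \<Phi>_def mult_zero_left)
        then show False using pos by simp
      qed
      then obtain y where y: "y > 0" "f x = ennreal y" using U_cases by blast
      have "\<Phi> k x \<le> 1 * (u x * max 0 (g x - 1 / real (Suc k)))"
        unfolding \<Phi>_def using u(2)[of x] test_funD(3)[OF test_fun_open_approx[OF U D_nonempty]]
        by (intro mult_right_mono) auto
      then show "\<exists>y>0. f x = ennreal y \<and> \<Phi> k x \<le> u x * max 0 (exp (- (C * y powr (- \<alpha>))) - 1 / real (Suc k))"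
        using y by (intro exI[of _ y]) (simp add: g_def)
    qed simp
    moreover have "(\<integral>\<^sup>+y. ennreal (u (emb y)) \<partial>\<mu>) = ennreal (\<integral>y. u (emb y) \<partial>\<mu>)"
      using u(2) by (intro nn_integral_eq_integral \<mu>.integrable_const_bound[of _ 1]) auto
    ultimately show ?thesis
      using integrable_test_fun(2)[OF radon \<Phi>_test[of k]] by (simp add: ennreal_leI)
  qed
  have "(\<integral>\<^sup>+x. ennreal (u x) * implicit_ev_density \<alpha> f \<nu> x \<partial>\<nu>) \<le> (\<integral>\<^sup>+x. liminf (\<lambda>k. ennreal (\<Phi> k x)) \<partial>\<nu>)"
  proof (rule nn_integral_mono_AE, use O1(3) AE_finite in eventually_elim)
    fix x assume x: "x \<in> O1" "x \<in> range emb"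
    show "ennreal (u x) * implicit_ev_density \<alpha> f \<nu> x \<le> liminf (\<lambda>k. ennreal (\<Phi> k x))"
    proof (cases "f x = 0")
      case False
      have "f x < \<infinity>" using x(2) H_finite[OF H] by auto
      then have xU: "x \<in> U" using False x(1) by (simp add: U_def zero_less_iff_neq_zero)
      have "(\<lambda>k. 1 / real (Suc k)) \<longlonglongrightarrow> 0" by (rule lim_1_over_n[THEN LIMSEQ_Suc])
      then have "(\<lambda>k. \<Phi> k x) \<longlonglongrightarrow> indicator U x * (u x * max 0 (g x - 0))"
        unfolding \<Phi>_def by (intro tendsto_intros open_approx_tendsto[OF U D_nonempty])
      also have "indicator U x * (u x * max 0 (g x - 0)) = u x * g x" using xU g_le[of x] by simp
      finally have "(\<lambda>k. ennreal (\<Phi> k x)) \<longlonglongrightarrow> ennreal (u x * g x)" by (rule tendsto_ennrealI)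
      then have "liminf (\<lambda>k. ennreal (\<Phi> k x)) = ennreal (u x * g x)" by (intro lim_imp_Liminf) auto
      moreover have "ennreal (u x * g x) = ennreal (u x) * implicit_ev_density \<alpha> f \<nu> x"
        using False level u(2)[of x] g_le[of x] by (simp add: implicit_ev_density_def g_def ennreal_mult)
      ultimately show ?thesis by simp
    qed (simp add: implicit_ev_density_def)
  qed
  also have "\<dots> \<le> liminf (\<lambda>k. \<integral>\<^sup>+x. ennreal (\<Phi> k x) \<partial>\<nu>)"
    by (intro nn_integral_liminf measurable_compose[OF measurable_nu[OF test_funD(4)[OF \<Phi>_test]] measurable_ennreal])
  also have "\<dots> \<le> liminf (\<lambda>k. \<integral>\<^sup>+y. ennreal (u (emb y)) \<partial>\<mu>)"
    by (intro Liminf_mono always_eventually allI lower)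
  also have "\<dots> = (\<integral>\<^sup>+y. ennreal (u (emb y)) \<partial>\<mu>)" by (simp add: Liminf_const)
  finally show ?thesis .
qed

text \<open>The mass is read off from the law with polar representation for the matching
  \<open>g\<close>, which is a probability law and has the same integrals.\<close>

lemma density_mass_1:
  assumes H: "assumption_H f" and level: "level_const f \<nu> = ennreal C" "C > 0"
  shows "(\<integral>\<^sup>+x. implicit_ev_density \<alpha> f \<nu> x \<partial>\<nu>) = 1"
proof -
  let ?g = "\<lambda>\<theta>. C powr (- 1 / \<alpha>) * enn2real (f (emb \<theta>))"
  obtain \<mu> where \<mu>: "polar_representation \<alpha> \<tau> \<nu> \<mu> ?g"
    using ex_polar_representation[OF admissible_f[OF H level]] by blast
  have "(\<integral>\<^sup>+y. 1 \<partial>\<mu>) = (\<integral>\<^sup>+x. implicit_ev_density \<alpha> f \<nu> x \<partial>\<nu>)"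
    using polar_representation_integral[OF \<mu> H level refl, of "\<lambda>_. 1"] by simp
  moreover have "prob_space \<mu>" by (rule prob_space_polar_representation[OF \<mu>])
  ultimately show ?thesis by (simp add: prob_space.emeasure_space_1)
qed

text \<open>The lower bounds for \<open>h\<close> and for \<open>1 - h\<close> add up to 1 on both
  sides, so both are equalities, and test functions determine a measure off \<open>D\<close>. Since
  \<open>1 - h\<close> equals 1 on \<open>D\<close>, \<open>implicit_limit_lower\<close> has to
  admit every continuous function with values in the unit interval.\<close>

lemma implicit_limit_density:
  fixes M :: "'z measure"
  assumes lim: "implicit_extremes_limit \<alpha> a D f \<nu> M X Xs \<mu>"
    and H: "assumption_H f" and F: "assumption_F D f" and C: "assumption_C D \<nu> f"
    and level: "level_const f \<nu> = ennreal C" "C > 0"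
    and \<mu>: "prob_space \<mu>" "sets \<mu> = sets borel" "emeasure \<mu> (emb -` D) = 0"
  shows "restrict_space (distr \<mu> borel emb) (- D) = density \<nu> (implicit_ev_density \<alpha> f \<nu>)"
proof (rule radon_off_eqI)
  interpret \<mu>: prob_space \<mu> by fact
  note [measurable_cong] = \<mu>(2)
  note [measurable] = H_measurable[OF H]
  let ?d = "implicit_ev_density \<alpha> f \<nu>"
  let ?\<rho> = "restrict_space (distr \<mu> borel emb) (- D)"
  have rv: "regularly_varying \<alpha> a D \<nu> M X" and ind: "independent_copies M X Xs"
    and conv: "conv_in_distr (\<lambda>n. distr M borel (\<lambda>\<omega>. Xs (argmax_index f Xs n \<omega>) \<omega> /\<^sub>R a n)) \<mu>"
    using lim by (auto simp: implicit_extremes_limit_def)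
  note lower = implicit_limit_lower[OF rv ind H F C level \<mu>(1,2) conv]
  have dm: "?d \<in> borel_measurable \<nu>" by (intro measurable_nu implicit_ev_density_measurable H_measurable[OF H])
  have sets_\<rho>: "sets ?\<rho> = sets (restrict_space borel (- D))"
    by (simp cong: sets_restrict_space_cong)
  have dens_fin: "emeasure (density \<nu> ?d) A \<le> 1" for A
  proof -
    have "emeasure (density \<nu> ?d) A \<le> emeasure (density \<nu> ?d) (space (density \<nu> ?d))" by (rule emeasure_space)
    also have "\<dots> = (\<integral>\<^sup>+x. ?d x * indicator (space \<nu>) x \<partial>\<nu>)"
      using dm by (simp add: emeasure_density)
    also have "\<dots> = (\<integral>\<^sup>+x. ?d x \<partial>\<nu>)" by (intro nn_integral_cong) simp
    finally show ?thesis by (simp add: density_mass_1[OF H level])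
  qed
  have \<rho>_fin: "emeasure ?\<rho> A \<le> 1" for A
  proof -
    have "emeasure ?\<rho> A \<le> emeasure ?\<rho> (space ?\<rho>)" by (rule emeasure_space)
    also have "\<dots> = emeasure (distr \<mu> borel emb) (- D)"
      using D_borel by (subst emeasure_restrict_space) (auto simp: space_restrict_space)
    also have "\<dots> \<le> emeasure (distr \<mu> borel emb) (space (distr \<mu> borel emb))" by (rule emeasure_space)
    also have "\<dots> = 1" by (intro prob_space.emeasure_space_1 \<mu>.prob_space_distr) measurable
    finally show ?thesis .
  qed
  have less: "x \<le> 1 \<Longrightarrow> x < \<infinity>" for x :: ennreal by (rule le_less_trans) auto
  show "radon_off D ?\<rho>"
    unfolding radon_off_def using sets_\<rho> less[OF \<rho>_fin] by blast
  show "radon_off D (density \<nu> ?d)"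
    unfolding radon_off_def using less[OF dens_fin] sets_nu by auto
  fix h assume h: "test_fun D h"
  note hm [measurable] = test_funD(4)[OF h]
  have h\<nu>: "h \<in> borel_measurable \<nu>" by (rule measurable_nu[OF hm])
  have range: "0 \<le> h x \<and> h x \<le> 1" for x using test_funD(2,3)[OF h] by blast
  have cont': "continuous_on UNIV (\<lambda>x. 1 - h x)" by (intro continuous_intros test_funD(1)[OF h])
  have range': "0 \<le> 1 - h x \<and> 1 - h x \<le> 1" for x using range[of x] by simp
  have le1: "(\<integral>\<^sup>+x. ennreal (h x) * ?d x \<partial>\<nu>) \<le> (\<integral>\<^sup>+y. ennreal (h (emb y)) \<partial>\<mu>)"
    by (rule lower[OF test_funD(1)[OF h] range])
  have le2: "(\<integral>\<^sup>+x. ennreal (1 - h x) * ?d x \<partial>\<nu>) \<le> (\<integral>\<^sup>+y. ennreal (1 - h (emb y)) \<partial>\<mu>)"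
    by (rule lower[OF cont' range'])
  have split: "ennreal (h x) + ennreal (1 - h x) = 1" for x
    using range[of x] by (simp add: ennreal_plus[symmetric] del: ennreal_plus)
  have sum1: "(\<integral>\<^sup>+x. ennreal (h x) * ?d x \<partial>\<nu>) + (\<integral>\<^sup>+x. ennreal (1 - h x) * ?d x \<partial>\<nu>) = 1"
  proof -
    have "(\<integral>\<^sup>+x. ennreal (h x) * ?d x \<partial>\<nu>) + (\<integral>\<^sup>+x. ennreal (1 - h x) * ?d x \<partial>\<nu>) =
        (\<integral>\<^sup>+x. ennreal (h x) * ?d x + ennreal (1 - h x) * ?d x \<partial>\<nu>)"
      using dm h\<nu> by (intro nn_integral_add[symmetric]) auto
    also have "\<dots> = (\<integral>\<^sup>+x. ?d x \<partial>\<nu>)" by (simp add: distrib_right[symmetric] split)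
    finally show ?thesis by (simp add: density_mass_1[OF H level])
  qed
  have sum2: "(\<integral>\<^sup>+y. ennreal (h (emb y)) \<partial>\<mu>) + (\<integral>\<^sup>+y. ennreal (1 - h (emb y)) \<partial>\<mu>) = 1"
  proof -
    have "(\<integral>\<^sup>+y. ennreal (h (emb y)) \<partial>\<mu>) + (\<integral>\<^sup>+y. ennreal (1 - h (emb y)) \<partial>\<mu>) =
        (\<integral>\<^sup>+y. ennreal (h (emb y)) + ennreal (1 - h (emb y)) \<partial>\<mu>)"
      by (intro nn_integral_add[symmetric]) measurable
    also have "\<dots> = 1" by (simp add: split \<mu>.emeasure_space_1)
    finally show ?thesis .
  qed
  have eq: "(\<integral>\<^sup>+x. ennreal (h x) * ?d x \<partial>\<nu>) = (\<integral>\<^sup>+y. ennreal (h (emb y)) \<partial>\<mu>)"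
  proof (rule antisym[OF le1], rule ccontr)
    let ?A = "\<integral>\<^sup>+x. ennreal (h x) * ?d x \<partial>\<nu>" and ?B = "\<integral>\<^sup>+y. ennreal (h (emb y)) \<partial>\<mu>"
    let ?A' = "\<integral>\<^sup>+x. ennreal (1 - h x) * ?d x \<partial>\<nu>" and ?B' = "\<integral>\<^sup>+y. ennreal (1 - h (emb y)) \<partial>\<mu>"
    assume "\<not> ?B \<le> ?A"
    then have "?A < ?B" by simp
    have "?A' \<le> ?A + ?A'" by (rule add_increasing) auto
    then have "?A' \<le> 1" unfolding sum1 .
    \<comment> \<open>Adding \<open>?A'\<close> preserves the strict inequality only because
      \<open>?A'\<close> is finite.\<close>
    then have "?A' < \<infinity>" by (rule less)
    with \<open>?A < ?B\<close> have "?A' + ?A < ?A' + ?B" unfolding ennreal_add_left_cancel_less by simp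
    also have "\<dots> \<le> ?B' + ?B" using le2 by (rule add_right_mono)
    finally have "?A + ?A' < ?B + ?B'" by (simp only: add.commute)
    then show False unfolding sum1 sum2 by simp
  qed
  have "(\<integral>x. h x \<partial>?\<rho>) = enn2real (\<integral>\<^sup>+x. ennreal (h x) \<partial>?\<rho>)"
    using range by (intro integral_eq_nn_integral measurable_off[OF sets_\<rho> hm]) auto
  also have "(\<integral>\<^sup>+x. ennreal (h x) \<partial>?\<rho>) = (\<integral>\<^sup>+x. ennreal (h x) * indicator (- D) x \<partial>distr \<mu> borel emb)"
    using D_borel by (intro nn_integral_restrict_space) auto
  also have "\<dots> = (\<integral>\<^sup>+x. ennreal (h x) \<partial>distr \<mu> borel emb)"
    using test_funD(5)[OF h] by (intro nn_integral_cong) (auto simp: indicator_def)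
  also have "\<dots> = (\<integral>\<^sup>+y. ennreal (h (emb y)) \<partial>\<mu>)" by (rule nn_integral_distr) measurable
  also have "\<dots> = (\<integral>\<^sup>+x. ?d x * ennreal (h x) \<partial>\<nu>)" by (simp add: eq[symmetric] mult.commute)
  also have "\<dots> = (\<integral>\<^sup>+x. ennreal (h x) \<partial>density \<nu> ?d)"
    using h\<nu> by (intro nn_integral_density[symmetric] dm) auto
  also have "enn2real \<dots> = (\<integral>x. h x \<partial>density \<nu> ?d)"
    using range h\<nu> by (intro integral_eq_nn_integral[symmetric]) auto
  finally show "(\<integral>x. h x \<partial>?\<rho>) = (\<integral>x. h x \<partial>density \<nu> ?d)" .
qed

end

theorem proposition3p18:
  fixes D :: "('d::finite \<Rightarrow> ereal) set"
    and \<tau> :: "('d \<Rightarrow> ereal) \<Rightarrow> ennreal"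
    and \<alpha> :: real
    and \<nu> :: "('d \<Rightarrow> ereal) measure"
    and N :: "'b measure"
    and Y :: "'b \<Rightarrow> real ^ 'd"
  assumes D: "closed D" "is_cone D"
    and \<tau>: "radial_function D \<tau>"
    and \<alpha>: "\<alpha> > 0"
    and \<nu>: "measure_of_regular_variation \<alpha> D \<nu>"
    and N: "prob_space N"
    and Y: "Y \<in> borel_measurable N" "AE \<omega> in N. emb (Y \<omega>) \<notin> D"
  shows "((\<exists>f. implicit_ev_law \<alpha> D f \<nu> (distr N borel Y)) \<longleftrightarrow>
          (\<exists>g. polar_representation \<alpha> \<tau> \<nu> (distr N borel Y) g)) \<and>
         (\<forall>g g'. polar_representation \<alpha> \<tau> \<nu> (distr N borel Y) g \<and>
                polar_representation \<alpha> \<tau> \<nu> (distr N borel Y) g' \<longrightarrow>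
                (AE \<theta> in spectral_measure \<tau> \<nu>. g \<theta> = g' \<theta>)) \<and>
         (\<forall>f a (M :: 'a measure) X Xs.
           assumption_H f \<and> assumption_F D f \<and> assumption_C D \<nu> f \<and>
           implicit_extremes_limit \<alpha> a D f \<nu> M X Xs (distr N borel Y) \<longrightarrow>
           level_const f \<nu> < \<infinity> \<and>
           level_const f \<nu> =
             (\<integral>\<^sup>+ \<theta>. ennreal (enn2real (f (emb \<theta>)) powr \<alpha>) \<partial>spectral_measure \<tau> \<nu>) \<and>
           polar_representation \<alpha> \<tau> \<nu> (distr N borel Y)
             (\<lambda>\<theta>. enn2real (level_const f \<nu>) powr (- 1 / \<alpha>) * enn2real (f (emb \<theta>)))) \<and>
         (\<forall>g. admissible_g \<alpha> \<tau> \<nu> g \<longrightarrow>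
           emeasure (tilted_measure \<alpha> g (spectral_measure \<tau> \<nu>))
             {\<theta> \<in> tau_sphere \<tau>. g \<theta> = 0} = 0)"
proof -
  obtain M0 :: "(real ^ 'd) measure" and X0 a0 where rv: "regularly_varying \<alpha> a0 D \<nu> M0 X0"
    using \<nu> unfolding measure_of_regular_variation_def by blast
  interpret polar_space D \<tau>
    using D(1) \<tau> by unfold_locales
  \<comment> \<open>The law of \<open>X0\<close> witnesses regular variation and yields homogeneity.
    It is unrelated to the \<open>X\<close> of the claim about limits.\<close>
  interpret homogeneous_measure D \<tau> \<alpha> \<nu>
    using rv by unfold_locales
      (auto simp: regularly_varying_def \<alpha> intro: regularly_varying_scaling[OF rv \<alpha>])
  interpret N: prob_space N by (rule N)
  let ?\<mu> = "distr N borel Y"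
  have \<mu>: "prob_space ?\<mu>" "sets ?\<mu> = sets borel" by (simp_all add: N.prob_space_distr[OF Y(1)])
  have "emb -` D \<in> sets borel" using measurable_sets[OF measurable_emb D_borel] by simp
  then have off: "emeasure ?\<mu> (emb -` D) = 0"
    using Y(2) by (subst emeasure_distr[OF Y(1)], simp)
      (subst AE_iff_measurable[symmetric, where P = "\<lambda>\<omega>. emb (Y \<omega>) \<notin> D"],
        auto intro!: measurable_sets[OF Y(1)])
  \<comment> \<open>Shared by the equivalence, where the density identity is part of being an
    implicit extreme value law, and by the claim about limits, where it has to be derived from F and
    C.\<close>
  have fwd: "polar_representation \<alpha> \<tau> \<nu> ?\<mu>
      (\<lambda>\<theta>. enn2real (level_const f \<nu>) powr (- 1 / \<alpha>) * enn2real (f (emb \<theta>)))"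
    if f: "assumption_H f" "level_const f \<nu> = ennreal C" "C > 0"
      and dens: "restrict_space (distr ?\<mu> borel emb) (- D) = density \<nu> (implicit_ev_density \<alpha> f \<nu>)" for f C
    using polar_representation_iff_density[OF f admissible_f[OF f] refl \<mu>(2) off] dens f(2,3) by simp
  have iff: "(\<exists>f. implicit_ev_law \<alpha> D f \<nu> ?\<mu>) \<longleftrightarrow> (\<exists>g. polar_representation \<alpha> \<tau> \<nu> ?\<mu> g)"
  proof
    assume "\<exists>f. implicit_ev_law \<alpha> D f \<nu> ?\<mu>"
    then obtain f where f: "assumption_H f" "level_const f \<nu> < \<infinity>"
      and dens: "restrict_space (distr ?\<mu> borel emb) (- D) = density \<nu> (implicit_ev_density \<alpha> f \<nu>)"
      unfolding implicit_ev_law_def by blast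
    \<comment> \<open>If the constant were 0, the loss and with it the density would vanish
      \<nu>-almost everywhere, and a probability law would have mass 0.\<close>
    have "level_const f \<nu> \<noteq> 0"
    proof
      assume zero: "level_const f \<nu> = 0"
      have "(\<integral>\<^sup>+y. 1 \<partial>?\<mu>) = (\<integral>\<^sup>+x. 1 * implicit_ev_density \<alpha> f \<nu> x \<partial>\<nu>)"
        using law_eq_density_iff[OF \<mu>(2) off implicit_ev_density_measurable[OF H_measurable[OF f(1)]],
            THEN iffD1, OF dens]
        by (rule bspec) (rule borel_measurable_const)
      also have "\<dots> = (\<integral>\<^sup>+x. 0 \<partial>\<nu>)"
        using AE_zero_if_level_zero[OF f(1) zero]
        by (intro nn_integral_cong_AE) (auto elim!: eventually_mono simp: implicit_ev_density_def)
      finally show False using prob_space.emeasure_space_1[OF \<mu>(1)] by simp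
    qed
    then obtain C where "level_const f \<nu> = ennreal C" "C > 0"
      using f(2) by (cases "level_const f \<nu>") (auto simp: less_le)
    from fwd[OF f(1) this dens] show "\<exists>g. polar_representation \<alpha> \<tau> \<nu> ?\<mu> g" by blast
  next
    assume "\<exists>g. polar_representation \<alpha> \<tau> \<nu> ?\<mu> g"
    then obtain g where g: "polar_representation \<alpha> \<tau> \<nu> ?\<mu> g" by blast
    then have adm: "admissible_g \<alpha> \<tau> \<nu> g" by (simp add: polar_representation_def)
    note H = assumption_H_homogeneous_ext[OF adm]
    \<comment> \<open>The normalization of \<open>g\<close> gives the constant 1, so the factor
      C^(-1/\<alpha>) disappears and the loss restricted to the sphere is \<open>g\<close>
      itself.\<close>
    have level: "level_const (homogeneous_ext g) \<nu> = ennreal 1"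
      using level_const_homogeneous_ext[OF adm] by simp
    have "restrict_space (distr ?\<mu> borel emb) (- D) = density \<nu> (implicit_ev_density \<alpha> (homogeneous_ext g) \<nu>)"
      using polar_representation_iff_density[OF H level _ adm _ \<mu>(2) off] g adm
      by (simp add: homogeneous_ext_S admissible_g_def)
    then have "implicit_ev_law \<alpha> D (homogeneous_ext g) \<nu> ?\<mu>"
      by (intro implicit_ev_lawI[OF H level _ \<mu> off]) simp_all
    then show "\<exists>f. implicit_ev_law \<alpha> D f \<nu> ?\<mu>" by blast
  qed
  have limit: "level_const f \<nu> < \<infinity> \<and>
      level_const f \<nu> = (\<integral>\<^sup>+ \<theta>. ennreal (enn2real (f (emb \<theta>)) powr \<alpha>) \<partial>spectral_measure \<tau> \<nu>) \<and>
      polar_representation \<alpha> \<tau> \<nu> ?\<mu>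
        (\<lambda>\<theta>. enn2real (level_const f \<nu>) powr (- 1 / \<alpha>) * enn2real (f (emb \<theta>)))"
    if f: "assumption_H f" "assumption_F D f" "assumption_C D \<nu> f"
      and lim: "implicit_extremes_limit \<alpha> a D f \<nu> M X Xs ?\<mu>"
    for f a and M :: "'a measure" and X Xs
  proof -
    obtain C where C: "level_const f \<nu> = ennreal C" "C > 0"
      by (rule level_const_finite_pos[OF f(1,2)])
    have "level_const f \<nu> < \<infinity>" using C(1) by simp
    then show ?thesis
      using fwd[OF f(1) C implicit_limit_density[OF lim f C \<mu> off]] level_const_eq[OF f(1)]
      unfolding f_moment_def by blast
  qed
  show ?thesis
    using iff polar_representation_unique limit tilted_zero_set by blast
qed

end
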